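(* Let $n\ge 1$, let $W$ be the Weyl group of type $A_n$ (the symmetric group on $n+1$ letters) with simple reflections $S$, and let $\mathcal{C}(v)$ be the associated braid-image subalgebra of the algebra of braids and ties $\mathcal{E}(v)$. When considered as an algebra over $\mathbb{C}(v)$, there is an explicit formula for the dimension of the algebra $\mathcal{C}(v)$ given by $$\dim \mathcal{C}(v)=|W|\sum_{I\subset S}D_I/N_I,$$ where $N_I$ is the size of the normalizer of the standard parabolic subgroup of $W$ associated to $I\subset S$, and $D_I$ is the number of elements $w\in W$ such that for each contiguous block $I'\subset I$, there is a simple reflection $s\in I'$ for which $\ell(ws)<\ell(w)$. This gives a general formula which continues the sequence of dimensions $1,\,3,\,20,\,217,\,3364,\dots$ given by Marin (the values $3,20,217,3364$ being those for $n=1,2,3,4$).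
   Context: $\ell$ is the Coxeter length function on $W$. The standard parabolic subgroup associated to $I\subset S$ is the subgroup $W_I$ of $W$ generated by $I$. A contiguous block of $I\subset S$ is the vertex set of a connected component of the subdiagram of the Dynkin diagram of type $A_n$ spanned by $I$ (so for $I=\emptyset$ there are no blocks and $D_\emptyset=|W|$). The algebra $\mathcal{E}(v)$ is the $\mathbb{C}(v)$-algebra with generators $g_s$ ($s\in S$) and $e_r$ ($r\in W$ a reflection), and relations: $g_sg_tg_s\cdots=g_tg_sg_t\cdots$ ($m_{st}$ factors on each side, $m_{st}$ the order of $st$) for $s,t\in S$; $e_r^2=e_r$ for every reflection $r$; $e_{r_1}e_{r_2}=e_{r_2}e_{r_1}$ and $e_{r_1}e_{r_2}=e_{r_1}e_{r_1^{-1}r_2r_1}$ for all reflections $r_1,r_2$; $g_se_r=e_{srs}g_s$ for $s\in S$ and every reflection $r$; and $g_s^2=1+(v^2-1)e_s(1+g_s)$ for $s\in S$. (In type $A$ the further relation appearing in the definition for general types is redundant.) $\mathcal{C}(v)$ is the subalgebra of $\mathcal{E}(v)$ generated by the $g_s$, $s\in S$.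
   Formalization: The sum runs over one I ⊂ S for each conjugacy class of standard parabolic subgroups, not over all I ⊂ S: summing over all subsets gives 29 instead of the dimension 20 for n=2. *)

theory Defs
  imports
    "HOL-Algebra.Algebra"
    "HOL-Library.Poly_Mapping"
    "HOL-Computational_Algebra.Computational_Algebra"
begin

section \<open>Coxeter groups\<close>

text \<open>
  A group \<open>G\<close> is given together with its set \<open>S\<close> of simple reflections.
\<close>

definition coxeter_length :: "('w, 'm) monoid_scheme \<Rightarrow> 'w set \<Rightarrow> 'w \<Rightarrow> nat" where
  "coxeter_length G S w =
     (LEAST k. \<exists>xs. length xs = k \<and> set xs \<subseteq> S \<and> foldr (\<otimes>\<^bsub>G\<^esub>) xs \<one>\<^bsub>G\<^esub> = w)"

definition reflections :: "('w, 'm) monoid_scheme \<Rightarrow> 'w set \<Rightarrow> 'w set" where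
  "reflections G S = {w \<otimes>\<^bsub>G\<^esub> s \<otimes>\<^bsub>G\<^esub> inv\<^bsub>G\<^esub> w | w s. w \<in> carrier G \<and> s \<in> S}"

definition dynkin_edges :: "('w, 'm) monoid_scheme \<Rightarrow> 'w set \<Rightarrow> ('w \<times> 'w) set" where
  "dynkin_edges G S =
     {(s, t). s \<in> S \<and> t \<in> S \<and> s \<noteq> t \<and> group.ord G (s \<otimes>\<^bsub>G\<^esub> t) \<noteq> 2}"

text \<open>
  For \<open>I \<subseteq> S\<close>: the vertex sets of the connected components of the subdiagram spanned by \<open>I\<close>,
  as classes of \<open>I\<close> under reachability inside \<open>I\<close>.
\<close>

definition blocks :: "('w, 'm) monoid_scheme \<Rightarrow> 'w set \<Rightarrow> 'w set \<Rightarrow> 'w set set" where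
  "blocks G S I = I // ((dynkin_edges G S \<inter> I \<times> I)\<^sup>*)"

definition block_descent_count :: "('w, 'm) monoid_scheme \<Rightarrow> 'w set \<Rightarrow> 'w set \<Rightarrow> nat" where
  "block_descent_count G S I =
     card {w \<in> carrier G. \<forall>B \<in> blocks G S I. \<exists>s\<in>B.
             coxeter_length G S (w \<otimes>\<^bsub>G\<^esub> s) < coxeter_length G S w}"

definition parabolic_normalizer_size :: "('w, 'm) monoid_scheme \<Rightarrow> 'w set \<Rightarrow> nat" where
  "parabolic_normalizer_size G I = card (normalizer G (generate G I))"

text \<open>
  The sum in the dimension formula has one term for each conjugacy class of standard parabolic
  subgroups. Summing over all \<open>I \<subseteq> S\<close> instead would count conjugate subgroups repeatedly, and
  give 29 rather than the dimension 20 in type \<open>A\<^sub>2\<close>, where \<open>{s}\<close> and \<open>{t}\<close> are conjugate.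
\<close>

definition parabolic_class :: "('w, 'm) monoid_scheme \<Rightarrow> 'w set \<Rightarrow> 'w set set" where
  "parabolic_class G I =
     {g <#\<^bsub>G\<^esub> generate G I #>\<^bsub>G\<^esub> inv\<^bsub>G\<^esub> g | g. g \<in> carrier G}"

definition parabolic_representatives ::
  "('w, 'm) monoid_scheme \<Rightarrow> 'w set \<Rightarrow> 'w set set \<Rightarrow> bool" where
  "parabolic_representatives G S R \<longleftrightarrow>
     R \<subseteq> Pow S \<and> bij_betw (parabolic_class G) R (parabolic_class G ` Pow S)"

lemma parabolic_representatives_exist: "\<exists>R. parabolic_representatives G S R"
proof -
  have "\<exists>R \<subseteq> Pow S. inj_on (parabolic_class G) R \<and>
          parabolic_class G ` Pow S = parabolic_class G ` R"
    using subset_image_inj[of "parabolic_class G ` Pow S" "parabolic_class G" "Pow S"] by blast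
  then show ?thesis
    unfolding parabolic_representatives_def bij_betw_def by metis
qed

text \<open>
  The Weyl group of type \<open>A\<^sub>n\<close> is \<^term>\<open>sym_group (n + 1)\<close>, the permutations of \<open>{1..n+1}\<close>,
  with the following simple reflections.
\<close>

definition simple_transpositions :: "nat \<Rightarrow> (nat \<Rightarrow> nat) set" where
  "simple_transpositions n = {transpose i (i + 1) | i. i \<in> {1..n}}"


section \<open>Free associative algebras\<close>

text \<open>
  Words over an alphabet, written additively because the multiplication of \<open>\<Rightarrow>\<^sub>0\<close> is convolution
  with respect to \<open>+\<close> on the keys.
\<close>

datatype 'x free_word = Word (letters: "'x list")

instantiation free_word :: (type) monoid_add
begin

definition zero_free_word :: "'a free_word" where
  "0 = Word []"

definition plus_free_word :: "'a free_word \<Rightarrow> 'a free_word \<Rightarrow> 'a free_word" where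
  "u + w = Word (letters u @ letters w)"

instance
  by standard (simp_all add: zero_free_word_def plus_free_word_def)

end

type_synonym ('x, 'k) free_alg = "'x free_word \<Rightarrow>\<^sub>0 'k"

definition free_scalar :: "'k::field \<Rightarrow> ('x, 'k) free_alg" where
  "free_scalar c = Poly_Mapping.single 0 c"

definition free_gen :: "'x \<Rightarrow> ('x, 'k::field) free_alg" where
  "free_gen x = Poly_Mapping.single (Word [x]) 1"

definition free_algebra :: "'x set \<Rightarrow> ('x, 'k::field) free_alg ring" where
  "free_algebra A =
     \<lparr>carrier = {p. Poly_Mapping.keys p \<subseteq> Word ` lists A},
      monoid.mult = (*), one = 1, ring.zero = 0, add = (+)\<rparr>"


section \<open>The algebra of braids and ties\<close>

datatype 'w bt_gen = Braid 'w | Tie 'w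

abbreviation bt_g :: "'w \<Rightarrow> ('w bt_gen, 'k::field) free_alg" where
  "bt_g s \<equiv> free_gen (Braid s)"

abbreviation bt_e :: "'w \<Rightarrow> ('w bt_gen, 'k::field) free_alg" where
  "bt_e r \<equiv> free_gen (Tie r)"

definition bt_gens :: "('w, 'm) monoid_scheme \<Rightarrow> 'w set \<Rightarrow> 'w bt_gen set" where
  "bt_gens G S = Braid ` S \<union> Tie ` reflections G S"

fun alternating_prod :: "nat \<Rightarrow> 'a::monoid_mult \<Rightarrow> 'a \<Rightarrow> 'a" where
  "alternating_prod 0 a b = 1"
| "alternating_prod (Suc m) a b = a * alternating_prod m b a"

text \<open>Each defining relation \<open>l = r\<close> is recorded as the element \<open>l - r\<close> of the free algebra.\<close>

inductive_set bt_relators ::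
  "('w, 'm) monoid_scheme \<Rightarrow> 'w set \<Rightarrow> 'k::field \<Rightarrow> ('w bt_gen, 'k) free_alg set"
  for G :: "('w, 'm) monoid_scheme" and S :: "'w set" and v :: 'k
  where
    braid: "\<lbrakk>s \<in> S; t \<in> S; m = group.ord G (s \<otimes>\<^bsub>G\<^esub> t)\<rbrakk> \<Longrightarrow>
      alternating_prod m (bt_g s) (bt_g t) - alternating_prod m (bt_g t) (bt_g s)
        \<in> bt_relators G S v"
  | tie_idem: "r \<in> reflections G S \<Longrightarrow>
      bt_e r * bt_e r - bt_e r \<in> bt_relators G S v"
  | tie_commute: "\<lbrakk>r1 \<in> reflections G S; r2 \<in> reflections G S\<rbrakk> \<Longrightarrow>
      bt_e r1 * bt_e r2 - bt_e r2 * bt_e r1 \<in> bt_relators G S v"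
  | tie_conj: "\<lbrakk>r1 \<in> reflections G S; r2 \<in> reflections G S\<rbrakk> \<Longrightarrow>
      bt_e r1 * bt_e r2 - bt_e r1 * bt_e (inv\<^bsub>G\<^esub> r1 \<otimes>\<^bsub>G\<^esub> r2 \<otimes>\<^bsub>G\<^esub> r1) \<in> bt_relators G S v"
  | braid_tie: "\<lbrakk>s \<in> S; r \<in> reflections G S\<rbrakk> \<Longrightarrow>
      bt_g s * bt_e r - bt_e (s \<otimes>\<^bsub>G\<^esub> r \<otimes>\<^bsub>G\<^esub> s) * bt_g s \<in> bt_relators G S v"
  | quadratic: "s \<in> S \<Longrightarrow>
      bt_g s * bt_g s - (1 + free_scalar (v\<^sup>2 - 1) * bt_e s * (1 + bt_g s)) \<in> bt_relators G S v"

definition bt_ideal ::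
  "('w, 'm) monoid_scheme \<Rightarrow> 'w set \<Rightarrow> 'k::field \<Rightarrow> ('w bt_gen, 'k) free_alg set" where
  "bt_ideal G S v = genideal (free_algebra (bt_gens G S)) (bt_relators G S v)"

definition bt_algebra ::
  "('w, 'm) monoid_scheme \<Rightarrow> 'w set \<Rightarrow> 'k::field \<Rightarrow> ('w bt_gen, 'k) free_alg set ring" where
  "bt_algebra G S v = free_algebra (bt_gens G S) Quot bt_ideal G S v"

definition bt_class ::
  "('w, 'm) monoid_scheme \<Rightarrow> 'w set \<Rightarrow> 'k::field \<Rightarrow> ('w bt_gen, 'k) free_alg
    \<Rightarrow> ('w bt_gen, 'k) free_alg set" where
  "bt_class G S v p = bt_ideal G S v +>\<^bsub>free_algebra (bt_gens G S)\<^esub> p"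

text \<open>
  The ground field, embedded in the algebra as the scalar multiples of the identity.
  Vector space notions for the algebra are those of
  \<^theory>\<open>HOL-Algebra.Embedded_Algebras\<close> over this subfield.
\<close>

definition bt_scalars ::
  "('w, 'm) monoid_scheme \<Rightarrow> 'w set \<Rightarrow> 'k::field \<Rightarrow> ('w bt_gen, 'k) free_alg set set" where
  "bt_scalars G S v = range (\<lambda>c. bt_class G S v (free_scalar c))"

text \<open>
  The locale \<^locale>\<open>subalgebra\<close> only asks for a linear subspace; a unital subalgebra is a
  \<^locale>\<open>subring\<close> which is also a linear subspace.
\<close>

definition generated_subalgebra :: "'a set \<Rightarrow> ('a, 'm) ring_scheme \<Rightarrow> 'a set \<Rightarrow> 'a set" where
  "generated_subalgebra K R H = \<Inter>{V. subring V R \<and> subalgebra K V R \<and> H \<subseteq> V}"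

definition braid_image ::
  "('w, 'm) monoid_scheme \<Rightarrow> 'w set \<Rightarrow> 'k::field \<Rightarrow> ('w bt_gen, 'k) free_alg set set" where
  "braid_image G S v =
     generated_subalgebra (bt_scalars G S v) (bt_algebra G S v)
       ((\<lambda>s. bt_class G S v (bt_g s)) ` S)"

text \<open>The variable of the field of rational functions over the complex numbers.\<close>

definition rat_fun_var :: "complex poly fract" where
  "rat_fun_var = Fraction_Field.Fract [:0, 1:] 1"

abbreviation bt_A :: "nat \<Rightarrow> ((nat \<Rightarrow> nat) bt_gen, complex poly fract) free_alg set ring" where
  "bt_A n \<equiv> bt_algebra (sym_group (n + 1)) (simple_transpositions n) rat_fun_var"

abbreviation bt_A_scalars ::
  "nat \<Rightarrow> ((nat \<Rightarrow> nat) bt_gen, complex poly fract) free_alg set set" where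
  "bt_A_scalars n \<equiv> bt_scalars (sym_group (n + 1)) (simple_transpositions n) rat_fun_var"

abbreviation bt_A_braid_image ::
  "nat \<Rightarrow> ((nat \<Rightarrow> nat) bt_gen, complex poly fract) free_alg set set" where
  "bt_A_braid_image n \<equiv> braid_image (sym_group (n + 1)) (simple_transpositions n) rat_fun_var"

end

theory Submission
  imports Defs "HOL-Library.Function_Algebras"
begin

text \<open>
  Write \<open>N = n + 1\<close>, \<open>q = v\<^sup>2\<close>, and let \<open>E\<close> be the algebra of braids and ties. The proof replaces \<open>E\<close>
  by a concrete space of functions on which it acts faithfully, and computes the dimension of the
  braid image there; it works over every field with \<open>q \<noteq> 0, 1, - 1\<close>.

  The space. A coloured word is a pair \<open>(A, w)\<close> of a colouring \<open>A\<close> of the letters \<open>1, \<dots>, N\<close> and a word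
  \<open>w\<close> in them. The generator \<open>g\<^sub>i\<close> exchanges the letters in the positions \<open>i\<close> and \<open>i + 1\<close>: by the Hecke
  algebra rule if the two letters have the same colour, and as a plain exchange otherwise. The tie
  \<open>e\<^sub>r\<close>, \<open>r = (a b)\<close>, is the projection to the words with equally coloured letters in the positions
  \<open>a\<close> and \<open>b\<close>. Let \<open>\<xi>\<close> be the sum of the words \<open>(A, id)\<close> over all equivalence relations \<open>A\<close>. By the
  defining relations \<open>E\<close> is spanned by products of a set of ties, closed under transitivity, and one
  of at most \<open>N!\<close> words in the \<open>g\<^sub>i\<close>. As \<open>E \<xi>\<close> contains the indicator function of each \<open>(A, w)\<close> with \<open>A\<close> an
  equivalence relation and \<open>w\<close> a permutation, counting shows that \<open>x \<mapsto> x \<xi>\<close> is injective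
  (\<open>act_on_words_injective\<close>). So the dimension of the braid image is that of the smallest subspace
  that contains \<open>\<xi>\<close> and is stable under all \<open>g\<^sub>i\<close>, the orbit space.

  Lower bound (\<open>exists_independent_family\<close>). The braid image does not contain the ties, but a subspace
  that is stable under the braids is stable under \<open>e\<^sub>b (1 + g\<^sub>k)\<close>, where \<open>b\<close> is an interval of
  positions, \<open>e\<^sub>b\<close> ties all of \<open>b\<close>, and \<open>k, k + 1 \<in> b\<close> (\<open>braid_stable_block_tie\<close>). Applying such operators to
  the words, one for each non-trivial class of an equivalence relation \<open>P\<close> on positions, gives one
  vector for each permutation that increases on no such class, and these vectors are triangular
  with respect to inclusion of \<open>P\<close> and number of inversions. The number of permutations that
  increase on no such class is \<open>N! \<Prod>\<^sub>b (1 - 1 / \<bar>b\<bar>!)\<close>, the product over the non-trivial classes \<open>b\<close>.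

  Upper bound (\<open>alternating_compatible_determined\<close>). Antisymmetrise a function over the permutations of
  the letters of one colour class \<open>b\<close>. The Hecke correction terms then cancel in pairs, so that
  \<open>g\<^sub>i\<close> acts as if the letters of \<open>b\<close> had pairwise different colours. Hence for every vector of the
  orbit space the antisymmetrisation takes the same value at \<open>A\<close> and at the colouring in which \<open>b\<close> is
  broken into singletons. By these linear equations a vector is determined by its values at those
  \<open>(A, w)\<close> for which the letters of no non-trivial class appear in increasing order; their number is
  the one of the lower bound.

  Therefore the dimension is the sum of \<open>N! \<Prod>\<^sub>b (1 - 1 / \<bar>b\<bar>!)\<close> over all equivalence relations on
  \<open>1, \<dots>, N\<close>. Equivalence relations correspond to the conjugates of the standard parabolic subgroups.
  The conjugates of one \<open>W\<^sub>I\<close> contribute the equal amounts \<open>D\<^sub>I\<close>, because \<open>w\<close> increases on a class exactly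
  if it has no right descent in the corresponding block, and there are \<open>\<bar>W\<bar> / N\<^sub>I\<close> of them by the orbit
  stabiliser theorem (\<open>dimension_sum_eq\<close>). The numerical values come from a recursion over the class
  of a chosen point.
\<close>

section \<open>Permutations and adjacent transpositions\<close>

abbreviation adj :: "nat \<Rightarrow> nat \<Rightarrow> nat" where
  "adj i \<equiv> transpose i (Suc i)"

lemma adj_permutes: "i \<in> {1..<N} \<Longrightarrow> adj i permutes {1..N}"
  by (rule permutes_swap_id) auto

definition inversions :: "nat \<Rightarrow> (nat \<Rightarrow> nat) \<Rightarrow> (nat \<times> nat) set" where
  "inversions N w = {(a, b). 1 \<le> a \<and> a < b \<and> b \<le> N \<and> w b < w a}"

lemma finite_inversions: "finite (inversions N w)"
  by (rule finite_subset[of _ "{1..N} \<times> {1..N}"]) (auto simp: inversions_def)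

lemma card_inversions_adj:
  assumes i: "i \<in> {1..<N}" and asc: "w i < w (Suc i)"
  shows "card (inversions N (w \<circ> adj i)) = Suc (card (inversions N w))"
proof -
  let ?s = "adj i"
  let ?m = "\<lambda>(a, b). (?s a, ?s b)"
  have lt: "?s a < ?s b" if "a < b" "(a, b) \<noteq> (i, Suc i)" for a b
    using that by (auto simp: transpose_def)
  have range: "1 \<le> ?s a \<longleftrightarrow> 1 \<le> a" "?s a \<le> N \<longleftrightarrow> a \<le> N" for a
    using i by (auto simp: transpose_def)
  have sub: "?m ` inversions N w \<subseteq> inversions N (w \<circ> ?s)"
  proof
    fix y assume "y \<in> ?m ` inversions N w"
    then obtain a b where "y = (?s a, ?s b)" and ab: "(a, b) \<in> inversions N w" by auto
    moreover have "(a, b) \<noteq> (i, Suc i)" using ab asc by (auto simp: inversions_def)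
    ultimately show "y \<in> inversions N (w \<circ> ?s)"
      using ab lt[of a b] range by (auto simp: inversions_def)
  qed
  have "inversions N (w \<circ> ?s) = insert (i, Suc i) (?m ` inversions N w)"
  proof
    show "insert (i, Suc i) (?m ` inversions N w) \<subseteq> inversions N (w \<circ> ?s)"
      using sub i asc by (auto simp: inversions_def)
    show "inversions N (w \<circ> ?s) \<subseteq> insert (i, Suc i) (?m ` inversions N w)"
    proof
      fix y assume y: "y \<in> inversions N (w \<circ> ?s)"
      obtain a b where ab: "y = (a, b)" by (cases y)
      have "y \<in> ?m ` inversions N w" if "y \<noteq> (i, Suc i)"
      proof (rule image_eqI[where x = "(?s a, ?s b)"])
        show "y = ?m (?s a, ?s b)" using ab by simp
        show "(?s a, ?s b) \<in> inversions N w"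
          using y that lt[of a b] range unfolding ab by (auto simp: inversions_def)
      qed
      then show "y \<in> insert (i, Suc i) (?m ` inversions N w)" by blast
    qed
  qed
  moreover have "(i, Suc i) \<notin> ?m ` inversions N w"
  proof
    assume "(i, Suc i) \<in> ?m ` inversions N w"
    then obtain a b where "i = ?s a" "Suc i = ?s b" and ab: "(a, b) \<in> inversions N w" by auto
    then have "a = Suc i" "b = i" by (metis transpose_apply_first transpose_apply_second transpose_involutory)+
    with ab show False by (simp add: inversions_def)
  qed
  moreover have "inj_on ?m (inversions N w)"
    by (auto simp: inj_on_def dest: injD[OF inj_transpose])
  ultimately show ?thesis
    using finite_inversions by (simp add: card_image)
qed

lemma card_inversions_adj_desc:
  assumes i: "i \<in> {1..<N}" and desc: "w (Suc i) < w i"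
  shows "Suc (card (inversions N (w \<circ> adj i))) = card (inversions N w)"
proof -
  have "card (inversions N (w \<circ> adj i \<circ> adj i)) = Suc (card (inversions N (w \<circ> adj i)))"
    by (rule card_inversions_adj[OF i]) (simp add: desc)
  then show ?thesis by (simp add: comp_assoc)
qed

text \<open>
  The least point moved by \<open>\<sigma>\<close> would be the image of a larger point, so \<open>\<sigma>\<close> would reverse the order
  of two points; but \<open>\<sigma>\<close> preserves the order, as \<open>v\<close> and \<open>v \<circ> \<sigma>\<close> both do.
\<close>

lemma strict_mono_on_permuted_imp_id:
  fixes v :: "nat \<Rightarrow> nat"
  assumes \<sigma>: "\<sigma> permutes b" and v: "strict_mono_on b v" and v\<sigma>: "strict_mono_on b (v \<circ> \<sigma>)"
  shows "\<sigma> = id"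
proof (rule ccontr)
  assume "\<sigma> \<noteq> id"
  then have "\<exists>x. \<sigma> x \<noteq> x" by auto
  then obtain x where x: "\<sigma> x \<noteq> x" and least: "\<And>y. y < x \<Longrightarrow> \<sigma> y = y"
    using exists_least_iff[of "\<lambda>x. \<sigma> x \<noteq> x"] by blast
  have xb: "x \<in> b" using x \<sigma> by (meson permutes_not_in)
  have mono: "\<sigma> c < \<sigma> d" if "c \<in> b" "d \<in> b" "c < d" for c d
  proof -
    have "v (\<sigma> c) < v (\<sigma> d)"
      using v\<sigma> that by (auto simp: strict_mono_on_def)
    moreover have "\<sigma> c \<in> b" "\<sigma> d \<in> b" using that \<sigma> by (simp_all add: permutes_in_image)
    ultimately show ?thesis
      using v by (metis linorder_neqE_nat not_less_iff_gr_or_eq strict_mono_onD)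
  qed
  have "\<sigma> x > x"
    using x least[of "\<sigma> x"] permutes_inj[OF \<sigma>] by (metis injD linorder_neqE_nat)
  obtain y where y: "\<sigma> y = x" using \<sigma> by (metis permutes_def)
  then have "y \<in> b" using xb \<sigma> by (metis permutes_in_image)
  moreover have "x < y" using y x least[of y] by (metis linorder_neqE_nat)
  ultimately show False using mono[of x y] xb y \<open>\<sigma> x > x\<close> by simp
qed

lemma exists_descent:
  assumes w: "w permutes {1..N}" and "w \<noteq> id"
  obtains i where "i \<in> {1..<N}" "w (Suc i) < w i"
proof -
  have "\<exists>i \<in> {1..<N}. w (Suc i) < w i"
  proof (rule ccontr)
    assume "\<not> ?thesis"
    then have asc: "w i < w (Suc i)" if "i \<in> {1..<N}" for i
      using that permutes_inj[OF w] by (metis injD linorder_neqE_nat n_not_Suc_n)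
    have "w a < w (Suc (a + d))" if "1 \<le> a" "Suc (a + d) \<le> N" for a d
      using that
    proof (induction d)
      case 0 then show ?case using asc[of a] by auto
    next
      case (Suc d) then show ?case using asc[of "Suc (a + d)"] by (auto intro: less_trans)
    qed
    then have "strict_mono_on {1..N} w"
      unfolding strict_mono_on_def by (metis atLeastAtMost_iff less_iff_Suc_add)
    then have "w = id"
      using strict_mono_on_permuted_imp_id[OF w, of id] by (auto simp: strict_mono_on_def)
    with assms show False by simp
  qed
  then show ?thesis using that by blast
qed

text \<open>
  Sorting a permutation by exchanges of neighbours: each exchange at a descent removes one inversion.
  Read backwards, every permutation arises from the identity by exchanges that create an inversion,
  and these are the steps at which the action on words has no correction term.
\<close>

lemma perm_adj_induct [consumes 1, case_names id ascent]:
  assumes "w permutes {1..N}"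
    and "P id"
    and step: "\<And>w i. w permutes {1..N} \<Longrightarrow> i \<in> {1..<N} \<Longrightarrow> w i < w (Suc i) \<Longrightarrow> P w \<Longrightarrow> P (w \<circ> adj i)"
  shows "P w"
  using assms(1)
proof (induction "card (inversions N w)" arbitrary: w rule: less_induct)
  case less
  show ?case
  proof (cases "w = id")
    case True
    then show ?thesis using assms(2) by simp
  next
    case False
    with less.prems obtain i where i: "i \<in> {1..<N}" "w (Suc i) < w i"
      by (rule exists_descent)
    have perm: "w \<circ> adj i permutes {1..N}"
      using less.prems adj_permutes[OF i(1)] by (intro permutes_compose)
    have "P (w \<circ> adj i)"
      using card_inversions_adj_desc[OF i] perm by (intro less.hyps) auto
    then have "P (w \<circ> adj i \<circ> adj i)"
      by (rule step[OF perm i(1), rotated]) (simp add: i(2))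
    then show ?thesis by (simp add: comp_assoc)
  qed
qed

lemma exists_sorting_permutation:
  fixes u :: "nat \<Rightarrow> nat"
  assumes "finite b" "inj_on u b"
  obtains \<sigma> where "\<sigma> permutes b" "strict_mono_on b (u \<circ> \<sigma>)"
proof -
  obtain h where h: "bij_betw h {..<card b} b" "strict_mono_on {..<card b} h"
    using ex_bij_betw_strict_mono_card[OF assms(1)] by blast
  obtain k where k: "bij_betw k {..<card b} (u ` b)" "strict_mono_on {..<card b} k"
    using ex_bij_betw_strict_mono_card[of "u ` b"] assms by (auto simp: card_image)
  define \<phi> where "\<phi> = inv_into b u \<circ> k \<circ> inv_into {..<card b} h"
  define \<sigma> where "\<sigma> x = (if x \<in> b then \<phi> x else x)" for x
  have "bij_betw \<phi> b b"
    unfolding \<phi>_def comp_assoc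
    by (rule bij_betw_trans[OF bij_betw_trans[OF bij_betw_inv_into[OF h(1)] k(1)] bij_betw_inv_into])
      (simp add: bij_betw_imageI assms)
  then have "bij_betw \<sigma> b b"
    by (rule bij_betw_cong[THEN iffD1, rotated]) (simp add: \<sigma>_def)
  then have "\<sigma> permutes b"
    by (rule bij_imp_permutes) (simp add: \<sigma>_def)
  moreover have "strict_mono_on b (u \<circ> \<sigma>)"
  proof (rule strict_mono_onI)
    fix x y assume xy: "x \<in> b" "y \<in> b" "x < y"
    define x' y' where "x' = inv_into {..<card b} h x" and "y' = inv_into {..<card b} h y"
    have x': "x' < card b" "h x' = x" and y': "y' < card b" "h y' = y"
      unfolding x'_def y'_def
      using xy h(1) inv_into_into[of _ h "{..<card b}"] by (auto simp: bij_betw_def f_inv_into_f)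
    have "x' < y'"
      using h(2) x' y' xy by (metis lessThan_iff linorder_neqE_nat order_less_asym strict_mono_onD)
    then have "k x' < k y'"
      using k(2) x' y' by (auto simp: strict_mono_on_def)
    moreover have "u (\<sigma> x) = k x'" "u (\<sigma> y) = k y'"
      using xy x' y' bij_betw_apply[OF k(1), of x'] bij_betw_apply[OF k(1), of y']
      by (simp_all add: \<sigma>_def \<phi>_def x'_def[symmetric] y'_def[symmetric] f_inv_into_f)
    ultimately show "(u \<circ> \<sigma>) x < (u \<circ> \<sigma>) y" by simp
  qed
  ultimately show ?thesis by (rule that)
qed

section \<open>Counting permutations that increase on no block\<close>

text \<open>
  For each further block \<open>b\<close>, every permutation in the set counted so far is \<open>w \<circ> \<sigma>\<close> for exactly one \<open>w\<close>
  of that set that increases on \<open>b\<close> and one permutation \<open>\<sigma>\<close> of \<open>b\<close>. So the proportion that increases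
  on \<open>b\<close> is \<open>1 / \<bar>b\<bar>!\<close>, independently of the blocks treated before.
\<close>

lemma card_nowhere_increasing:
  assumes "finite \<B>" "disjoint \<B>" "\<And>b. b \<in> \<B> \<Longrightarrow> b \<subseteq> {1..N}"
  shows "rat_of_nat (card {w. w permutes {1..N} \<and> (\<forall>b \<in> \<B>. \<not> strict_mono_on b w)}) =
    fact N * (\<Prod>b \<in> \<B>. 1 - 1 / fact (card b))"
  using assms
proof (induction \<B> rule: finite_induct)
  case empty
  then show ?case using card_permutations[of "{1..N}" N] by simp
next
  case (insert b \<B>)
  let ?T = "{w. w permutes {1..N} \<and> (\<forall>b \<in> \<B>. \<not> strict_mono_on b w)}"
  let ?M = "{w \<in> ?T. strict_mono_on b w}"
  have fin: "finite ?T" "finite b"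
    using finite_permutations[of "{1..N}"] insert.prems(2)[of b] by (auto intro: finite_subset)
  have IH: "rat_of_nat (card ?T) = fact N * (\<Prod>b \<in> \<B>. 1 - 1 / fact (card b))"
    by (rule insert.IH) (use insert.prems in \<open>auto intro: pairwise_subset\<close>)
  have disj: "\<sigma> x = x" if "\<sigma> permutes b" "b' \<in> \<B>" "x \<in> b'" for \<sigma> b' x
  proof -
    have "b \<inter> b' = {}"
      using disjointD[OF insert.prems(1), of b b'] insert.hyps(2) that(2) by auto
    then have "x \<notin> b" using that(3) by blast
    then show ?thesis by (rule permutes_not_in[OF that(1)])
  qed
  have stable: "w \<circ> \<sigma> \<in> ?T" if w: "w \<in> ?T" and \<sigma>: "\<sigma> permutes b" for w \<sigma>
  proof -
    have "strict_mono_on b' (w \<circ> \<sigma>) = strict_mono_on b' w" if "b' \<in> \<B>" for b'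
      using disj[OF \<sigma> that] by (simp add: strict_mono_on_def)
    moreover have "\<sigma> permutes {1..N}"
      by (rule permutes_subset[OF \<sigma> insert.prems(2)]) simp
    then have "w \<circ> \<sigma> permutes {1..N}"
      by (rule permutes_compose) (use w in simp)
    ultimately show ?thesis
      using w by blast
  qed
  have "bij_betw (\<lambda>(w, \<sigma>). w \<circ> \<sigma>) (?M \<times> {\<sigma>. \<sigma> permutes b}) ?T"
  proof (rule bij_betw_imageI)
    show "inj_on (\<lambda>(w, \<sigma>). w \<circ> \<sigma>) (?M \<times> {\<sigma>. \<sigma> permutes b})"
    proof (rule inj_onI)
      fix x y
      assume x: "x \<in> ?M \<times> {\<sigma>. \<sigma> permutes b}" and y: "y \<in> ?M \<times> {\<sigma>. \<sigma> permutes b}"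
        and xy: "(case x of (w, \<sigma>) \<Rightarrow> w \<circ> \<sigma>) = (case y of (w, \<sigma>) \<Rightarrow> w \<circ> \<sigma>)"
      obtain w \<sigma> w' \<sigma>' where x': "x = (w, \<sigma>)" and y': "y = (w', \<sigma>')"
        by (cases x, cases y)
      have mono: "strict_mono_on b w" "strict_mono_on b w'"
        and \<sigma>: "\<sigma> permutes b" "\<sigma>' permutes b" and eq: "w \<circ> \<sigma> = w' \<circ> \<sigma>'"
        using x y xy unfolding x' y' mem_Times_iff mem_Collect_eq prod.case fst_conv snd_conv by simp_all
      have w: "w = w' \<circ> (\<sigma>' \<circ> inv' \<sigma>)"
        using eq permutes_inv_o(1)[OF \<sigma>(1)] by (metis comp_assoc comp_id)
      have id: "\<sigma>' \<circ> inv' \<sigma> = id"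
      proof (rule strict_mono_on_permuted_imp_id)
        show "\<sigma>' \<circ> inv' \<sigma> permutes b"
          by (rule permutes_compose[OF permutes_inv[OF \<sigma>(1)] \<sigma>(2)])
        show "strict_mono_on b w'" by (rule mono(2))
        show "strict_mono_on b (w' \<circ> (\<sigma>' \<circ> inv' \<sigma>))" using mono(1) unfolding w[symmetric] .
      qed
      then have "\<sigma>' = \<sigma>"
        using permutes_inv_o(2)[OF \<sigma>(1)] by (metis comp_assoc comp_id id_comp)
      moreover have "w = w'" using w id by simp
      ultimately show "x = y" using x' y' by simp
    qed
    show "(\<lambda>(w, \<sigma>). w \<circ> \<sigma>) ` (?M \<times> {\<sigma>. \<sigma> permutes b}) = ?T"
    proof
      show "(\<lambda>(w, \<sigma>). w \<circ> \<sigma>) ` (?M \<times> {\<sigma>. \<sigma> permutes b}) \<subseteq> ?T"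
      proof
        fix u assume "u \<in> (\<lambda>(w, \<sigma>). w \<circ> \<sigma>) ` (?M \<times> {\<sigma>. \<sigma> permutes b})"
        then obtain w \<sigma> where u: "u = w \<circ> \<sigma>" and w: "w \<in> ?T" and \<sigma>: "\<sigma> permutes b" by (elim imageE SigmaE) simp
        show "u \<in> ?T" unfolding u by (rule stable[OF w \<sigma>])
      qed
      show "?T \<subseteq> (\<lambda>(w, \<sigma>). w \<circ> \<sigma>) ` (?M \<times> {\<sigma>. \<sigma> permutes b})"
      proof
        fix u assume u: "u \<in> ?T"
        obtain \<sigma> where \<sigma>: "\<sigma> permutes b" "strict_mono_on b (u \<circ> \<sigma>)"
          using exists_sorting_permutation[OF fin(2)] permutes_inj_on[of u "{1..N}" b] u by blast
        have "u = (\<lambda>(w, \<sigma>). w \<circ> \<sigma>) (u \<circ> \<sigma>, inv' \<sigma>)"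
          using permutes_inv_o(1)[OF \<sigma>(1)] by (simp add: comp_assoc)
        moreover have "(u \<circ> \<sigma>, inv' \<sigma>) \<in> ?M \<times> {\<sigma>. \<sigma> permutes b}"
          using stable[OF u \<sigma>(1)] \<sigma>(2) permutes_inv[OF \<sigma>(1)] by simp
        ultimately show "u \<in> (\<lambda>(w, \<sigma>). w \<circ> \<sigma>) ` (?M \<times> {\<sigma>. \<sigma> permutes b})" by (rule image_eqI)
      qed
    qed
  qed
  then have "card ?T = card ?M * fact (card b)"
    using card_permutations[OF refl fin(2)] bij_betw_same_card card_cartesian_product[of ?M "{\<sigma>. \<sigma> permutes b}"]
    by fastforce
  then have "rat_of_nat (card ?T) = rat_of_nat (card ?M) * fact (card b)"
    by (simp only: of_nat_mult of_nat_fact)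
  then have M: "rat_of_nat (card ?M) = rat_of_nat (card ?T) / fact (card b)"
    by (simp only: nonzero_mult_div_cancel_right fact_nonzero not_False_eq_True)
  have "{w. w permutes {1..N} \<and> (\<forall>b \<in> insert b \<B>. \<not> strict_mono_on b w)} = ?T - ?M"
    by auto
  moreover have MT: "?M \<subseteq> ?T" by auto
  then have "card (?T - ?M) = card ?T - card ?M"
    by (intro card_Diff_subset finite_subset[OF MT fin(1)])
  moreover have "card ?M \<le> card ?T"
    by (rule card_mono[OF fin(1) MT])
  ultimately have "rat_of_nat (card {w. w permutes {1..N} \<and> (\<forall>b \<in> insert b \<B>. \<not> strict_mono_on b w)})
      = rat_of_nat (card ?T) - rat_of_nat (card ?M)"
    by (simp only: of_nat_diff)
  also have "\<dots> = rat_of_nat (card ?T) * (1 - 1 / fact (card b))"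
    unfolding M by (simp add: algebra_simps)
  finally show ?case
    unfolding IH using insert.hyps by (simp add: algebra_simps)
qed

text \<open>
  A one-element block imposes no condition, while \<open>1 - 1 / 1!\<close> would be \<open>0\<close>.
\<close>

definition block_weight :: "nat \<Rightarrow> rat" where
  "block_weight k = (if k = 1 then 1 else 1 - 1 / fact k)"

definition rel_weight :: "nat \<Rightarrow> (nat \<times> nat) set \<Rightarrow> rat" where
  "rel_weight N A = (\<Prod>b \<in> {1..N} // A. block_weight (card b))"

lemma class_subset: "equiv Z A \<Longrightarrow> b \<in> Z // A \<Longrightarrow> b \<subseteq> Z"
  by (metis Union_quotient Sup_upper)

lemma finite_class: "equiv {1..N::nat} A \<Longrightarrow> b \<in> {1..N} // A \<Longrightarrow> finite b"
  by (meson class_subset finite_atLeastAtMost finite_subset)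

lemma finite_classes: "equiv {1..N::nat} A \<Longrightarrow> finite ({1..N} // A)"
  by (intro finite_quotient) (auto simp: equiv_def refl_on_def)

lemma card_nowhere_increasing_classes:
  assumes A: "equiv {1..N} A"
  shows "rat_of_nat (card {w. w permutes {1..N} \<and>
      (\<forall>b \<in> {1..N} // A. 2 \<le> card b \<longrightarrow> \<not> strict_mono_on b w)}) = fact N * rel_weight N A"
proof -
  let ?\<B> = "{b \<in> {1..N} // A. 2 \<le> card b}"
  have fin: "finite ({1..N} // A)"
    by (rule finite_classes[OF A])
  have pos: "card b \<noteq> 0" if "b \<in> {1..N} // A" for b
    using that finite_class[OF A that] in_quotient_imp_non_empty[OF A that] by simp
  have "rel_weight N A = (\<Prod>b \<in> ?\<B>. block_weight (card b))"
    unfolding rel_weight_def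
  proof (rule prod.mono_neutral_right[OF fin])
    show "\<forall>b \<in> {1..N} // A - ?\<B>. block_weight (card b) = 1"
    proof
      fix b assume b: "b \<in> {1..N} // A - ?\<B>"
      with pos[of b] have "card b = 1" by auto
      then show "block_weight (card b) = 1" by (simp add: block_weight_def)
    qed
  qed auto
  also have "\<dots> = (\<Prod>b \<in> ?\<B>. 1 - 1 / fact (card b))"
    by (rule prod.cong) (auto simp: block_weight_def)
  also have "fact N * \<dots> =
      rat_of_nat (card {w. w permutes {1..N} \<and> (\<forall>b \<in> ?\<B>. \<not> strict_mono_on b w)})"
  proof (rule card_nowhere_increasing[symmetric])
    show "finite ?\<B>" using fin by simp
    show "disjoint ?\<B>" using quotient_disj[OF A] by (auto simp: pairwise_def disjnt_def)
    show "b \<subseteq> {1..N}" if "b \<in> ?\<B>" for b using that class_subset[OF A] by blast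
  qed
  also have "{w. w permutes {1..N} \<and> (\<forall>b \<in> ?\<B>. \<not> strict_mono_on b w)} =
    {w. w permutes {1..N} \<and> (\<forall>b \<in> {1..N} // A. 2 \<le> card b \<longrightarrow> \<not> strict_mono_on b w)}"
    by auto
  finally show ?thesis by simp
qed

text \<open>
  The upper bound speaks of the order in which letters appear, that is of the inverse of the word,
  and the lower bound of the word itself; inversion shows that the counts agree.
\<close>

lemma card_nowhere_increasing_inverse:
  assumes A: "equiv {1..N} A"
  shows "rat_of_nat (card {w. w permutes {1..N} \<and>
      (\<forall>b \<in> {1..N} // A. 2 \<le> card b \<longrightarrow> \<not> strict_mono_on b (inv' w))}) = fact N * rel_weight N A"
proof -
  let ?S = "\<lambda>f. {w. w permutes {1..N} \<and>
      (\<forall>b \<in> {1..N} // A. 2 \<le> card b \<longrightarrow> \<not> strict_mono_on b (f w))}"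
  have "bij_betw inv' (?S inv') (?S (\<lambda>w. w))"
    by (rule bij_betw_byWitness[where f' = inv'])
      (auto simp: permutes_inv permutes_inv_inv)
  then have "card (?S inv') = card (?S (\<lambda>w. w))"
    by (rule bij_betw_same_card)
  then show ?thesis
    using card_nowhere_increasing_classes[OF A] by simp
qed

text \<open>
  The sum over all equivalence relations of a product over the classes, in a form that admits a
  recursion over the size of the set.
\<close>

definition partition_sum :: "(nat \<Rightarrow> rat) \<Rightarrow> nat set \<Rightarrow> rat" where
  "partition_sum \<phi> Z = (\<Sum>p | partition_on Z p. \<Prod>c \<in> p. \<phi> (card c))"

lemma sum_rel_weight: "(\<Sum>A | equiv {1..N} A. rel_weight N A) = partition_sum block_weight {1..N}"
  unfolding rel_weight_def partition_sum_def
proof (rule sum.reindex_bij_witness[where i = "\<lambda>p. {(x, y). \<exists>c \<in> p. x \<in> c \<and> y \<in> c}" and j = "\<lambda>A. {1..N} // A"])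
  fix A assume A: "A \<in> {A. equiv {1..N} A}"
  then have A: "equiv {1..N} A" by simp
  show "{(x, y). \<exists>c \<in> {1..N} // A. x \<in> c \<and> y \<in> c} = A"
  proof (rule Set.set_eqI, rule prod.induct)
    fix x y
    show "(x, y) \<in> {(x, y). \<exists>c \<in> {1..N} // A. x \<in> c \<and> y \<in> c} \<longleftrightarrow> (x, y) \<in> A"
    proof
      assume "(x, y) \<in> {(x, y). \<exists>c \<in> {1..N} // A. x \<in> c \<and> y \<in> c}"
      then show "(x, y) \<in> A" using quotient_eq_iff[OF A] by blast
    next
      assume xy: "(x, y) \<in> A"
      then have "x \<in> {1..N}" using A by (auto simp: equiv_def refl_on_def)
      then show "(x, y) \<in> {(x, y). \<exists>c \<in> {1..N} // A. x \<in> c \<and> y \<in> c}"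
        using xy equiv_class_self[OF A] quotientI[of x "{1..N}" A] by blast
    qed
  qed
  show "{1..N} // A \<in> {p. partition_on {1..N} p}"
    using partition_on_quotient[OF A] by simp
next
  fix p assume "p \<in> {p. partition_on {1..N} p}"
  then have p: "partition_on {1..N} p" by simp
  show "{1..N} // {(x, y). \<exists>c \<in> p. x \<in> c \<and> y \<in> c} = p"
    by (rule partition_on_eq_quotient[OF p])
  show "{(x, y). \<exists>c \<in> p. x \<in> c \<and> y \<in> c} \<in> {A. equiv {1..N} A}"
    using equiv_partition_on[OF p] by simp
qed simp

text \<open>
  Split a set partition into the class of \<open>a\<close>, which is \<open>a\<close> together with a set \<open>C\<close>, and a partition of
  the rest.
\<close>

lemma partition_sum_insert:
  assumes Z: "finite Z" "a \<notin> Z"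
  shows "partition_sum \<phi> (insert a Z) = (\<Sum>C \<in> Pow Z. \<phi> (Suc (card C)) * partition_sum \<phi> (Z - C))"
proof -
  have fin: "finite p" if "partition_on Y p" "Y \<subseteq> insert a Z" for p Y
    using that Z by (meson finite_elements finite_insert finite_subset)
  have "(\<Sum>C \<in> Pow Z. \<phi> (Suc (card C)) * partition_sum \<phi> (Z - C)) =
      (\<Sum>(C, p) \<in> (SIGMA C : Pow Z. {p. partition_on (Z - C) p}). \<phi> (Suc (card C)) * (\<Prod>c \<in> p. \<phi> (card c)))"
    unfolding partition_sum_def sum_distrib_left
    by (rule sum.Sigma) (use Z in \<open>auto intro: finitely_many_partition_on\<close>)
  also have "\<dots> = partition_sum \<phi> (insert a Z)"
    unfolding partition_sum_def
  proof (rule sum.reindex_bij_witness[where j = "\<lambda>(C, p). insert (insert a C) p"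
        and i = "\<lambda>p. ((THE c. c \<in> p \<and> a \<in> c) - {a}, p - {THE c. c \<in> p \<and> a \<in> c})"])
    fix x assume x: "x \<in> (SIGMA C : Pow Z. {p. partition_on (Z - C) p})"
    then obtain C p where xp: "x = (C, p)" and C: "C \<subseteq> Z" and p: "partition_on (Z - C) p" by auto
    have a: "a \<notin> c" if "c \<in> p" for c
      using partition_onD1[OF p] Z that by blast
    then have new: "insert a C \<notin> p" by blast
    have the: "(THE c. c \<in> insert (insert a C) p \<and> a \<in> c) = insert a C"
      using a by (intro the_equality) auto
    show "(\<lambda>p. ((THE c. c \<in> p \<and> a \<in> c) - {a}, p - {THE c. c \<in> p \<and> a \<in> c}))
        ((\<lambda>(C, p). insert (insert a C) p) x) = x"
      unfolding xp prod.case the using C Z new by auto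
    show "(\<lambda>(C, p). insert (insert a C) p) x \<in> {p. partition_on (insert a Z) p}"
      unfolding xp prod.case mem_Collect_eq
    proof (rule partition_onI)
      show "\<Union> (insert (insert a C) p) = insert a Z"
        using partition_onD1[OF p] C by auto
      show "{} \<notin> insert (insert a C) p"
        using partition_onD3[OF p] by blast
      show "disjnt q r" if "q \<in> insert (insert a C) p" "r \<in> insert (insert a C) p" "q \<noteq> r" for q r
      proof -
        have "disjnt (insert a C) c" if "c \<in> p" for c
          using a[OF that] partition_onD1[OF p] that by (auto simp: disjnt_def)
        then show ?thesis
          using that partition_onD2[OF p] by (auto simp: pairwise_def disjnt_sym)
      qed
    qed
    show "(\<Prod>c \<in> (\<lambda>(C, p). insert (insert a C) p) x. \<phi> (card c)) =
        (case x of (C, p) \<Rightarrow> \<phi> (Suc (card C)) * (\<Prod>c \<in> p. \<phi> (card c)))"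
    proof -
      have "a \<notin> C" "finite C" using C Z by (auto intro: finite_subset)
      then show ?thesis
        unfolding xp prod.case using fin[OF p] new by (subst prod.insert) auto
    qed
  next
    fix p assume "p \<in> {p. partition_on (insert a Z) p}"
    then have p: "partition_on (insert a Z) p" by simp
    obtain c where c: "c \<in> p" "a \<in> c"
      using partition_onD1[OF p] by blast
    have uniq: "d = c" if "d \<in> p" "a \<in> d" for d
      using partition_onD2[OF p] c that by (metis disjnt_iff pairwiseD)
    have the: "(THE c. c \<in> p \<and> a \<in> c) = c"
      by (rule the_equality) (use c uniq in blast)+
    show "(\<lambda>(C, p). insert (insert a C) p)
        ((\<lambda>p. ((THE c. c \<in> p \<and> a \<in> c) - {a}, p - {THE c. c \<in> p \<and> a \<in> c})) p) = p"
      unfolding the prod.case using c by (simp add: insert_absorb)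
    have "partition_on (Z - (c - {a})) (p - {c})"
    proof (rule partition_onI)
      have "\<Union> (p - {c}) = \<Union> p - c"
        using partition_onD2[OF p] c(1) by (auto simp: pairwise_def disjnt_def)
      then show "\<Union> (p - {c}) = Z - (c - {a})"
        using partition_onD1[OF p] c Z by auto
      show "{} \<notin> p - {c}"
        using partition_onD3[OF p] by blast
      show "disjnt q r" if "q \<in> p - {c}" "r \<in> p - {c}" "q \<noteq> r" for q r
        using that partition_onD2[OF p] by (auto simp: pairwise_def)
    qed
    moreover have "c \<subseteq> insert a Z"
      using partition_onD1[OF p] c by blast
    ultimately show "(\<lambda>p. ((THE c. c \<in> p \<and> a \<in> c) - {a}, p - {THE c. c \<in> p \<and> a \<in> c})) p
        \<in> (SIGMA C : Pow Z. {p. partition_on (Z - C) p})"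
      unfolding the by auto
  qed
  finally show ?thesis by simp
qed

fun partition_number :: "(nat \<Rightarrow> rat) \<Rightarrow> nat \<Rightarrow> rat" where
  "partition_number \<phi> 0 = 1"
| "partition_number \<phi> (Suc m) =
     (\<Sum>k \<le> m. of_nat (m choose k) * (\<phi> (Suc k) * partition_number \<phi> (m - k)))"

lemma sum_Pow_card:
  assumes "finite Z"
  shows "(\<Sum>C \<in> Pow Z. f (card C)) = (\<Sum>k \<le> card Z. of_nat (card Z choose k) * (f k :: rat))"
proof -
  have "(\<Sum>C \<in> Pow Z. f (card C)) = (\<Sum>k \<le> card Z. \<Sum>C | C \<in> Pow Z \<and> card C = k. f (card C))"
    using assms by (intro sum.group[symmetric]) (auto simp: card_mono)
  also have "\<dots> = (\<Sum>k \<le> card Z. of_nat (card Z choose k) * f k)"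
    using n_subsets[OF assms] by (intro sum.cong) (simp_all add: Pow_def)
  finally show ?thesis .
qed

lemma partition_sum_eq_number:
  assumes "finite Z"
  shows "partition_sum \<phi> Z = partition_number \<phi> (card Z)"
  using assms
proof (induction Z rule: finite_psubset_induct)
  case (psubset Z)
  show ?case
  proof (cases "Z = {}")
    case True
    then show ?thesis by (simp add: partition_sum_def partition_on_empty)
  next
    case False
    then obtain a Y where Y: "Z = insert a Y" "a \<notin> Y" by (meson mk_disjoint_insert ex_in_conv)
    have fin: "finite Y" using psubset.hyps Y by simp
    have "partition_sum \<phi> Z = (\<Sum>C \<in> Pow Y. \<phi> (Suc (card C)) * partition_number \<phi> (card Y - card C))"
      unfolding Y(1) partition_sum_insert[OF fin Y(2)]
    proof (rule sum.cong[OF refl])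
      fix C assume C: "C \<in> Pow Y"
      then have "partition_sum \<phi> (Y - C) = partition_number \<phi> (card (Y - C))"
        using Y by (intro psubset.IH) auto
      then show "\<phi> (Suc (card C)) * partition_sum \<phi> (Y - C) =
          \<phi> (Suc (card C)) * partition_number \<phi> (card Y - card C)"
        using C fin by (simp add: card_Diff_subset finite_subset)
    qed
    also have "\<dots> = partition_number \<phi> (card Z)"
      using sum_Pow_card[OF fin, of "\<lambda>k. \<phi> (Suc k) * partition_number \<phi> (card Y - k)"] Y fin by simp
    finally show ?thesis .
  qed
qed

definition dimension_formula :: "nat \<Rightarrow> rat" where
  "dimension_formula N = (\<Sum>A | equiv {1..N} A. fact N * rel_weight N A)"

lemma dimension_formula_eq: "dimension_formula N = fact N * partition_number block_weight N"
  using sum_rel_weight[of N] partition_sum_eq_number[of "{1..N}" block_weight]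
  by (simp add: dimension_formula_def sum_distrib_left[symmetric])

lemma dimension_formula_values:
  "dimension_formula 1 = 1" "dimension_formula 2 = 3" "dimension_formula 3 = 20"
  "dimension_formula 4 = 217" "dimension_formula 5 = 3364"
  unfolding dimension_formula_eq
  by (simp_all add: eval_nat_numeral block_weight_def fact_numeral)

section \<open>The action on coloured words\<close>

text \<open>
  Coefficient functions of formal sums of pairs \<open>(A, w)\<close>. Two letters \<open>x\<close> and \<open>y\<close> have the same colour if
  \<open>A `` {x} = A `` {y}\<close>. This is an equivalence relation on letters for every relation \<open>A\<close>, so the operators
  below satisfy the defining relations on all functions, without conditions on \<open>A\<close> and \<open>w\<close>.
\<close>

type_synonym 'k coloured_words = "(nat \<times> nat) set \<times> (nat \<Rightarrow> nat) \<Rightarrow> 'k"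

definition fscale :: "'k::field \<Rightarrow> ('i \<Rightarrow> 'k) \<Rightarrow> 'i \<Rightarrow> 'k" where
  "fscale c f = (\<lambda>x. c * f x)"

interpretation fvs: vector_space "fscale :: 'k::field \<Rightarrow> ('i \<Rightarrow> 'k) \<Rightarrow> 'i \<Rightarrow> 'k"
  by standard (auto simp: fscale_def fun_eq_iff algebra_simps)

text \<open>
  The action of \<open>g\<^sub>s\<close> for a transposition \<open>s\<close>, phrased without naming the two points that \<open>s\<close> exchanges,
  since the generators of the algebra carry \<open>s\<close> as a permutation. For \<open>s = (i i+1)\<close> it reads as in
  \<open>braid_act_adj\<close>. In the case \<open>w i = w (i + 1)\<close>, which occurs only outside permutations, it is
  multiplication by \<open>q\<close>.
\<close>

definition braid_act :: "'k::field \<Rightarrow> (nat \<Rightarrow> nat) \<Rightarrow> 'k coloured_words \<Rightarrow> 'k coloured_words" where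
  "braid_act q s f = (\<lambda>(A, w).
     if \<exists>k. A `` {w k} \<noteq> A `` {w (s k)} then f (A, w \<circ> s)
     else if \<forall>k. k < s k \<longrightarrow> w k \<le> w (s k) then q * f (A, w \<circ> s)
     else f (A, w \<circ> s) + (q - 1) * f (A, w))"

definition tie_act :: "(nat \<Rightarrow> nat) \<Rightarrow> 'k::field coloured_words \<Rightarrow> 'k coloured_words" where
  "tie_act r f = (\<lambda>(A, w). if \<forall>k. A `` {w k} = A `` {w (r k)} then f (A, w) else 0)"

lemma braid_act_adj:
  "braid_act q (adj i) f (A, w) =
     (if A `` {w i} \<noteq> A `` {w (Suc i)} then f (A, w \<circ> adj i)
      else if w i \<le> w (Suc i) then q * f (A, w \<circ> adj i)
      else f (A, w \<circ> adj i) + (q - 1) * f (A, w))"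
proof -
  have 1: "(\<exists>k. A `` {w k} \<noteq> A `` {w (adj i k)}) \<longleftrightarrow> A `` {w i} \<noteq> A `` {w (Suc i)}"
    by (auto simp: transpose_def)
  have 2: "(\<forall>k. k < adj i k \<longrightarrow> w k \<le> w (adj i k)) \<longleftrightarrow> w i \<le> w (Suc i)"
    by (auto simp: transpose_def)
  show ?thesis
    unfolding braid_act_def prod.case 1 2 by simp
qed

lemma tie_act_apply:
  "tie_act r f (A, w) = (if \<forall>k. A `` {w k} = A `` {w (r k)} then f (A, w) else 0)"
  by (simp add: tie_act_def)

lemma tie_transpose_iff:
  "(\<forall>k. A `` {w k} = A `` {w (transpose a b k)}) \<longleftrightarrow> A `` {w a} = A `` {w b}"
  by (auto simp: transpose_def)

lemma comp_adj_adj: "w \<circ> adj i \<circ> adj i = w"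
  by (simp add: comp_assoc)

lemma comp_adj_braid: "w \<circ> adj (Suc i) \<circ> adj i \<circ> adj (Suc i) = w \<circ> adj i \<circ> adj (Suc i) \<circ> adj i"
  by (auto simp: fun_eq_iff transpose_def)

lemma comp_adj_far: "Suc i < j \<Longrightarrow> w \<circ> adj j \<circ> adj i = w \<circ> adj i \<circ> adj j"
  by (auto simp: fun_eq_iff transpose_def)

text \<open>
  Both sides of the braid relation, evaluated at a word with letters \<open>a\<close>, \<open>b\<close>, \<open>c\<close> in three neighbouring
  positions, involve only the values of the function at the six rearrangements of these letters. For
  each pattern of equal colours and each order of the letters the claim is an identity in \<open>q\<close>.
\<close>

lemma braid_arith:
  fixes q :: "'k::field" and a b c :: nat and C :: "nat \<Rightarrow> 'c"
  defines "st \<equiv> \<lambda>x y G1 G0. if C x \<noteq> C y then G1 else if x \<le> y then q * G1 else G1 + (q - 1) * G0"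
  assumes "a = b \<Longrightarrow> Fs = F0 \<and> Fst = Ft \<and> Fts = Fsts"
    and "b = c \<Longrightarrow> Ft = F0 \<and> Fts = Fs \<and> Fst = Fsts"
    and "a = c \<Longrightarrow> Fst = Fs \<and> Fts = Ft \<and> Fsts = F0"
  shows "st a b (st a c (st b c Fsts Fst) (st b a F0 Fs)) (st b c (st a c Fts Ft) (st a b Fs F0)) =
         st b c (st a c (st a b Fsts Fts) (st c b F0 Ft)) (st a b (st a c Fst Fs) (st b c Ft F0))"
proof -
  consider "C a = C b" "C b = C c" | "C a = C b" "C b \<noteq> C c" | "C a \<noteq> C b" "C b = C c"
    | "C a \<noteq> C b" "C b \<noteq> C c" "C a = C c" | "C a \<noteq> C b" "C b \<noteq> C c" "C a \<noteq> C c"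
    by metis
  then show ?thesis
  proof cases
    case 1
    then show ?thesis
      using assms(2-) unfolding st_def
      by (cases rule: linorder_cases[of a b]; cases rule: linorder_cases[of b c];
          cases rule: linorder_cases[of a c]; simp; simp add: algebra_simps)
  next
    case 2
    then show ?thesis
      using assms(2-) unfolding st_def
      by (cases rule: linorder_cases[of a b]) (auto simp: algebra_simps)
  next
    case 3
    then show ?thesis
      using assms(2-) unfolding st_def
      by (cases rule: linorder_cases[of b c]) (auto simp: algebra_simps)
  next
    case 4
    then show ?thesis
      using assms(2-) unfolding st_def
      by (cases rule: linorder_cases[of a c]) (auto simp: algebra_simps)
  next
    case 5
    then show ?thesis unfolding st_def by auto
  qed
qed

lemma braid_act_braid:
  "braid_act q (adj i) (braid_act q (adj (Suc i)) (braid_act q (adj i) f)) =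
   braid_act q (adj (Suc i)) (braid_act q (adj i) (braid_act q (adj (Suc i)) f))"
proof
  fix x :: "(nat \<times> nat) set \<times> (nat \<Rightarrow> nat)"
  obtain A w where x: "x = (A, w)" by (cases x)
  define s where "s = adj i"
  define t where "t = adj (Suc i)"
  have [simp]: "s i = Suc i" "s (Suc i) = i" "s (Suc (Suc i)) = Suc (Suc i)"
    "t i = i" "t (Suc i) = Suc (Suc i)" "t (Suc (Suc i)) = Suc i"
    by (simp_all add: s_def t_def transpose_def)
  have words [simp]: "u \<circ> s \<circ> s = u" "u \<circ> t \<circ> t = u" "u \<circ> t \<circ> s \<circ> t = u \<circ> s \<circ> t \<circ> s" for u :: "nat \<Rightarrow> nat"
    unfolding s_def t_def by (rule comp_adj_adj comp_adj_braid)+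
  have act: "braid_act q s g (A, u) = (if A `` {u i} \<noteq> A `` {u (Suc i)} then g (A, u \<circ> s)
      else if u i \<le> u (Suc i) then q * g (A, u \<circ> s) else g (A, u \<circ> s) + (q - 1) * g (A, u))"
    "braid_act q t g (A, u) = (if A `` {u (Suc i)} \<noteq> A `` {u (Suc (Suc i))} then g (A, u \<circ> t)
      else if u (Suc i) \<le> u (Suc (Suc i)) then q * g (A, u \<circ> t) else g (A, u \<circ> t) + (q - 1) * g (A, u))" for g u
    unfolding s_def t_def by (rule braid_act_adj)+
  have "w i = w (Suc i) \<Longrightarrow> w \<circ> s = w" "w (Suc i) = w (Suc (Suc i)) \<Longrightarrow> w \<circ> t = w"
    "w i = w (Suc i) \<Longrightarrow> w \<circ> t \<circ> s = w \<circ> s \<circ> t \<circ> s"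
    "w (Suc i) = w (Suc (Suc i)) \<Longrightarrow> w \<circ> s \<circ> t = w \<circ> s \<circ> t \<circ> s"
    "w (Suc i) = w (Suc (Suc i)) \<Longrightarrow> w \<circ> t \<circ> s = w \<circ> s"
    "w i = w (Suc (Suc i)) \<Longrightarrow> w \<circ> s \<circ> t = w \<circ> s" "w i = w (Suc (Suc i)) \<Longrightarrow> w \<circ> t \<circ> s = w \<circ> t"
    "w i = w (Suc (Suc i)) \<Longrightarrow> w \<circ> s \<circ> t \<circ> s = w"
    by (auto simp: fun_eq_iff transpose_def s_def t_def)
  note eqs = this
  have ev: "(u \<circ> s) i = u (Suc i)" "(u \<circ> s) (Suc i) = u i" "(u \<circ> s) (Suc (Suc i)) = u (Suc (Suc i))"
    "(u \<circ> t) i = u i" "(u \<circ> t) (Suc i) = u (Suc (Suc i))" "(u \<circ> t) (Suc (Suc i)) = u (Suc i)" for u :: "nat \<Rightarrow> nat"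
    by simp_all
  have "braid_act q s (braid_act q t (braid_act q s f)) (A, w) =
      braid_act q t (braid_act q s (braid_act q t f)) (A, w)"
    unfolding act ev words
  proof (rule braid_arith[of "w i" "w (Suc i)" "f (A, w \<circ> s)" "f (A, w)" "f (A, w \<circ> s \<circ> t)" "f (A, w \<circ> t)"
        "f (A, w \<circ> t \<circ> s)" "f (A, w \<circ> s \<circ> t \<circ> s)" "w (Suc (Suc i))" "\<lambda>x. A `` {x}" q])
    assume "w i = w (Suc i)"
    then show "f (A, w \<circ> s) = f (A, w) \<and> f (A, w \<circ> s \<circ> t) = f (A, w \<circ> t) \<and>
        f (A, w \<circ> t \<circ> s) = f (A, w \<circ> s \<circ> t \<circ> s)"
      using eqs(1,3) by metis
  next
    assume "w (Suc i) = w (Suc (Suc i))"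
    then show "f (A, w \<circ> t) = f (A, w) \<and> f (A, w \<circ> t \<circ> s) = f (A, w \<circ> s) \<and>
        f (A, w \<circ> s \<circ> t) = f (A, w \<circ> s \<circ> t \<circ> s)"
      using eqs(2,4,5) by metis
  next
    assume "w i = w (Suc (Suc i))"
    then show "f (A, w \<circ> s \<circ> t) = f (A, w \<circ> s) \<and> f (A, w \<circ> t \<circ> s) = f (A, w \<circ> t) \<and>
        f (A, w \<circ> s \<circ> t \<circ> s) = f (A, w)"
      using eqs(6-8) by metis
  qed
  then show "braid_act q (adj i) (braid_act q (adj (Suc i)) (braid_act q (adj i) f)) x =
      braid_act q (adj (Suc i)) (braid_act q (adj i) (braid_act q (adj (Suc i)) f)) x"
    unfolding x s_def t_def .
qed

lemma braid_act_far:
  assumes "Suc i < j"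
  shows "braid_act q (adj i) (braid_act q (adj j) f) = braid_act q (adj j) (braid_act q (adj i) f)"
proof
  fix x :: "(nat \<times> nat) set \<times> (nat \<Rightarrow> nat)"
  obtain A w where x: "x = (A, w)" by (cases x)
  have [simp]: "adj i j = j" "adj i (Suc j) = Suc j" "adj j i = i" "adj j (Suc i) = Suc i"
    using assms by (simp_all add: transpose_def)
  show "braid_act q (adj i) (braid_act q (adj j) f) x = braid_act q (adj j) (braid_act q (adj i) f) x"
    unfolding x braid_act_adj using comp_adj_far[OF assms, of w]
    by (auto simp: algebra_simps)
qed

lemma tie_act_idem: "tie_act r (tie_act r f) = tie_act r f"
  by (auto simp: tie_act_def fun_eq_iff)

lemma tie_act_commute: "tie_act r (tie_act r' f) = tie_act r' (tie_act r f)"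
  by (auto simp: tie_act_def fun_eq_iff)

text \<open>
  On a word that is invariant in colour under \<open>r\<close>, moving positions by \<open>r\<close> does not change which of
  them have equal colours.
\<close>

lemma tie_act_conj:
  assumes "bij r"
  shows "tie_act r (tie_act r' f) = tie_act r (tie_act (inv' r \<circ> r' \<circ> r) f)"
proof
  fix x :: "(nat \<times> nat) set \<times> (nat \<Rightarrow> nat)"
  obtain A w where x: "x = (A, w)" by (cases x)
  have "(\<forall>k. A `` {w k} = A `` {w (r' k)}) \<longleftrightarrow> (\<forall>k. A `` {w k} = A `` {w (inv' r (r' (r k)))})"
    if t: "\<forall>k. A `` {w k} = A `` {w (r k)}"
  proof -
    have "A `` {w (inv' r (r' (r k)))} = A `` {w (r' (r k))}" for k
      using t[rule_format, of "inv' r (r' (r k))"] assms by (simp add: surj_f_inv_f bij_is_surj)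
    then have "(\<forall>k. A `` {w k} = A `` {w (inv' r (r' (r k)))}) \<longleftrightarrow> (\<forall>k. A `` {w (r k)} = A `` {w (r' (r k))})"
      using t by auto
    also have "\<dots> \<longleftrightarrow> (\<forall>k. A `` {w k} = A `` {w (r' k)})"
      using assms by (metis bij_pointE)
    finally show ?thesis by simp
  qed
  then show "tie_act r (tie_act r' f) x = tie_act r (tie_act (inv' r \<circ> r' \<circ> r) f) x"
    unfolding x by (auto simp: tie_act_apply)
qed

lemma braid_act_tie:
  "braid_act q (adj i) (tie_act r f) = tie_act (adj i \<circ> r \<circ> adj i) (braid_act q (adj i) f)"
proof
  fix x :: "(nat \<times> nat) set \<times> (nat \<Rightarrow> nat)"
  obtain A w where x: "x = (A, w)" by (cases x)
  let ?P = "\<forall>k. A `` {w k} = A `` {w (adj i (r (adj i k)))}"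
  have 1: "(\<forall>k. A `` {w (adj i k)} = A `` {w (adj i (r k))}) \<longleftrightarrow> ?P"
    by (metis transpose_involutory)
  have 2: "(\<forall>k. A `` {w k} = A `` {w (r k)}) \<longleftrightarrow> ?P" if "A `` {w i} = A `` {w (Suc i)}"
  proof -
    have "A `` {w (adj i k)} = A `` {w k}" for k
      using that by (simp add: transpose_def)
    then show ?thesis
      using 1 by simp
  qed
  show "braid_act q (adj i) (tie_act r f) x = tie_act (adj i \<circ> r \<circ> adj i) (braid_act q (adj i) f) x"
  proof (cases "A `` {w i} = A `` {w (Suc i)}")
    case True
    show ?thesis
      unfolding x braid_act_adj tie_act_apply using 1 2[OF True] True by simp
  next
    case False
    then show ?thesis
      unfolding x braid_act_adj tie_act_apply using 1 by simp
  qed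
qed

text \<open>
  If the letters at \<open>i\<close> and \<open>i + 1\<close> have different colours, both sides are \<open>f\<close>; otherwise the tie acts as
  the identity and this is the quadratic relation of the Hecke algebra.
\<close>

lemma braid_act_quadratic:
  "braid_act q (adj i) (braid_act q (adj i) f) =
     f + fscale (q - 1) (tie_act (adj i) (f + braid_act q (adj i) f))"
proof
  fix x :: "(nat \<times> nat) set \<times> (nat \<Rightarrow> nat)"
  obtain A w where x: "x = (A, w)" by (cases x)
  have [simp]: "w \<circ> adj i = w" if "w i = w (Suc i)"
    using that by (auto simp: fun_eq_iff transpose_def)
  show "braid_act q (adj i) (braid_act q (adj i) f) x =
     (f + fscale (q - 1) (tie_act (adj i) (f + braid_act q (adj i) f))) x"
    unfolding x plus_fun_apply fscale_def tie_act_apply tie_transpose_iff braid_act_adj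
    by (auto simp: comp_adj_adj algebra_simps)
qed

lemma linear_braid_act: "Vector_Spaces.linear fscale fscale (braid_act q s)"
  by unfold_locales (auto simp: braid_act_def fscale_def fun_eq_iff algebra_simps)

lemma linear_tie_act: "Vector_Spaces.linear fscale fscale (tie_act r)"
  by unfold_locales (auto simp: tie_act_def fscale_def fun_eq_iff algebra_simps)

lemma linear_imp_module_hom:
  "Vector_Spaces.linear s1 s2 f \<Longrightarrow> module_hom s1 s2 f"
  by (simp add: Vector_Spaces.linear_def module_hom_def)

lemmas braid_act_add = module_hom.add[OF linear_imp_module_hom[OF linear_braid_act]]
lemmas braid_act_scale = module_hom.scale[OF linear_imp_module_hom[OF linear_braid_act]]

section \<open>Ties of intervals in braid-stable subspaces\<close>

definition monochrome :: "nat set \<Rightarrow> (nat \<times> nat) set \<Rightarrow> (nat \<Rightarrow> nat) \<Rightarrow> bool" where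
  "monochrome b A w \<longleftrightarrow> (\<forall>k \<in> b. \<forall>l \<in> b. A `` {w k} = A `` {w l})"

definition block_tie :: "nat set \<Rightarrow> 'k::field coloured_words \<Rightarrow> 'k coloured_words" where
  "block_tie b f = (\<lambda>(A, w). if monochrome b A w then f (A, w) else 0)"

lemma block_tie_apply:
  "block_tie b f (A, w) = (if monochrome b A w then f (A, w) else 0)"
  by (simp add: block_tie_def)

lemma linear_block_tie: "Vector_Spaces.linear fscale fscale (block_tie b)"
  by unfold_locales (auto simp: block_tie_def fscale_def fun_eq_iff algebra_simps)

lemmas block_tie_add = module_hom.add[OF linear_imp_module_hom[OF linear_block_tie]]
lemmas block_tie_scale = module_hom.scale[OF linear_imp_module_hom[OF linear_block_tie]]

definition braid_stable :: "nat \<Rightarrow> 'k::field \<Rightarrow> 'k coloured_words set \<Rightarrow> bool" where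
  "braid_stable N q W \<longleftrightarrow> fvs.subspace W \<and> (\<forall>i \<in> {1..<N}. \<forall>f \<in> W. braid_act q (adj i) f \<in> W)"

lemma block_tie_braid_act:
  assumes "k \<in> b" "Suc k \<in> b"
  shows "block_tie b (braid_act q (adj k) f) = braid_act q (adj k) (block_tie b f)"
proof
  fix x :: "(nat \<times> nat) set \<times> (nat \<Rightarrow> nat)"
  obtain A w where x: "x = (A, w)" by (cases x)
  have "adj k l \<in> b \<longleftrightarrow> l \<in> b" for l using assms by (auto simp: transpose_def)
  then have "monochrome b A (w \<circ> adj k) \<longleftrightarrow> monochrome b A w"
    unfolding monochrome_def o_apply by (metis transpose_involutory)
  then show "block_tie b (braid_act q (adj k) f) x = braid_act q (adj k) (block_tie b f) x"
    unfolding x block_tie_apply braid_act_adj by simp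
qed

lemma block_tie_quadratic:
  assumes "k \<in> b" "Suc k \<in> b"
  shows "block_tie b (braid_act q (adj k) (braid_act q (adj k) f)) =
    fscale q (block_tie b f) + fscale (q - 1) (block_tie b (braid_act q (adj k) f))"
proof -
  have "block_tie b (tie_act (adj k) h) = block_tie b h" for h :: "'a coloured_words"
  proof -
    have "A `` {w k} = A `` {w (Suc k)}" if "monochrome b A w" for A w
      using that assms unfolding monochrome_def by blast
    then show ?thesis
      by (simp add: fun_eq_iff block_tie_apply tie_act_apply tie_transpose_iff)
  qed
  then show ?thesis
    unfolding braid_act_quadratic
    by (simp add: block_tie_add block_tie_scale) (simp add: fun_eq_iff fscale_def algebra_simps)
qed

text \<open>
  Two overlapping intervals that are each monochrome have a monochrome union. The exchange at \<open>m\<close> moves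
  a letter out of the second interval, but only into a position of the same colour, once the first
  interval is monochrome as well.
\<close>

lemma block_tie_join:
  assumes "i \<le> m" "Suc m \<le> j"
  shows "block_tie {i..Suc m} (block_tie {Suc m..j} f + braid_act q (adj m) (block_tie {Suc m..j} f)) =
    block_tie {i..j} (f + braid_act q (adj m) f)"
proof
  fix x :: "(nat \<times> nat) set \<times> (nat \<Rightarrow> nat)"
  obtain A w where x: "x = (A, w)" by (cases x)
  show "block_tie {i..Suc m} (block_tie {Suc m..j} f + braid_act q (adj m) (block_tie {Suc m..j} f)) x =
    block_tie {i..j} (f + braid_act q (adj m) f) x"
  proof (cases "\<forall>k \<in> {i..Suc m}. A `` {w k} = A `` {w (Suc m)}")
    case True
    have m: "A `` {w m} = A `` {w (Suc m)}" by (rule bspec[OF True]) (use assms in simp)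
    have 1: "monochrome {i..Suc m} A w"
      unfolding monochrome_def by (intro ballI trans[OF bspec[OF True] bspec[OF True, symmetric]])
    have 2: "monochrome {i..j} A w \<longleftrightarrow> monochrome {Suc m..j} A w"
    proof
      assume R: "monochrome {Suc m..j} A w"
      have "A `` {w k} = A `` {w (Suc m)}" if "k \<in> {i..j}" for k
      proof (cases "k \<le> Suc m")
        case False
        then show ?thesis using R that assms unfolding monochrome_def by (meson atLeastAtMost_iff nat_le_linear order_refl)
      next
        case k: True
        show ?thesis by (rule bspec[OF True]) (use k that in simp)
      qed
      note * = this
      show "monochrome {i..j} A w"
        unfolding monochrome_def by (intro ballI trans[OF * *[symmetric]])
    next
      have "{Suc m..j} \<subseteq> {i..j}" using assms by auto
      then show "monochrome {i..j} A w \<Longrightarrow> monochrome {Suc m..j} A w"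
        unfolding monochrome_def by blast
    qed
    have "A `` {w (adj m k)} = A `` {w k}" for k using m by (simp add: transpose_def)
    then have 3: "monochrome {Suc m..j} A (w \<circ> adj m) \<longleftrightarrow> monochrome {Suc m..j} A w"
      unfolding monochrome_def o_apply by simp
    show ?thesis
      unfolding x plus_fun_apply block_tie_apply braid_act_adj 2 3 using m 1 by simp
  next
    case False
    then have 1: "\<not> monochrome {i..Suc m} A w"
      using assms unfolding monochrome_def by (meson atLeastAtMost_iff le_SucI order_refl)
    have "{i..Suc m} \<subseteq> {i..j}" using assms by auto
    then have 2: "\<not> monochrome {i..j} A w" using 1 unfolding monochrome_def by blast
    show ?thesis unfolding x block_tie_apply if_not_P[OF 1] if_not_P[OF 2] ..
  qed
qed

text \<open>
  A tie need not preserve a braid-stable subspace, but \<open>e\<^sub>b (1 + g\<^sub>k)\<close> does, for an interval \<open>b\<close>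
  that contains \<open>k\<close> and \<open>k + 1\<close>. For \<open>b = {i, i + 1}\<close> this is the quadratic relation, solved for
  \<open>e (1 + g)\<close>, which needs \<open>q \<noteq> 1\<close>. A longer interval is the union of two shorter ones that overlap in a
  point, and the induction hypothesis provides \<open>e\<^sub>b (1 + g\<^sub>m) (1 + g\<^sub>m\<^sub>+\<^sub>1)\<close>. The two factors are separated
  by means of the symmetriser of the three positions \<open>m\<close>, \<open>m + 1\<close>, \<open>m + 2\<close>; this needs \<open>q \<noteq> - 1\<close> and
  \<open>q \<noteq> 0\<close>.
\<close>

lemma braid_stable_block_tie:
  assumes W: "braid_stable N q W" and q: "q \<noteq> 0" "q \<noteq> 1" "q \<noteq> - 1"
    and "1 \<le> i" "j \<le> N" "i \<le> k" "k < j" "f \<in> W"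
  shows "block_tie {i..j} (f + braid_act q (adj k) f) \<in> W"
  using assms(5-)
proof (induction "j - i" arbitrary: i j k f rule: less_induct)
  case less
  have sub: "fvs.subspace W" and act: "\<And>i f. i \<in> {1..<N} \<Longrightarrow> f \<in> W \<Longrightarrow> braid_act q (adj i) f \<in> W"
    using W by (auto simp: braid_stable_def)
  note add = fvs.subspace_add[OF sub] and scale = fvs.subspace_scale[OF sub] and diff = fvs.subspace_diff[OF sub]
  have scaleD: "h \<in> W" if "fscale c h \<in> W" "c \<noteq> 0" for c h
    using scale[OF that(1), of "inverse c"] that(2) by simp
  show ?case
  proof (cases "j = Suc i")
    case True
    then have k: "k = i" using less.prems by simp
    have "{i..j} = {i, Suc i}" using True by auto
    then have tie: "block_tie {i..j} h = tie_act (adj i) h" for h :: "'a coloured_words"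
      by (auto simp: fun_eq_iff block_tie_apply tie_act_apply tie_transpose_iff monochrome_def)
    have "fscale (q - 1) (tie_act (adj i) (f + braid_act q (adj i) f)) =
        braid_act q (adj i) (braid_act q (adj i) f) - f"
      unfolding braid_act_quadratic by simp
    also have "\<dots> \<in> W"
      using less.prems k by (intro diff act) auto
    finally show ?thesis
      unfolding tie k using q(2) by (auto intro: scaleD)
  next
    case False
    then have "Suc i < j" using less.prems by simp
    have step: "block_tie {i..j} (f + braid_act q (adj m) f) \<in> W \<and>
        block_tie {i..j} (f + braid_act q (adj (Suc m)) f) \<in> W" if m: "i \<le> m" "Suc m < j" for m
    proof -
      define a where "a = (braid_act q (adj m) :: 'a coloured_words \<Rightarrow> _)"
      define c where "c = (braid_act q (adj (Suc m)) :: 'a coloured_words \<Rightarrow> _)"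
      define T where "T = (block_tie {i..j} :: 'a coloured_words \<Rightarrow> _)"
      have a_add: "a (g + h) = a g + a h" and a_sc: "a (fscale x g) = fscale x (a g)"
        and c_add: "c (g + h) = c g + c h" and c_sc: "c (fscale x g) = fscale x (c g)"
        and T_add: "T (g + h) = T g + T h" and T_sc: "T (fscale x g) = fscale x (T g)" for g h x
        unfolding a_def c_def T_def
        by (rule braid_act_add braid_act_scale block_tie_add block_tie_scale)+
      have Ta: "a (T g) = T (a g)" and Tc: "c (T g) = T (c g)" for g
        unfolding a_def c_def T_def using m
        by (auto intro!: block_tie_braid_act[symmetric])
      have Taa: "T (a (a g)) = fscale q (T g) + fscale (q - 1) (T (a g))"
        and Tcc: "T (c (c g)) = fscale q (T g) + fscale (q - 1) (T (c g))" for g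
        unfolding a_def c_def T_def using m by (auto intro!: block_tie_quadratic)
      have cac: "c (a (c g)) = a (c (a g))" for g
        unfolding a_def c_def by (rule braid_act_braid[symmetric])
      have aW: "a g \<in> W" and cW: "c g \<in> W" if "g \<in> W" for g
        unfolding a_def c_def using that m less.prems by (auto intro!: act)
      note lin = a_add a_sc c_add c_sc T_add T_sc
      let ?y = "\<lambda>h. h + a h + a (c h)" and ?z = "\<lambda>h. h + c h + c (a h)"
      (* The sum over the six elements of the group generated by both exchanges. On words with b
         monochrome it is an eigenvector of a and c for the eigenvalue q. *)
      define S where "S h = ?y h + c (?y h)" for h
      have S': "S h = ?z h + a (?z h)" for h
        unfolding S_def lin cac by (simp add: add_ac)
      have SW: "S h \<in> W" if "h \<in> W" for h
        unfolding S_def using that by (intro add aW cW)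
      have TcS: "T (c (S h)) = fscale q (T (S h))" for h
        unfolding S_def[of h] c_add T_add Tcc by (simp add: fun_eq_iff fscale_def algebra_simps)
      have TaS: "T (a (S h)) = fscale q (T (S h))" for h
        unfolding S'[of h] a_add T_add Taa by (simp add: fun_eq_iff fscale_def algebra_simps)
      (* The induction hypothesis for the two shorter intervals. *)
      let ?Z = "\<lambda>h. T ((h + c h) + a (h + c h))"
      have ZW: "?Z h \<in> W" if "h \<in> W" for h
      proof -
        have 1: "block_tie {Suc m..j} (h + c h) \<in> W"
          unfolding c_def using m less.prems that by (intro less.hyps) auto
        have "block_tie {i..Suc m} (block_tie {Suc m..j} (h + c h) +
            braid_act q (adj m) (block_tie {Suc m..j} (h + c h))) \<in> W"
          using m less.prems 1 by (intro less.hyps) auto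
        then show ?thesis
          unfolding T_def a_def using block_tie_join[of i m j "h + c h" q] m by simp
      qed
      have "T (a (c (S f))) = a (fscale q (T (S f)))"
        unfolding Ta[symmetric] TcS ..
      then have "T (a (c (S f))) = fscale q (fscale q (T (S f)))"
        unfolding a_sc Ta TaS .
      then have "?Z (S f) = fscale ((1 + q) * (1 + q)) (T (S f))"
        unfolding lin TcS TaS by (simp add: fun_eq_iff fscale_def algebra_simps)
      then have "fscale ((1 + q) * (1 + q)) (T (S f)) \<in> W"
        using ZW[OF SW[OF less.prems(5)]] by simp
      moreover have "1 + q \<noteq> 0" using q(3) by (metis add_eq_0_iff)
      ultimately have TS: "T (S f) \<in> W" by (auto intro: scaleD)
      (* (1 + a) (1 + c) (1 + a) and the symmetriser differ by a multiple of 1 + a. *)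
      have "?Z (f + a f) - T (S f) = fscale q (T (f + a f))"
        unfolding S_def lin cac Taa by (simp add: fun_eq_iff fscale_def algebra_simps)
      moreover have "?Z (f + a f) - T (S f) \<in> W"
        using less.prems(5) by (intro diff TS ZW add aW)
      ultimately have 1: "T (f + a f) \<in> W" using q(1) by (auto intro: scaleD)
      have "?Z f + c (?Z f) - T (S f) = fscale q (T (f + c f))"
        unfolding S_def lin Tc cac Tcc by (simp add: fun_eq_iff fscale_def algebra_simps)
      moreover have "?Z f + c (?Z f) - T (S f) \<in> W"
        using less.prems(5) by (intro diff TS ZW add cW)
      ultimately have 2: "T (f + c f) \<in> W" using q(1) by (auto intro: scaleD)
      show ?thesis using 1 2 unfolding T_def a_def c_def by blast
    qed
    show ?thesis
    proof (cases "Suc k < j")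
      case True
      then show ?thesis using step[of k] less.prems by blast
    next
      case False
      then have "k = Suc (k - 1)" "i \<le> k - 1" "Suc (k - 1) < j"
        using \<open>Suc i < j\<close> less.prems by auto
      then show ?thesis using step[of "k - 1"] by metis
    qed
  qed
qed

section \<open>Leading vectors\<close>

text \<open>
  For \<open>v = id\<close> this is the cyclic vector \<open>\<xi>\<close>: the word \<open>v\<close> in all colourings at once.
\<close>

definition word_vec :: "nat \<Rightarrow> (nat \<Rightarrow> nat) \<Rightarrow> 'k::field coloured_words" where
  "word_vec N v = (\<lambda>(A, w). if equiv {1..N} A \<and> w = v then 1 else 0)"

lemma word_vec_apply: "word_vec N v (A, w) = (if equiv {1..N} A \<and> w = v then 1 else 0)"
  by (simp add: word_vec_def)

lemma comp_adj_eq_iff: "w \<circ> adj i = v \<longleftrightarrow> w = v \<circ> adj i"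
  by (metis comp_adj_adj)

lemma braid_act_word_vec:
  assumes "w i < w (Suc i)"
  shows "braid_act q (adj i) (word_vec N w) = word_vec N (w \<circ> adj i)"
proof
  fix x :: "(nat \<times> nat) set \<times> (nat \<Rightarrow> nat)"
  obtain A u where x: "x = (A, u)" by (cases x)
  have ne: "w \<noteq> w \<circ> adj i"
  proof
    assume "w = w \<circ> adj i"
    then have "w i = (w \<circ> adj i) i" by simp
    then show False using assms by simp
  qed
  have desc: "(w \<circ> adj i) (Suc i) < (w \<circ> adj i) i" using assms by simp
  consider "u = w" | "u = w \<circ> adj i" | "u \<noteq> w" "u \<noteq> w \<circ> adj i" by blast
  then show "braid_act q (adj i) (word_vec N w) x = word_vec N (w \<circ> adj i) x"
  proof cases
    case 1
    then show ?thesis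
      unfolding x braid_act_adj word_vec_apply comp_adj_eq_iff using ne assms by simp
  next
    case 2
    then show ?thesis
      unfolding x braid_act_adj word_vec_apply comp_adj_eq_iff using ne desc by simp
  next
    case 3
    then show ?thesis
      unfolding x braid_act_adj word_vec_apply comp_adj_eq_iff by simp
  qed
qed

lemma braid_stable_word_vec:
  assumes "braid_stable N q W" "word_vec N id \<in> W" "w permutes {1..N}"
  shows "word_vec N w \<in> W"
  using assms(3)
proof (induction rule: perm_adj_induct)
  case id
  then show ?case using assms(2) .
next
  case (ascent w i)
  then have "braid_act q (adj i) (word_vec N w) \<in> W"
    using assms(1) by (simp add: braid_stable_def)
  then show ?case
    unfolding braid_act_word_vec[where w = w and i = i, OF ascent.hyps(3)] .
qed

lemma braid_act_nonzero:
  assumes "braid_act q (adj i) f (A, u) \<noteq> 0"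
  shows "f (A, u \<circ> adj i) \<noteq> 0 \<or> f (A, u) \<noteq> 0 \<and> A `` {u i} = A `` {u (Suc i)}"
proof (rule ccontr)
  assume "\<not> ?thesis"
  then have "f (A, u \<circ> adj i) = 0" "A `` {u i} = A `` {u (Suc i)} \<Longrightarrow> f (A, u) = 0" by blast+
  then have "braid_act q (adj i) f (A, u) = 0" unfolding braid_act_adj by simp
  with assms show False by simp
qed

lemma permutes_comp_adj_iff: "i \<in> {1..<N} \<Longrightarrow> w \<circ> adj i permutes {1..N} \<longleftrightarrow> w permutes {1..N}"
  using permutes_compose[OF adj_permutes, of i N w] permutes_compose[OF adj_permutes, of i N "w \<circ> adj i"]
  unfolding comp_adj_adj by blast

lemma card_inversions_comp_adj_le:
  assumes "i \<in> {1..<N}"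
  shows "card (inversions N w) \<le> Suc (card (inversions N (w \<circ> adj i)))"
proof (cases "w i = w (Suc i)")
  case True
  then have "w \<circ> adj i = w" by (auto simp: fun_eq_iff transpose_def)
  then show ?thesis by simp
next
  case False
  then consider "w i < w (Suc i)" | "w (Suc i) < w i" by linarith
  then show ?thesis
    using card_inversions_adj[OF assms, of w] card_inversions_adj_desc[OF assms, of w] by cases simp_all
qed

lemma monochrome_comp_adj_disjoint:
  assumes "k \<notin> b" "Suc k \<notin> b"
  shows "monochrome b A (w \<circ> adj k) \<longleftrightarrow> monochrome b A w"
proof -
  have "(w \<circ> adj k) l = w l" if "l \<in> b" for l
    using assms that by (metis o_apply transpose_apply_other)
  then show ?thesis unfolding monochrome_def by simp
qed

text \<open>
  For each block \<open>b\<close> choose a descent \<open>k\<close> of \<open>w\<close> in \<open>b\<close>. Undoing the exchange at \<open>k\<close> gives a word with fewer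
  inversions, and applying \<open>e\<^sub>b (1 + g\<^sub>k)\<close> to a vector with this leading word recovers \<open>w\<close> as leading
  word, now restricted to colourings in which \<open>b\<close> is monochrome. The blocks are disjoint, so the
  operators for different blocks do not interfere.
\<close>

lemma exists_leading_vector:
  assumes W: "braid_stable N q W" "word_vec N id \<in> W" and q: "q \<noteq> 0" "q \<noteq> 1" "q \<noteq> - 1"
    and "finite \<B>" "disjoint \<B>" "\<And>b. b \<in> \<B> \<Longrightarrow> \<exists>i j. 1 \<le> i \<and> j \<le> N \<and> b = {i..j}"
    and "w permutes {1..N}" "\<And>b. b \<in> \<B> \<Longrightarrow> \<exists>k. k \<in> b \<and> Suc k \<in> b \<and> w (Suc k) < w k"
  shows "\<exists>z \<in> W.
    (\<forall>A u. z (A, u) \<noteq> 0 \<longrightarrow> equiv {1..N} A \<and> u permutes {1..N} \<and> (\<forall>b \<in> \<B>. monochrome b A u) \<and>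
      (u = w \<or> card (inversions N u) < card (inversions N w))) \<and>
    (\<forall>A. equiv {1..N} A \<longrightarrow> (\<forall>b \<in> \<B>. monochrome b A w) \<longrightarrow> z (A, w) = 1)"
  using assms(6-)
proof (induction \<B> arbitrary: w rule: finite_induct)
  case empty
  show ?case
    using braid_stable_word_vec[OF W empty.prems(3)] empty.prems(3)
    by (intro bexI[of _ "word_vec N w"]) (auto simp: word_vec_apply split: if_splits)
next
  case (insert b \<B>)
  obtain i j where ij: "1 \<le> i" "j \<le> N" "b = {i..j}" using insert.prems(2)[of b] by blast
  obtain k where k: "k \<in> b" "Suc k \<in> b" "w (Suc k) < w k" using insert.prems(4)[of b] by blast
  have kN: "k \<in> {1..<N}" using ij k by auto
  define w1 where "w1 = w \<circ> adj k"
  have w: "w = w1 \<circ> adj k" unfolding w1_def comp_adj_adj ..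
  have inv: "Suc (card (inversions N w1)) = card (inversions N w)"
    unfolding w1_def by (rule card_inversions_adj_desc[OF kN k(3)])
  have perm1: "w1 permutes {1..N}"
    unfolding w1_def permutes_comp_adj_iff[OF kN] by (rule insert.prems(3))
  have disj: "k \<notin> b'" "Suc k \<notin> b'" if "b' \<in> \<B>" for b'
    using disjointD[OF insert.prems(1), of b b'] that k insert.hyps(2) by auto
  have "\<exists>z \<in> W.
    (\<forall>A u. z (A, u) \<noteq> 0 \<longrightarrow> equiv {1..N} A \<and> u permutes {1..N} \<and> (\<forall>b \<in> \<B>. monochrome b A u) \<and>
      (u = w1 \<or> card (inversions N u) < card (inversions N w1))) \<and>
    (\<forall>A. equiv {1..N} A \<longrightarrow> (\<forall>b \<in> \<B>. monochrome b A w1) \<longrightarrow> z (A, w1) = 1)"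
  proof (rule insert.IH[OF _ _ perm1])
    show "disjoint \<B>" by (rule pairwise_subset[OF insert.prems(1)]) auto
    show "\<exists>i j. 1 \<le> i \<and> j \<le> N \<and> b' = {i..j}" if "b' \<in> \<B>" for b'
      using insert.prems(2)[of b'] that by simp
    show "\<exists>k'. k' \<in> b' \<and> Suc k' \<in> b' \<and> w1 (Suc k') < w1 k'" if b': "b' \<in> \<B>" for b'
    proof -
      obtain k' where k': "k' \<in> b'" "Suc k' \<in> b'" "w (Suc k') < w k'" using insert.prems(4)[of b'] b' by blast
      moreover have "w1 l = w l" if "l \<in> b'" for l
        unfolding w1_def using disj[OF b'] that by (metis o_apply transpose_apply_other)
      ultimately show ?thesis by auto
    qed
  qed
  then obtain z1 where z1: "z1 \<in> W"
    and supp: "\<And>A u. z1 (A, u) \<noteq> 0 \<Longrightarrow> equiv {1..N} A \<and> u permutes {1..N} \<and> (\<forall>b \<in> \<B>. monochrome b A u) \<and>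
      (u = w1 \<or> card (inversions N u) < card (inversions N w1))"
    and lead: "\<And>A. equiv {1..N} A \<Longrightarrow> (\<forall>b \<in> \<B>. monochrome b A w1) \<Longrightarrow> z1 (A, w1) = 1"
    by blast
  define z where "z = block_tie b (z1 + braid_act q (adj k) z1)"
  have "z \<in> W"
    unfolding z_def ij(3) using ij k z1 by (intro braid_stable_block_tie[OF W(1) q]) auto
  moreover have "equiv {1..N} A \<and> u permutes {1..N} \<and> (\<forall>b \<in> insert b \<B>. monochrome b A u) \<and>
      (u = w \<or> card (inversions N u) < card (inversions N w))" if nz: "z (A, u) \<noteq> 0" for A u
  proof -
    have b: "monochrome b A u"
      using nz unfolding z_def block_tie_apply by (auto split: if_splits)
    have "(z1 + braid_act q (adj k) z1) (A, u) \<noteq> 0"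
      using nz unfolding z_def block_tie_apply by (auto split: if_splits)
    then consider "z1 (A, u) \<noteq> 0" | "z1 (A, u \<circ> adj k) \<noteq> 0"
      using braid_act_nonzero[of q k z1 A u] unfolding plus_fun_apply by fastforce
    then show ?thesis
    proof cases
      case 1
      then show ?thesis using supp[OF 1] b inv by auto
    next
      case 2
      note s = supp[OF 2]
      have "\<forall>b' \<in> \<B>. monochrome b' A u"
        using s monochrome_comp_adj_disjoint[OF disj, of _ A u] by blast
      moreover have "u permutes {1..N}" using s permutes_comp_adj_iff[OF kN, of u] by blast
      moreover have "u = w \<or> card (inversions N u) < card (inversions N w)"
      proof (cases "u \<circ> adj k = w1")
        case True
        then show ?thesis using comp_adj_eq_iff[of u k w1] w by metis
      next
        case False
        then have "card (inversions N (u \<circ> adj k)) < card (inversions N w1)" using s by blast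
        then show ?thesis using card_inversions_comp_adj_le[OF kN, of u] inv by linarith
      qed
      ultimately show ?thesis using s b by blast
    qed
  qed
  moreover have "z (A, w) = 1" if A: "equiv {1..N} A" and mono: "\<forall>b \<in> insert b \<B>. monochrome b A w" for A
  proof -
    have "\<forall>b' \<in> \<B>. monochrome b' A w1"
      unfolding w1_def using mono monochrome_comp_adj_disjoint[OF disj, of _ A w] by blast
    then have 1: "z1 (A, w1) = 1" by (rule lead[OF A])
    have "card (inversions N w) > card (inversions N w1)" using inv by simp
    then have 0: "z1 (A, w) = 0" using supp[of A w] by (metis not_less_iff_gr_or_eq)
    have "A `` {w k} = A `` {w (Suc k)}"
      using mono k unfolding monochrome_def by blast
    moreover have "\<not> w k \<le> w (Suc k)" using k by simp
    ultimately show ?thesis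
      using mono 0 1 unfolding z_def block_tie_apply plus_fun_apply braid_act_adj w1_def[symmetric] by simp
  qed
  ultimately show ?case by blast
qed

section \<open>From intervals to arbitrary classes\<close>

lemma inv_image_adj_invariant:
  assumes P: "equiv {1..N} P" and "(i, Suc i) \<in> P"
  shows "inv_image P (adj i) = P"
proof -
  have sym: "(Suc i, i) \<in> P" using P assms(2) by (meson equivE symD)
  have tr: "(x, z) \<in> P" if "(x, y) \<in> P" "(y, z) \<in> P" for x y z
    using P that by (meson equivE transD)
  have 1: "(x, adj i x) \<in> P" if "x \<in> {1..N}" for x
  proof -
    have "(x, x) \<in> P" using P that by (meson equivE refl_onD)
    then show ?thesis using assms(2) sym by (cases "x = i"; cases "x = Suc i") simp_all
  qed
  have dom: "x \<in> {1..N} \<and> y \<in> {1..N}" if "(x, y) \<in> P" for x y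
    using P that by (auto simp: equiv_def)
  have i: "i \<in> {1..<N}" using dom[OF assms(2)] by auto
  have 2: "(adj i x, x) \<in> P" if "x \<in> {1..N}" for x
    using 1[OF that] P by (meson equivE symD)
  have in_iff: "adj i x \<in> {1..N} \<longleftrightarrow> x \<in> {1..N}" for x
    by (rule permutes_in_image[OF adj_permutes[OF i]])
  have "(adj i x, adj i y) \<in> P \<longleftrightarrow> (x, y) \<in> P" for x y
  proof
    assume h: "(adj i x, adj i y) \<in> P"
    then have "x \<in> {1..N}" "y \<in> {1..N}" using dom in_iff by blast+
    then show "(x, y) \<in> P" using tr[OF tr[OF 1 h] 2] by blast
  next
    assume h: "(x, y) \<in> P"
    then have "x \<in> {1..N}" "y \<in> {1..N}" using dom by blast+
    then show "(adj i x, adj i y) \<in> P" using tr[OF tr[OF 2 h] 1] by blast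
  qed
  then show ?thesis by (auto simp: inv_image_def)
qed

lemma equiv_inv_image:
  assumes "equiv {1..N} P" "\<pi> permutes {1..N}"
  shows "equiv {1..N} (inv_image P \<pi>)"
proof (rule equivI)
  have im: "\<pi> x \<in> {1..N} \<longleftrightarrow> x \<in> {1..N}" for x by (rule permutes_in_image[OF assms(2)])
  have sub: "P \<subseteq> {1..N} \<times> {1..N}" using assms(1) by (auto simp: equiv_def)
  show "inv_image P \<pi> \<subseteq> {1..N} \<times> {1..N}"
    using im sub by (auto simp: inv_image_def simp del: atLeastAtMost_iff)
  show "refl_on {1..N} (inv_image P \<pi>)"
    using im assms(1) by (auto simp: inv_image_def equiv_def refl_on_def simp del: atLeastAtMost_iff)
  show "sym (inv_image P \<pi>)" using assms(1) by (auto simp: equiv_def intro: sym_inv_image)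
  show "trans (inv_image P \<pi>)" using assms(1) by (auto simp: equiv_def intro: trans_inv_image)
qed

lemma inv_image_comp: "inv_image (inv_image r f) g = inv_image r (f \<circ> g)"
  by (simp add: inv_image_def)

lemma tied_iff_related:
  assumes "equiv {1..N} A" "u permutes {1..N}" "x \<in> {1..N}"
  shows "A `` {u x} = A `` {u y} \<longleftrightarrow> (x, y) \<in> inv_image A u"
proof -
  have "u x \<in> {1..N}" using assms permutes_in_image by metis
  then have self: "u x \<in> A `` {u x}" by (rule equiv_class_self[OF assms(1)])
  have "A `` {u x} = A `` {u y} \<longleftrightarrow> (u x, u y) \<in> A"
  proof
    assume "A `` {u x} = A `` {u y}"
    then have "(u y, u x) \<in> A" using self by simp
    then show "(u x, u y) \<in> A" using assms(1) by (meson equivE symD)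
  qed (rule equiv_class_eq[OF assms(1)])
  then show ?thesis by simp
qed

text \<open>
  The pullback \<open>inv_image A u\<close> relates the positions that carry equally coloured letters.
\<close>

definition supported_over :: "nat \<Rightarrow> (nat \<times> nat) set \<Rightarrow> 'k::field coloured_words \<Rightarrow> bool" where
  "supported_over N P z \<longleftrightarrow> (\<forall>A u. z (A, u) \<noteq> 0 \<longrightarrow>
     equiv {1..N} A \<and> u permutes {1..N} \<and> P \<subseteq> inv_image A u)"

text \<open>
  The operators \<open>e\<^sub>b (1 + g\<^sub>k)\<close> are available for intervals \<open>b\<close> only. An arbitrary equivalence relation on
  positions is a pullback of one with interval classes, and the braids carry vectors for the latter
  to vectors for the former: sort step by step, and apply \<open>g\<^sub>i\<close> whenever \<open>i\<close> and \<open>i + 1\<close> are unrelated.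
  Then \<open>g\<^sub>i\<close> is a plain exchange at the pairs \<open>(A, u)\<close> whose pullback is exactly the given relation. If
  they are related, the exchange does not change the relation and nothing is to be done.
\<close>

lemma exists_transport:
  assumes W: "braid_stable N q W" and P0: "equiv {1..N} P0" and "w permutes {1..N}"
  shows "\<exists>\<pi>. \<pi> permutes {1..N} \<and> inv_image (inv_image P0 w) \<pi> = P0 \<and>
    (\<forall>z \<in> W. supported_over N P0 z \<longrightarrow> (\<exists>z' \<in> W. supported_over N (inv_image P0 w) z' \<and>
      (\<forall>A u. equiv {1..N} A \<and> u permutes {1..N} \<and> inv_image A u = inv_image P0 w \<longrightarrow>
        z' (A, u) = z (A, u \<circ> \<pi>))))"
  using assms(3)
proof (induction rule: perm_adj_induct)
  case id
  have "inv_image P0 id = P0" by (simp add: inv_image_def)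
  then show ?case
    by (intro exI[of _ id] conjI ballI impI permutes_id, simp only:) (rule bexI, simp_all only: comp_id simp_thms)
next
  case (ascent w i)
  let ?s = "adj i" and ?P = "inv_image P0 w"
  let ?P' = "inv_image P0 (w \<circ> ?s)"
  have P': "?P' = inv_image ?P ?s" by (simp add: inv_image_comp)
  have eqP: "equiv {1..N} ?P" by (rule equiv_inv_image[OF P0 ascent.hyps(1)])
  show ?case
  proof (cases "(i, Suc i) \<in> ?P")
    case True
    have same: "?P' = ?P" unfolding P' by (rule inv_image_adj_invariant[OF eqP True])
    show ?thesis unfolding same by (rule ascent.IH)
  next
    case False
    obtain \<pi> where \<pi>: "\<pi> permutes {1..N}" "inv_image ?P \<pi> = P0"
      and tr: "\<And>z. z \<in> W \<Longrightarrow> supported_over N P0 z \<Longrightarrow> \<exists>z' \<in> W. supported_over N ?P z' \<and>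
        (\<forall>A u. equiv {1..N} A \<and> u permutes {1..N} \<and> inv_image A u = ?P \<longrightarrow> z' (A, u) = z (A, u \<circ> \<pi>))"
      using ascent.IH by blast
    have notP': "(i, Suc i) \<notin> ?P'"
      using False eqP unfolding P' by (auto simp: inv_image_def equiv_def dest: symD)
    show ?thesis
    proof (intro exI[of _ "?s \<circ> \<pi>"] conjI ballI impI)
      show "?s \<circ> \<pi> permutes {1..N}"
        by (rule permutes_compose[OF \<pi>(1) adj_permutes[OF ascent.hyps(2)]])
      have "w \<circ> ?s \<circ> (?s \<circ> \<pi>) = w \<circ> \<pi>" by (metis comp_adj_adj comp_assoc)
      then show "inv_image ?P' (?s \<circ> \<pi>) = P0" using \<pi>(2) by (simp only: inv_image_comp)
      fix z assume "z \<in> W" "supported_over N P0 z"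
      from tr[OF this] obtain z' where z': "z' \<in> W" "supported_over N ?P z'"
        and val: "\<And>A u. equiv {1..N} A \<and> u permutes {1..N} \<and> inv_image A u = ?P \<Longrightarrow> z' (A, u) = z (A, u \<circ> \<pi>)"
        by blast
      let ?z = "braid_act q ?s z'"
      have "?z \<in> W" using W z'(1) ascent.hyps(2) by (simp add: braid_stable_def)
      moreover have "supported_over N ?P' ?z"
        unfolding supported_over_def
      proof (intro allI impI)
        fix A u assume nz: "?z (A, u) \<noteq> 0"
        consider "z' (A, u \<circ> ?s) \<noteq> 0" | "z' (A, u) \<noteq> 0" "A `` {u i} = A `` {u (Suc i)}"
          using braid_act_nonzero[OF nz] by blast
        then show "equiv {1..N} A \<and> u permutes {1..N} \<and> ?P' \<subseteq> inv_image A u"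
        proof cases
          case 1
          then have *: "equiv {1..N} A" "u \<circ> ?s permutes {1..N}" "?P \<subseteq> inv_image A (u \<circ> ?s)"
            using z'(2) unfolding supported_over_def by blast+
          have "?P' \<subseteq> inv_image (inv_image A (u \<circ> ?s)) ?s"
            unfolding P' using *(3) by (auto simp: inv_image_def)
          then show ?thesis
            using * permutes_comp_adj_iff[OF ascent.hyps(2), of u] by (simp only: inv_image_comp comp_adj_adj)
        next
          case 2
          then have *: "equiv {1..N} A" "u permutes {1..N}" "?P \<subseteq> inv_image A u"
            using z'(2) unfolding supported_over_def by blast+
          have "(i, Suc i) \<in> inv_image A u"
            using tied_iff_related[OF *(1,2)] 2(2) ascent.hyps(2) by (metis atLeastAtMost_iff atLeastLessThan_iff less_imp_le_nat)
          then have "inv_image (inv_image A u) ?s = inv_image A u"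
            by (rule inv_image_adj_invariant[OF equiv_inv_image[OF *(1,2)]])
          moreover have "?P' \<subseteq> inv_image (inv_image A u) ?s"
            unfolding P' using *(3) by (auto simp: inv_image_def)
          ultimately show ?thesis using * by metis
        qed
      qed
      moreover have "?z (A, u) = z (A, u \<circ> (?s \<circ> \<pi>))"
        if *: "equiv {1..N} A \<and> u permutes {1..N} \<and> inv_image A u = ?P'" for A u
      proof -
        have "A `` {u i} \<noteq> A `` {u (Suc i)}"
          using tied_iff_related[of N A u i "Suc i"] * notP' ascent.hyps(2) by auto
        then have "?z (A, u) = z' (A, u \<circ> ?s)" unfolding braid_act_adj by simp
        also have "\<dots> = z (A, u \<circ> ?s \<circ> \<pi>)"
        proof (rule val)
          have "inv_image A (u \<circ> ?s) = inv_image ?P' ?s"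
            using * by (simp only: inv_image_comp[symmetric])
          also have "\<dots> = ?P" by (simp only: inv_image_comp comp_adj_adj)
          finally show "equiv {1..N} A \<and> u \<circ> ?s permutes {1..N} \<and> inv_image A (u \<circ> ?s) = ?P"
            using * permutes_comp_adj_iff[OF ascent.hyps(2), of u] by blast
        qed
        finally show ?thesis by (simp only: comp_assoc)
      qed
      ultimately show "\<exists>z' \<in> W. supported_over N ?P' z' \<and>
        (\<forall>A u. equiv {1..N} A \<and> u permutes {1..N} \<and> inv_image A u = ?P' \<longrightarrow> z' (A, u) = z (A, u \<circ> (?s \<circ> \<pi>)))"
        by blast
    qed
  qed
qed

text \<open>
  Sort the positions by their class first and by size second; classes are listed by their least
  elements.
\<close>

lemma exists_convex_conjugate:
  fixes P :: "(nat \<times> nat) set"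
  assumes P: "equiv {1..N} P"
  obtains P0 \<tau> where "equiv {1..N} P0" "\<tau> permutes {1..N}" "P = inv_image P0 \<tau>"
    "\<And>b. b \<in> {1..N} // P0 \<Longrightarrow> \<exists>i j. 1 \<le> i \<and> j \<le> N \<and> b = {i..j}"
proof -
  define m where "m x = Min (P `` {x})" for x
  (* Lexicographic order of (m x, x), as x is at most N. *)
  define \<kappa> where "\<kappa> x = m x * Suc N + x" for x
  have fin: "finite (P `` {x})" for x
    by (rule finite_subset[of _ "{1..N}"]) (use P in \<open>auto simp: equiv_def\<close>)
  have m_eq: "(x, y) \<in> P \<longleftrightarrow> m x = m y" if "x \<in> {1..N}" "y \<in> {1..N}" for x y
  proof
    assume "(x, y) \<in> P"
    then show "m x = m y" unfolding m_def using equiv_class_eq[OF P] by metis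
  next
    assume eq: "m x = m y"
    have "m x \<in> P `` {x}" "m y \<in> P `` {y}"
      unfolding m_def using fin equiv_class_self[OF P] that by (metis Min_in empty_iff)+
    then have "(x, m x) \<in> P" "(y, m x) \<in> P" using eq by auto
    then show "(x, y) \<in> P" using P by (meson equivE symD transD)
  qed
  have \<kappa>_mono: "m x \<le> m y" if "\<kappa> x \<le> \<kappa> y" "y \<in> {1..N}" for x y
  proof (rule ccontr)
    assume "\<not> m x \<le> m y"
    then have "Suc (m y) * Suc N \<le> m x * Suc N" by (intro mult_le_mono1) simp
    then have "\<kappa> y < \<kappa> x" using that(2) unfolding \<kappa>_def by simp
    then show False using that(1) by simp
  qed
  have "inj_on \<kappa> {1..N}"
  proof (rule inj_onI)
    fix x y assume xy: "x \<in> {1..N}" "y \<in> {1..N}" "\<kappa> x = \<kappa> y"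
    then have "m x = m y" using \<kappa>_mono[of x y] \<kappa>_mono[of y x] by simp
    then show "x = y" using xy(3) by (simp add: \<kappa>_def)
  qed
  then obtain \<sigma> where \<sigma>: "\<sigma> permutes {1..N}" "strict_mono_on {1..N} (\<kappa> \<circ> \<sigma>)"
    using exists_sorting_permutation[OF finite_atLeastAtMost] by blast
  have \<sigma>_le: "\<kappa> (\<sigma> x) \<le> \<kappa> (\<sigma> y)" if "x \<in> {1..N}" "y \<in> {1..N}" "x \<le> y" for x y
    using strict_mono_onD[OF \<sigma>(2) that(1,2)] that(3) by (cases "x = y") (auto simp: less_imp_le)
  have \<sigma>_in: "\<sigma> x \<in> {1..N} \<longleftrightarrow> x \<in> {1..N}" for x
    by (rule permutes_in_image[OF \<sigma>(1)])
  define P0 where "P0 = inv_image P \<sigma>"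
  have eq: "equiv {1..N} P0" unfolding P0_def by (rule equiv_inv_image[OF P \<sigma>(1)])
  moreover have "inv' \<sigma> permutes {1..N}" by (rule permutes_inv[OF \<sigma>(1)])
  moreover have "P = inv_image P0 (inv' \<sigma>)"
    unfolding P0_def inv_image_comp permutes_inv_o(1)[OF \<sigma>(1)] by (simp add: inv_image_def)
  moreover have "\<exists>i j. 1 \<le> i \<and> j \<le> N \<and> b = {i..j}" if b: "b \<in> {1..N} // P0" for b
  proof -
    have bN: "b \<subseteq> {1..N}" and finb: "finite b" and ne: "b \<noteq> {}"
      using class_subset[OF eq b] finite_class[OF eq b] in_quotient_imp_non_empty[OF eq b] by auto
    define i j where "i = Min b" and "j = Max b"
    have ij: "i \<in> b" "j \<in> b" unfolding i_def j_def using finb ne by auto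
    have "c \<in> b" if c: "i \<le> c" "c \<le> j" for c
    proof -
      have N: "i \<in> {1..N}" "j \<in> {1..N}" "c \<in> {1..N}" using ij bN c by auto
      have "(i, j) \<in> P0" using quotient_eq_iff[OF eq b b ij] by simp
      then have "(\<sigma> i, \<sigma> j) \<in> P" by (simp add: P0_def)
      then have "m (\<sigma> i) = m (\<sigma> j)" using m_eq[of "\<sigma> i" "\<sigma> j"] \<sigma>_in N by blast
      moreover have "m (\<sigma> i) \<le> m (\<sigma> c)" "m (\<sigma> c) \<le> m (\<sigma> j)"
        using \<kappa>_mono[OF \<sigma>_le] \<sigma>_in N c by blast+
      ultimately have "m (\<sigma> i) = m (\<sigma> c)" by simp
      then have "(i, c) \<in> P0" using m_eq[of "\<sigma> i" "\<sigma> c"] \<sigma>_in N unfolding P0_def by simp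
      then show "c \<in> b" using ij(1) b eq by (meson in_quotient_imp_closed)
    qed
    moreover have "c \<in> {i..j}" if "c \<in> b" for c unfolding i_def j_def using finb that by simp
    ultimately have "b = {i..j}" by (intro equalityI subsetI) (simp_all only: atLeastAtMost_iff)
    then show ?thesis using ij bN by (metis atLeastAtMost_iff subsetD)
  qed
  ultimately show ?thesis by (rule that)
qed

lemma rel_weight_inv_image:
  assumes P: "equiv {1..N} P" and \<tau>: "\<tau> permutes {1..N}"
  shows "rel_weight N (inv_image P \<tau>) = rel_weight N P"
proof -
  have sub: "P \<subseteq> {1..N} \<times> {1..N}" using P by (auto simp: equiv_def)
  have im: "\<tau> ` (inv_image P \<tau> `` {x}) = P `` {\<tau> x}" for x
    using permutes_surj[OF \<tau>] by (auto simp: inv_image_def image_iff surj_def)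
  have "{1..N} // P = (\<lambda>x. P `` {x}) ` {1..N}" by (auto simp: quotient_def)
  also have "\<dots> = (\<lambda>x. P `` {x}) ` (\<tau> ` {1..N})" using permutes_image[OF \<tau>] by simp
  also have "\<dots> = (\<lambda>b. \<tau> ` b) ` ((\<lambda>x. inv_image P \<tau> `` {x}) ` {1..N})"
    by (simp only: image_image im)
  also have "(\<lambda>x. inv_image P \<tau> `` {x}) ` {1..N} = {1..N} // inv_image P \<tau>"
    by (auto simp: quotient_def)
  finally have q: "{1..N} // P = (\<lambda>b. \<tau> ` b) ` ({1..N} // inv_image P \<tau>)" .
  have inj: "inj \<tau>" by (rule permutes_inj[OF \<tau>])
  then have "inj_on (\<lambda>b. \<tau> ` b) ({1..N} // inv_image P \<tau>)"
    by (simp add: inj_on_def inj_image_eq_iff)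
  moreover have "card (\<tau> ` b) = card b" for b
    by (rule card_image) (rule inj_on_subset[OF inj], simp)
  ultimately show ?thesis
    unfolding rel_weight_def q by (simp add: prod.reindex)
qed

lemma descent_in_interval:
  assumes "w permutes {1..N}" "\<not> strict_mono_on {i..j} w"
  shows "\<exists>k. k \<in> {i..j} \<and> Suc k \<in> {i..j} \<and> w (Suc k) < w k"
proof (rule ccontr)
  assume none: "\<not> ?thesis"
  have asc: "w k < w (Suc k)" if "i \<le> k" "Suc k \<le> j" for k
  proof -
    have "w k \<noteq> w (Suc k)" using permutes_inj[OF assms(1)] by (metis injD n_not_Suc_n)
    then show ?thesis using none that by (metis atLeastAtMost_iff Suc_leD le_SucI linorder_neqE_nat)
  qed
  have "w a < w (Suc (a + d))" if "i \<le> a" "Suc (a + d) \<le> j" for a d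
    using that
  proof (induction d)
    case 0 then show ?case using asc[of a] by simp
  next
    case (Suc d)
    then have "w a < w (Suc (a + d))" "w (Suc (a + d)) < w (Suc (Suc (a + d)))"
      using asc[of "Suc (a + d)"] by simp_all
    then show ?case by simp
  qed
  then have "strict_mono_on {i..j} w"
    unfolding strict_mono_on_def by (metis atLeastAtMost_iff less_iff_Suc_add)
  with assms(2) show False ..
qed

text \<open>
  The conditions constrain only the pairs \<open>(A, u)\<close> whose pullback is \<open>P\<close> itself; at pairs with a strictly
  larger pullback the values are arbitrary, which the ordering in \<open>exists_independent_family\<close> allows
  for. The permutation \<open>\<pi>\<close> accounts for the transport from an interval partition.
\<close>

definition leading_at ::
  "nat \<Rightarrow> (nat \<times> nat) set \<Rightarrow> (nat \<Rightarrow> nat) \<Rightarrow> (nat \<Rightarrow> nat) \<Rightarrow> 'k::field coloured_words \<Rightarrow> bool" where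
  "leading_at N P \<pi> w z \<longleftrightarrow> supported_over N P z \<and>
      (\<forall>A u. equiv {1..N} A \<longrightarrow> u permutes {1..N} \<longrightarrow> inv_image A u = P \<longrightarrow>
        (z (A, u) \<noteq> 0 \<longrightarrow> u \<circ> \<pi> = w \<or> card (inversions N (u \<circ> \<pi>)) < card (inversions N w)) \<and>
        (u \<circ> \<pi> = w \<longrightarrow> z (A, u) = 1))"

lemma exists_triangular_family:
  assumes W: "braid_stable N q W" "word_vec N id \<in> W" and q: "q \<noteq> 0" "q \<noteq> 1" "q \<noteq> - 1"
    and P: "equiv {1..N} P"
  shows "\<exists>D \<pi>. D \<subseteq> {w. w permutes {1..N}} \<and> rat_of_nat (card D) = fact N * rel_weight N P \<and>
    \<pi> permutes {1..N} \<and> (\<forall>w \<in> D. \<exists>z \<in> W. leading_at N P \<pi> w z)"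
proof -
  obtain P0 \<tau> where P0: "equiv {1..N} P0" and \<tau>: "\<tau> permutes {1..N}" and P_eq: "P = inv_image P0 \<tau>"
    and conv: "\<And>b. b \<in> {1..N} // P0 \<Longrightarrow> \<exists>i j. 1 \<le> i \<and> j \<le> N \<and> b = {i..j}"
    using exists_convex_conjugate[OF P] by metis
  obtain \<pi> where \<pi>: "\<pi> permutes {1..N}" "inv_image P \<pi> = P0"
    and tr: "\<And>z. z \<in> W \<Longrightarrow> supported_over N P0 z \<Longrightarrow> \<exists>z' \<in> W. supported_over N P z' \<and>
        (\<forall>A u. equiv {1..N} A \<and> u permutes {1..N} \<and> inv_image A u = P \<longrightarrow> z' (A, u) = z (A, u \<circ> \<pi>))"
    using exists_transport[OF W(1) P0 \<tau>] unfolding P_eq[symmetric] by blast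
  define D where "D = {w. w permutes {1..N} \<and>
    (\<forall>b \<in> {1..N} // P0. 2 \<le> card b \<longrightarrow> \<not> strict_mono_on b w)}"
  define \<B> where "\<B> = {b \<in> {1..N} // P0. 2 \<le> card b}"
  have "\<exists>z \<in> W. leading_at N P \<pi> w z" if w: "w \<in> D" for w
  proof -
    have perm: "w permutes {1..N}" using w by (simp add: D_def)
    obtain z where z: "z \<in> W"
      and supp: "\<And>A u. z (A, u) \<noteq> 0 \<Longrightarrow> equiv {1..N} A \<and> u permutes {1..N} \<and> (\<forall>b \<in> \<B>. monochrome b A u) \<and>
        (u = w \<or> card (inversions N u) < card (inversions N w))"
      and lead: "\<And>A. equiv {1..N} A \<Longrightarrow> (\<forall>b \<in> \<B>. monochrome b A w) \<Longrightarrow> z (A, w) = 1"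
    proof -
      have "\<exists>z \<in> W. (\<forall>A u. z (A, u) \<noteq> 0 \<longrightarrow> equiv {1..N} A \<and> u permutes {1..N} \<and> (\<forall>b \<in> \<B>. monochrome b A u) \<and>
        (u = w \<or> card (inversions N u) < card (inversions N w))) \<and>
        (\<forall>A. equiv {1..N} A \<longrightarrow> (\<forall>b \<in> \<B>. monochrome b A w) \<longrightarrow> z (A, w) = 1)"
      proof (rule exists_leading_vector[OF W q _ _ _ perm])
        show "finite \<B>" unfolding \<B>_def using finite_classes[OF P0] by simp
        show "disjoint \<B>" unfolding \<B>_def using quotient_disj[OF P0] by (auto simp: pairwise_def disjnt_def)
        show "\<exists>i j. 1 \<le> i \<and> j \<le> N \<and> b = {i..j}" if "b \<in> \<B>" for b
          using conv that unfolding \<B>_def by blast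
        show "\<exists>k. k \<in> b \<and> Suc k \<in> b \<and> w (Suc k) < w k" if b: "b \<in> \<B>" for b
        proof -
          obtain i j where ij: "b = {i..j}" using conv b unfolding \<B>_def by blast
          have "\<not> strict_mono_on b w" using w b unfolding D_def \<B>_def by blast
          then show ?thesis unfolding ij by (rule descent_in_interval[OF perm])
        qed
      qed
      then show ?thesis using that by blast
    qed
    have rel_mono: "P0 \<subseteq> inv_image A u \<longleftrightarrow> (\<forall>b \<in> \<B>. monochrome b A u)"
      if A: "equiv {1..N} A" and u: "u permutes {1..N}" for A u
    proof
      assume le: "P0 \<subseteq> inv_image A u"
      show "\<forall>b \<in> \<B>. monochrome b A u"
      proof
        fix b assume "b \<in> \<B>"
        then have b: "b \<in> {1..N} // P0" by (simp add: \<B>_def)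
        show "monochrome b A u"
          unfolding monochrome_def
        proof (intro ballI)
          fix k l assume kl: "k \<in> b" "l \<in> b"
          then have "(k, l) \<in> P0" using quotient_eq_iff[OF P0 b b] by simp
          then have "(u k, u l) \<in> A" using le by auto
          then show "A `` {u k} = A `` {u l}" by (rule equiv_class_eq[OF A])
        qed
      qed
    next
      assume mono: "\<forall>b \<in> \<B>. monochrome b A u"
      show "P0 \<subseteq> inv_image A u"
      proof (rule subrelI)
        fix x y assume xy: "(x, y) \<in> P0"
        have N: "x \<in> {1..N}" "y \<in> {1..N}" using xy P0 by (auto simp: equiv_def)
        show "(x, y) \<in> inv_image A u"
        proof (cases "x = y")
          case True
          then show ?thesis using tied_iff_related[OF A u N(1), of x] by blast
        next
          case False
          let ?b = "P0 `` {x}"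
          have b: "?b \<in> {1..N} // P0" "x \<in> ?b" "y \<in> ?b"
            using N equiv_class_self[OF P0] xy by (auto intro: quotientI)
          have "card {x, y} \<le> card ?b" using b finite_class[OF P0 b(1)] by (intro card_mono) auto
          then have "?b \<in> \<B>" using b False by (simp add: \<B>_def)
          then have "A `` {u x} = A `` {u y}" using mono b unfolding monochrome_def by blast
          then show ?thesis using tied_iff_related[OF A u N(1)] by simp
        qed
      qed
    qed
    have "supported_over N P0 z"
      unfolding supported_over_def using supp rel_mono by blast
    from tr[OF z this] obtain z' where z': "z' \<in> W" "supported_over N P z'"
      and val: "\<And>A u. equiv {1..N} A \<Longrightarrow> u permutes {1..N} \<Longrightarrow> inv_image A u = P \<Longrightarrow> z' (A, u) = z (A, u \<circ> \<pi>)"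
      by blast
    have "(z' (A, u) \<noteq> 0 \<longrightarrow> u \<circ> \<pi> = w \<or> card (inversions N (u \<circ> \<pi>)) < card (inversions N w)) \<and>
        (u \<circ> \<pi> = w \<longrightarrow> z' (A, u) = 1)"
      if *: "equiv {1..N} A" "u permutes {1..N}" "inv_image A u = P" for A u
    proof (intro conjI impI)
      assume "z' (A, u) \<noteq> 0"
      then show "u \<circ> \<pi> = w \<or> card (inversions N (u \<circ> \<pi>)) < card (inversions N w)"
        using supp[of A "u \<circ> \<pi>"] unfolding val[OF *] by blast
    next
      assume uw: "u \<circ> \<pi> = w"
      have "inv_image A w = P0"
        unfolding uw[symmetric] inv_image_comp[symmetric] *(3) by (rule \<pi>(2))
      then have "\<forall>b \<in> \<B>. monochrome b A w" using rel_mono[OF *(1) perm] by blast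
      then show "z' (A, u) = 1" unfolding val[OF *] uw by (rule lead[OF *(1)])
    qed
    then show ?thesis using z' unfolding leading_at_def by blast
  qed
  moreover have "rat_of_nat (card D) = fact N * rel_weight N P"
    unfolding D_def card_nowhere_increasing_classes[OF P0] P_eq rel_weight_inv_image[OF P0 \<tau>] ..
  moreover have "D \<subseteq> {w. w permutes {1..N}}" by (auto simp: D_def)
  ultimately show ?thesis
    by (intro exI[of _ D] exI[of _ \<pi>] conjI ballI \<pi>(1))
qed

lemma triangular_independent:
  fixes z :: "'x \<Rightarrow> 'i \<Rightarrow> 'k::field" and m :: "'x \<Rightarrow> nat"
  assumes fin: "finite S" and diag: "\<And>x. x \<in> S \<Longrightarrow> z x (y x) = 1"
    and off: "\<And>x x'. x \<in> S \<Longrightarrow> x' \<in> S \<Longrightarrow> x' \<noteq> x \<Longrightarrow> z x' (y x) \<noteq> 0 \<Longrightarrow> m x' < m x"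
  shows "inj_on z S" and "fvs.independent (z ` S)"
proof -
  show inj: "inj_on z S"
  proof (rule inj_onI, rule ccontr)
    fix x x' assume x: "x \<in> S" "x' \<in> S" "z x = z x'" "x \<noteq> x'"
    then have "z x' (y x) = 1" "z x (y x') = 1" using diag[of x] diag[of x'] by metis+
    then have "m x' < m x" "m x < m x'" using off[of x x'] off[of x' x] x by simp_all
    then show False by simp
  qed
  have "\<not> (\<exists>c. (\<exists>v \<in> z ` S. c v \<noteq> 0) \<and> (\<Sum>v \<in> z ` S. fscale (c v) v) = 0)"
  proof (intro notI, elim exE conjE)
    fix c assume nz: "\<exists>v \<in> z ` S. c v \<noteq> 0" and zero: "(\<Sum>v \<in> z ` S. fscale (c v) v) = 0"
    have "\<exists>x. x \<in> S \<and> c (z x) \<noteq> 0" using nz by blast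
    then obtain x where x: "x \<in> S" "c (z x) \<noteq> 0"
      and least: "\<And>x'. x' \<in> S \<and> c (z x') \<noteq> 0 \<Longrightarrow> m x \<le> m x'"
    proof -
      obtain x0 where "x0 \<in> S \<and> c (z x0) \<noteq> 0" using \<open>\<exists>x. x \<in> S \<and> c (z x) \<noteq> 0\<close> ..
      from arg_min_nat_lemma[of "\<lambda>x. x \<in> S \<and> c (z x) \<noteq> 0", OF this, of m]
      show ?thesis by (intro that[of "arg_min m (\<lambda>x. x \<in> S \<and> c (z x) \<noteq> 0)"]) simp_all
    qed
    have "0 = (\<Sum>v \<in> z ` S. fscale (c v) v) (y x)" unfolding zero by simp
    also have "\<dots> = (\<Sum>x' \<in> S. c (z x') * z x' (y x))"
      unfolding sum.reindex[OF inj] by (simp add: fscale_def) (induction S rule: infinite_finite_induct; simp)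
    also have "\<dots> = (\<Sum>x' \<in> {x}. c (z x') * z x' (y x))"
    proof (rule sum.mono_neutral_right[OF fin])
      show "\<forall>x' \<in> S - {x}. c (z x') * z x' (y x) = 0"
      proof
        fix x' assume x': "x' \<in> S - {x}"
        show "c (z x') * z x' (y x) = 0"
        proof (rule ccontr)
          assume "c (z x') * z x' (y x) \<noteq> 0"
          then have "c (z x') \<noteq> 0" "z x' (y x) \<noteq> 0" by auto
          then show False using off[OF x(1), of x'] least[of x'] x' by auto
        qed
      qed
    qed (use x in simp)
    also have "\<dots> = c (z x)" using diag[OF x(1)] by simp
    finally show False using x(2) by simp
  qed
  then show "fvs.independent (z ` S)"
    unfolding fvs.dependent_finite[OF finite_imageI[OF fin]] by blast
qed

lemma finite_eqrels: "finite {A. equiv {1..N::nat} A}"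
  by (rule finite_subset[of _ "Pow ({1..N} \<times> {1..N})"]) (auto simp: equiv_def)

lemma card_dimension_family:
  assumes "\<And>P. equiv {1..N} P \<Longrightarrow> finite (D P) \<and> rat_of_nat (card (D P)) = fact N * rel_weight N P"
  shows "rat_of_nat (card (SIGMA P : {A. equiv {1..N} A}. D P)) = dimension_formula N"
proof -
  have "card (SIGMA P : {A. equiv {1..N} A}. D P) = (\<Sum>P | equiv {1..N} P. card (D P))"
    using assms finite_eqrels by (intro card_SigmaI) auto
  then show ?thesis
    unfolding dimension_formula_def using assms by simp
qed

text \<open>
  Order the vectors for pairs \<open>(P, w)\<close> by the size of \<open>P\<close> first and by decreasing number of inversions of
  \<open>w\<close> second, and evaluate the vector of \<open>(P, w)\<close> at a colouring and a word with pullback \<open>P\<close> that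
  correspond to \<open>w\<close>: the resulting matrix is unitriangular.
\<close>

lemma exists_independent_family:
  assumes W: "braid_stable N q W" "word_vec N id \<in> W" and q: "q \<noteq> 0" "q \<noteq> 1" "q \<noteq> - 1"
  shows "\<exists>B \<subseteq> W. finite B \<and> fvs.independent B \<and> rat_of_nat (card B) = dimension_formula N"
proof -
  let ?E = "{A. equiv {1..N} A}"
  define Q where "Q P F \<longleftrightarrow> fst F \<subseteq> {w. w permutes {1..N}} \<and>
    rat_of_nat (card (fst F)) = fact N * rel_weight N P \<and> snd F permutes {1..N} \<and>
    (\<forall>w \<in> fst F. \<exists>z \<in> W. leading_at N P (snd F) w z)" for P F
  have "\<forall>P \<in> ?E. \<exists>F. Q P F"
  proof
    fix P assume "P \<in> ?E"
    then have "equiv {1..N} P" by simp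
    from exists_triangular_family[OF W q this] obtain D \<pi> where "Q P (D, \<pi>)"
      unfolding Q_def fst_conv snd_conv by (elim exE)
    then show "\<exists>F. Q P F" ..
  qed
  then obtain F where F: "\<forall>P \<in> ?E. Q P (F P)" by (rule bchoice[THEN exE])
  define D \<pi> where "D P = fst (F P)" and "\<pi> P = snd (F P)" for P
  have F: "Q P (D P, \<pi> P)" if "equiv {1..N} P" for P
    using bspec[OF F, of P] that by (simp add: D_def \<pi>_def)
  have D: "\<And>P. equiv {1..N} P \<Longrightarrow> D P \<subseteq> {w. w permutes {1..N}}"
    and cardD: "\<And>P. equiv {1..N} P \<Longrightarrow> rat_of_nat (card (D P)) = fact N * rel_weight N P"
    and \<pi>: "\<And>P. equiv {1..N} P \<Longrightarrow> \<pi> P permutes {1..N}"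
    and exz: "\<And>P. equiv {1..N} P \<Longrightarrow> \<forall>w \<in> D P. \<exists>z \<in> W. leading_at N P (\<pi> P) w z"
    using F unfolding Q_def fst_conv snd_conv by blast+
  define S where "S = (SIGMA P : ?E. D P)"
  have "\<forall>x \<in> S. \<exists>z. z \<in> W \<and> leading_at N (fst x) (\<pi> (fst x)) (snd x) z"
  proof
    fix x assume "x \<in> S"
    then have "equiv {1..N} (fst x)" "snd x \<in> D (fst x)" unfolding S_def by auto
    then show "\<exists>z. z \<in> W \<and> leading_at N (fst x) (\<pi> (fst x)) (snd x) z"
      using exz by blast
  qed
  then obtain Z where Z: "\<forall>x \<in> S. Z x \<in> W \<and> leading_at N (fst x) (\<pi> (fst x)) (snd x) (Z x)"
    by (rule bchoice[THEN exE])
  define z where "z P w = Z (P, w)" for P w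
  have zW: "z P w \<in> W" and z: "leading_at N P (\<pi> P) w (z P w)" if "equiv {1..N} P" "w \<in> D P" for P w
    using bspec[OF Z, of "(P, w)"] that unfolding S_def z_def by simp_all
  have supp: "\<And>P w. equiv {1..N} P \<Longrightarrow> w \<in> D P \<Longrightarrow> supported_over N P (z P w)"
    and tri: "\<And>P w A u. equiv {1..N} P \<Longrightarrow> w \<in> D P \<Longrightarrow> equiv {1..N} A \<Longrightarrow> u permutes {1..N} \<Longrightarrow>
        inv_image A u = P \<Longrightarrow> z P w (A, u) \<noteq> 0 \<Longrightarrow>
        u \<circ> \<pi> P = w \<or> card (inversions N (u \<circ> \<pi> P)) < card (inversions N w)"
    and one: "\<And>P w A u. equiv {1..N} P \<Longrightarrow> w \<in> D P \<Longrightarrow> equiv {1..N} A \<Longrightarrow> u permutes {1..N} \<Longrightarrow>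
        inv_image A u = P \<Longrightarrow> u \<circ> \<pi> P = w \<Longrightarrow> z P w (A, u) = 1"
    using z unfolding leading_at_def by blast+
  (* The point (A, u) with pullback P at which the leading word w is read off. *)
  define u :: "(nat \<times> nat) set \<Rightarrow> (nat \<Rightarrow> nat) \<Rightarrow> nat \<Rightarrow> nat" where "u = (\<lambda>P w. w \<circ> inv' (\<pi> P))"
  define A :: "(nat \<times> nat) set \<Rightarrow> (nat \<Rightarrow> nat) \<Rightarrow> (nat \<times> nat) set" where "A = (\<lambda>P w. inv_image P (\<pi> P \<circ> inv' w))"
  define M where "M = card ({1..N} \<times> {1..N})"
  (* M bounds the number of inversions, so the size of P has priority. *)
  define m where "m = (\<lambda>(P::(nat \<times> nat) set, w). card P * Suc M + (M - card (inversions N w)))"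
  have invM: "card (inversions N w) \<le> M" for w
    unfolding M_def by (rule card_mono) (auto simp: inversions_def)
  have finD: "finite (D P)" if "equiv {1..N} P" for P
    using D[OF that] finite_permutations[of "{1..N}"] by (auto intro: finite_subset)
  have finS: "finite S"
    unfolding S_def using finite_eqrels finD by (intro finite_SigmaI) auto
  have point: "equiv {1..N} (A P w)" "u P w permutes {1..N}" "inv_image (A P w) (u P w) = P" "u P w \<circ> \<pi> P = w"
    if P: "equiv {1..N} P" and w: "w \<in> D P" for P w
  proof -
    have wp: "w permutes {1..N}" using D[OF P] w by blast
    show "equiv {1..N} (A P w)"
      unfolding A_def by (intro equiv_inv_image P permutes_compose permutes_inv wp \<pi>)
    show "u P w permutes {1..N}"
      unfolding u_def by (rule permutes_compose[OF permutes_inv[OF \<pi>[OF P]] wp])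
    have "(\<pi> P \<circ> inv' w) \<circ> (w \<circ> inv' (\<pi> P)) = \<pi> P \<circ> (inv' w \<circ> w) \<circ> inv' (\<pi> P)"
      by (simp only: comp_assoc)
    also have "\<dots> = id"
      by (simp only: permutes_inv_o(2)[OF wp] comp_id permutes_inv_o(1)[OF \<pi>[OF P]])
    finally show "inv_image (A P w) (u P w) = P"
      unfolding A_def u_def inv_image_comp by (simp add: inv_image_def)
    show "u P w \<circ> \<pi> P = w"
      unfolding u_def by (simp only: comp_assoc permutes_inv_o(2)[OF \<pi>[OF P]] comp_id)
  qed
  have "inj_on (case_prod z) S" "fvs.independent (case_prod z ` S)"
  proof (rule_tac [!] triangular_independent[OF finS, where y = "\<lambda>(P, w). (A P w, u P w)" and m = m])
    fix x assume "x \<in> S"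
    then obtain P w where x: "x = (P, w)" "equiv {1..N} P" "w \<in> D P" unfolding S_def by (elim SigmaE) simp
    show "case_prod z x (case x of (P, w) \<Rightarrow> (A P w, u P w)) = 1"
      unfolding x(1) prod.case using point[OF x(2,3)] by (intro one x)
    then show "case_prod z x (case x of (P, w) \<Rightarrow> (A P w, u P w)) = 1" .
  next
    fix x x' assume "x \<in> S" "x' \<in> S" and ne: "x' \<noteq> x"
      and nz: "case_prod z x' (case x of (P, w) \<Rightarrow> (A P w, u P w)) \<noteq> 0"
    then obtain P w P' w' where x: "x = (P, w)" "equiv {1..N} P" "w \<in> D P"
      and x': "x' = (P', w')" "equiv {1..N} P'" "w' \<in> D P'" unfolding S_def by (elim SigmaE) simp
    note pt = point[OF x(2,3)]
    have nz: "z P' w' (A P w, u P w) \<noteq> 0" using nz unfolding x(1) x'(1) by simp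
    then have sub: "P' \<subseteq> P" using supp[OF x'(2,3)] pt(3) unfolding supported_over_def by blast
    show "m x' < m x"
    proof (cases "P' = P")
      case True
      have "w = w' \<or> card (inversions N w) < card (inversions N w')"
        using tri[OF x'(2,3) pt(1,2)] pt(3,4) nz True by metis
      then have "card (inversions N w) < card (inversions N w')" using ne x(1) x'(1) True by auto
      then show ?thesis unfolding m_def x(1) x'(1) True using invM[of w'] by simp
    next
      case False
      have "finite P" by (rule finite_subset[of _ "{1..N} \<times> {1..N}"]) (use x(2) in \<open>auto simp: equiv_def\<close>)
      moreover have "P' \<subset> P" using sub False by blast
      ultimately have "Suc (card P') \<le> card P" using psubset_card_mono[of P P'] by linarith
      then have "Suc (card P') * Suc M \<le> card P * Suc M" by (rule mult_le_mono1)
      then show ?thesis unfolding m_def x(1) x'(1) by simp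
    qed
    then show "m x' < m x" .
  qed
  moreover have "case_prod z ` S \<subseteq> W" using zW by (auto simp: S_def)
  moreover have "rat_of_nat (card S) = dimension_formula N"
    unfolding S_def using finD cardD by (intro card_dimension_family) blast
  ultimately show ?thesis
    using finS by (intro exI[of _ "case_prod z ` S"]) (simp add: card_image)
qed

section \<open>Antisymmetrisation over a colour class\<close>

lemma two_elements:
  assumes "2 \<le> card b"
  obtains x y where "x \<in> b" "y \<in> b" "x \<noteq> y"
proof -
  have "finite b" using assms by (rule_tac ccontr) simp
  then have "\<not> (\<forall>x \<in> b. \<forall>y \<in> b. x = y)"
    using card_le_Suc0_iff_eq[of b] assms by simp
  then show ?thesis using that by blast
qed

definition alternate :: "nat set \<Rightarrow> 'k::field coloured_words \<Rightarrow> 'k coloured_words" where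
  "alternate b f = (\<lambda>(A, w). \<Sum>\<sigma> | \<sigma> permutes b. of_int (sign \<sigma>) * f (A, \<sigma> \<circ> w))"

lemma alternate_apply:
  "alternate b f (A, w) = (\<Sum>\<sigma> | \<sigma> permutes b. of_int (sign \<sigma>) * f (A, \<sigma> \<circ> w))"
  by (simp add: alternate_def)

text \<open>
  The class \<open>b\<close> is broken into singletons; the other classes stay.
\<close>

definition shatter :: "(nat \<times> nat) set \<Rightarrow> nat set \<Rightarrow> (nat \<times> nat) set" where
  "shatter A b = (A - b \<times> b) \<union> Id_on b"

text \<open>
  The rule for the action of \<open>g\<^sub>i\<close> with the two case distinctions as parameters. In this form it is
  visibly linear in the function \<open>h\<close> of the word, so it commutes with sums in which the distinctions
  come out alike.
\<close>

definition act_formula :: "'k::field \<Rightarrow> nat \<Rightarrow> bool \<Rightarrow> bool \<Rightarrow> ((nat \<Rightarrow> nat) \<Rightarrow> 'k) \<Rightarrow> (nat \<Rightarrow> nat) \<Rightarrow> 'k" where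
  "act_formula q i tied asc h w =
     (if \<not> tied then h (w \<circ> adj i) else if asc then q * h (w \<circ> adj i) else h (w \<circ> adj i) + (q - 1) * h w)"

lemma braid_act_formula:
  "braid_act q (adj i) f (A, w) =
     act_formula q i (A `` {w i} = A `` {w (Suc i)}) (w i \<le> w (Suc i)) (\<lambda>w. f (A, w)) w"
  unfolding braid_act_adj act_formula_def by simp

lemma class_in_shatter:
  assumes A: "equiv {1..N} A" and b: "b \<in> {1..N} // A" and x: "x \<in> {1..N}"
  shows "shatter A b `` {x} = (if x \<in> b then {x} else A `` {x})"
proof (cases "x \<in> b")
  case True
  have "y \<in> b" if "(x, y) \<in> A" for y using in_quotient_imp_closed[OF A b True that] .
  then show ?thesis using True by (auto simp: shatter_def)
next
  case False
  then show ?thesis by (auto simp: shatter_def)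
qed

lemma equiv_shatter:
  assumes A: "equiv {1..N} A" and b: "b \<in> {1..N} // A"
  shows "equiv {1..N} (shatter A b)"
proof (rule equivI)
  have cl: "x \<in> b \<longleftrightarrow> y \<in> b" if "(x, y) \<in> A" for x y
    using that in_quotient_imp_closed[OF A b] A by (meson equivE symD)
  have bN: "b \<subseteq> {1..N}" by (rule class_subset[OF A b])
  have A': "A \<subseteq> {1..N} \<times> {1..N}" "refl_on {1..N} A" "sym A" "trans A"
    using A by (auto simp: equiv_def)
  show "shatter A b \<subseteq> {1..N} \<times> {1..N}" using A'(1) bN unfolding shatter_def by blast
  show "refl_on {1..N} (shatter A b)"
    using A'(2) unfolding shatter_def refl_on_def by blast
  show "sym (shatter A b)" using A'(3) unfolding shatter_def sym_def by blast
  show "trans (shatter A b)"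
  proof (rule transI)
    fix x y z assume xy: "(x, y) \<in> shatter A b" and yz: "(y, z) \<in> shatter A b"
    show "(x, z) \<in> shatter A b"
    proof (cases "y \<in> b")
      case True
      have "x = y" using xy True cl[of x y] unfolding shatter_def by blast
      then show ?thesis using yz by simp
    next
      case False
      then have "(x, y) \<in> A" "(y, z) \<in> A" using xy yz unfolding shatter_def by blast+
      moreover have "x \<notin> b" using cl[of x y] False \<open>(x, y) \<in> A\<close> by blast
      ultimately show ?thesis using A'(4) unfolding shatter_def by (blast dest: transD)
    qed
  qed
qed

lemma sum_act_formula:
  "(\<Sum>\<sigma> \<in> T. c \<sigma> * act_formula q i tied asc (h \<sigma>) w) =
    act_formula q i tied asc (\<lambda>w. \<Sum>\<sigma> \<in> T. c \<sigma> * h \<sigma> w) w"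
  unfolding act_formula_def
  by (cases tied; cases asc; induction T rule: infinite_finite_induct; simp add: algebra_simps)

lemma alternate_commutes:
  assumes "\<And>\<sigma>. \<sigma> permutes b \<Longrightarrow> B `` {\<sigma> (w i)} = B `` {\<sigma> (w (Suc i))} \<longleftrightarrow> tied"
    and "\<And>\<sigma>. \<sigma> permutes b \<Longrightarrow> tied \<Longrightarrow> \<sigma> (w i) \<le> \<sigma> (w (Suc i)) \<longleftrightarrow> w i \<le> w (Suc i)"
  shows "alternate b (braid_act q (adj i) f) (B, w) =
    act_formula q i tied (w i \<le> w (Suc i)) (\<lambda>w. alternate b f (B, w)) w"
proof -
  have "braid_act q (adj i) f (B, \<sigma> \<circ> w) =
      act_formula q i tied (w i \<le> w (Suc i)) (\<lambda>w. f (B, \<sigma> \<circ> w)) w" if \<sigma>: "\<sigma> permutes b" for \<sigma>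
  proof -
    have 1: "(\<sigma> \<circ> w) i = \<sigma> (w i)" "(\<sigma> \<circ> w) (Suc i) = \<sigma> (w (Suc i))" by simp_all
    have 2: "\<sigma> \<circ> w \<circ> adj i = \<sigma> \<circ> (w \<circ> adj i)" by (rule comp_assoc)
    show ?thesis
      unfolding braid_act_formula 1 assms(1)[OF \<sigma>]
      using assms(2)[OF \<sigma>] unfolding act_formula_def 2 by simp
  qed
  then have "alternate b (braid_act q (adj i) f) (B, w) = (\<Sum>\<sigma> | \<sigma> permutes b. of_int (sign \<sigma>) *
      act_formula q i tied (w i \<le> w (Suc i)) (\<lambda>w. f (B, \<sigma> \<circ> w)) w)"
    unfolding alternate_apply by (intro sum.cong) simp_all
  then show ?thesis unfolding sum_act_formula alternate_apply .
qed

text \<open>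
  If both letters lie in \<open>b\<close>, write the Hecke rule as the plain exchange plus a correction \<open>D \<sigma>\<close> in each
  summand. Composing \<open>\<sigma>\<close> with the transposition of the two letters leaves the correction unchanged and
  flips the sign, so the corrections cancel. This identity is the reason for the upper bound.
\<close>

lemma alternate_braid_act_inside:
  assumes b: "finite b" "w i \<in> b" "w (Suc i) \<in> b" and w: "inj w"
    and tied: "\<And>x y. x \<in> b \<Longrightarrow> y \<in> b \<Longrightarrow> A `` {x} = A `` {y}"
  shows "alternate b (braid_act q (adj i) f) (A, w) = alternate b f (A, w \<circ> adj i)"
proof -
  let ?x = "w i" and ?y = "w (Suc i)"
  let ?\<tau> = "transpose ?x ?y"
  define S where "S = {\<sigma>. \<sigma> permutes b}"
  have S: "\<sigma> \<in> S \<longleftrightarrow> \<sigma> permutes b" for \<sigma> by (simp add: S_def)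
  have finS: "finite S" unfolding S_def by (rule finite_permutations[OF b(1)])
  have xy: "?x \<noteq> ?y" using w by (metis injD n_not_Suc_n)
  have \<tau>: "?\<tau> permutes b" by (rule permutes_swap_id[OF b(2,3)])
  have w\<tau>: "w \<circ> adj i = ?\<tau> \<circ> w"
    using w by (auto simp: fun_eq_iff transpose_def inj_eq)
  have \<tau>\<tau>: "\<sigma> \<circ> ?\<tau> \<circ> ?\<tau> = \<sigma>" for \<sigma> :: "nat \<Rightarrow> nat" by (simp add: comp_assoc)
  define D where "D \<sigma> = (q - 1) * f (A, if \<sigma> ?x \<le> \<sigma> ?y then \<sigma> \<circ> ?\<tau> \<circ> w else \<sigma> \<circ> w)" for \<sigma>
  have act: "braid_act q (adj i) f (A, \<sigma> \<circ> w) = f (A, \<sigma> \<circ> (w \<circ> adj i)) + D \<sigma>" if "\<sigma> permutes b" for \<sigma>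
  proof -
    have "A `` {(\<sigma> \<circ> w) i} = A `` {(\<sigma> \<circ> w) (Suc i)}"
      using tied[of "\<sigma> ?x" "\<sigma> ?y"] b(2,3) permutes_in_image[OF that] by simp
    moreover have "\<sigma> \<circ> w \<circ> adj i = \<sigma> \<circ> ?\<tau> \<circ> w" by (simp only: comp_assoc w\<tau>)
    ultimately show ?thesis
      unfolding braid_act_adj D_def using comp_assoc[of \<sigma> w "adj i"] by (simp add: algebra_simps)
  qed
  have D\<tau>: "D (\<sigma> \<circ> ?\<tau>) = D \<sigma>" if "\<sigma> permutes b" for \<sigma>
  proof -
    have "\<sigma> ?x \<noteq> \<sigma> ?y" using xy permutes_inj[OF that] by (metis injD)
    then show ?thesis unfolding D_def \<tau>\<tau> by auto
  qed
  have sgn: "sign (\<sigma> \<circ> ?\<tau>) = - sign \<sigma>" if "\<sigma> permutes b" for \<sigma>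
    using sign_compose[OF permutation_permutes[THEN iffD2] permutation_permutes[THEN iffD2]] that \<tau> b(1) xy
    by (metis (no_types, lifting) mult_minus1_right sign_swap_id)
  let ?asc = "{\<sigma> \<in> S. \<sigma> ?x < \<sigma> ?y}" and ?desc = "{\<sigma> \<in> S. \<sigma> ?y < \<sigma> ?x}"
  have split: "S = ?asc \<union> ?desc"
  proof (intro equalityI subsetI)
    fix \<sigma> assume \<sigma>: "\<sigma> \<in> S"
    then have "\<sigma> ?x \<noteq> \<sigma> ?y" using xy permutes_inj[of \<sigma> b] unfolding S by (metis injD)
    then show "\<sigma> \<in> ?asc \<union> ?desc" using \<sigma> by auto
  qed auto
  have "(\<Sum>\<sigma> \<in> ?desc. of_int (sign \<sigma>) * D \<sigma>) = (\<Sum>\<sigma> \<in> ?asc. of_int (sign (\<sigma> \<circ> ?\<tau>)) * D (\<sigma> \<circ> ?\<tau>))"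
  proof (rule sum.reindex_bij_witness[where i = "\<lambda>\<sigma>. \<sigma> \<circ> ?\<tau>" and j = "\<lambda>\<sigma>. \<sigma> \<circ> ?\<tau>"])
    show "\<sigma> \<circ> ?\<tau> \<in> ?asc" if "\<sigma> \<in> ?desc" for \<sigma>
      using that permutes_compose[OF \<tau>, of \<sigma>] by (simp add: S)
    show "\<sigma> \<circ> ?\<tau> \<in> ?desc" if "\<sigma> \<in> ?asc" for \<sigma>
      using that permutes_compose[OF \<tau>, of \<sigma>] by (simp add: S)
  qed (simp_all only: \<tau>\<tau>)
  also have "\<dots> = (\<Sum>\<sigma> \<in> ?asc. - (of_int (sign \<sigma>) * D \<sigma>))"
  proof (rule sum.cong[OF refl])
    fix \<sigma> assume "\<sigma> \<in> ?asc"
    then have "\<sigma> permutes b" by (simp add: S)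
    then show "of_int (sign (\<sigma> \<circ> ?\<tau>)) * D (\<sigma> \<circ> ?\<tau>) = - (of_int (sign \<sigma>) * D \<sigma>)"
      unfolding sgn[OF \<open>\<sigma> permutes b\<close>] D\<tau>[OF \<open>\<sigma> permutes b\<close>] by simp
  qed
  also have "\<dots> = - (\<Sum>\<sigma> \<in> ?asc. of_int (sign \<sigma>) * D \<sigma>)" by (rule sum_negf)
  finally have desc: "(\<Sum>\<sigma> \<in> ?desc. of_int (sign \<sigma>) * D \<sigma>) = - (\<Sum>\<sigma> \<in> ?asc. of_int (sign \<sigma>) * D \<sigma>)" .
  have "(\<Sum>\<sigma> \<in> ?asc \<union> ?desc. of_int (sign \<sigma>) * D \<sigma>) =
      (\<Sum>\<sigma> \<in> ?asc. of_int (sign \<sigma>) * D \<sigma>) + (\<Sum>\<sigma> \<in> ?desc. of_int (sign \<sigma>) * D \<sigma>)"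
  proof (rule sum.union_disjoint)
    show "finite ?asc" "finite ?desc" by (rule finite_subset[OF _ finS], blast)+
    show "?asc \<inter> ?desc = {}" by (blast dest: less_asym)
  qed
  then have "(\<Sum>\<sigma> \<in> ?asc \<union> ?desc. of_int (sign \<sigma>) * D \<sigma>) = 0"
    unfolding desc by (rule trans[OF _ add.right_inverse])
  then have "(\<Sum>\<sigma> \<in> S. of_int (sign \<sigma>) * D \<sigma>) = 0"
    by (rule trans[OF arg_cong[OF split, of "sum (\<lambda>\<sigma>. of_int (sign \<sigma>) * D \<sigma>)"]])
  moreover have "alternate b (braid_act q (adj i) f) (A, w) =
      (\<Sum>\<sigma> \<in> S. of_int (sign \<sigma>) * f (A, \<sigma> \<circ> (w \<circ> adj i)) + of_int (sign \<sigma>) * D \<sigma>)"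
    unfolding alternate_apply S_def[symmetric] by (rule sum.cong[OF refl]) (simp add: act S distrib_left)
  ultimately show ?thesis
    unfolding alternate_apply S_def[symmetric] by (simp add: sum.distrib)
qed

text \<open>
  The equations that confine the orbit space: after antisymmetrisation over the letters of a class \<open>b\<close> it
  does not matter whether these letters share a colour.
\<close>

definition alternating_compatible :: "nat \<Rightarrow> 'k::field coloured_words set" where
  "alternating_compatible N = {f.
     (\<forall>A w. f (A, w) \<noteq> 0 \<longrightarrow> equiv {1..N} A \<and> w permutes {1..N}) \<and>
     (\<forall>A b w. equiv {1..N} A \<longrightarrow> b \<in> {1..N} // A \<longrightarrow> w permutes {1..N} \<longrightarrow>
        alternate b f (A, w) = alternate b f (shatter A b, w))}"

text \<open>
  After antisymmetrisation over \<open>b\<close>, the operator \<open>g\<^sub>i\<close> follows the rule for the shattered colouring, also at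
  the original one. Only the case of two letters in \<open>b\<close> differs between the two colourings, and it is
  covered by \<open>alternate_braid_act_inside\<close>.
\<close>

lemma alternate_braid_act_compatible:
  assumes A: "equiv {1..N} A" and b: "b \<in> {1..N} // A" and w: "w permutes {1..N}" and i: "i \<in> {1..<N}"
    and B: "B = A \<or> B = shatter A b"
  shows "alternate b (braid_act q (adj i) f) (B, w) =
    act_formula q i (shatter A b `` {w i} = shatter A b `` {w (Suc i)}) (w i \<le> w (Suc i))
      (\<lambda>w. alternate b f (B, w)) w"
proof -
  let ?x = "w i" and ?y = "w (Suc i)"
  have N: "?x \<in> {1..N}" "?y \<in> {1..N}" using i permutes_in_image[OF w] by auto
  have bN: "b \<subseteq> {1..N}" by (rule class_subset[OF A b])
  have finb: "finite b" by (rule finite_class[OF A b])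
  have xy: "?x \<noteq> ?y" using permutes_inj[OF w] by (metis injD n_not_Suc_n)
  have in_b: "\<sigma> x \<in> b \<longleftrightarrow> x \<in> b" if "\<sigma> permutes b" for \<sigma> x by (rule permutes_in_image[OF that])
  have in_N: "\<sigma> x \<in> {1..N}" if "\<sigma> permutes b" "x \<in> {1..N}" for \<sigma> x
    using permutes_in_image[OF permutes_subset[OF that(1) bN]] that(2) by blast
  have out_b: "\<sigma> x = x" if "\<sigma> permutes b" "x \<notin> b" for \<sigma> x by (rule permutes_not_in[OF that])
  have self: "x \<in> A `` {x}" if "x \<in> {1..N}" for x by (rule equiv_class_self[OF A that])
  have sing: "{z} \<noteq> A `` {y}" "A `` {y} \<noteq> {z}" if "y \<in> {1..N}" "z \<noteq> y" for y z
    using self[OF that(1)] that(2) by (metis singletonD)+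
  have cls: "A `` {x} = b" if "x \<in> b" for x
    using b that bN by (metis A Image_singleton_iff equiv_class_eq quotientE)
  have tied_shatter: "shatter A b `` {\<sigma> ?x} = shatter A b `` {\<sigma> ?y} \<longleftrightarrow>
      shatter A b `` {?x} = shatter A b `` {?y}" if \<sigma>: "\<sigma> permutes b" for \<sigma>
  proof -
    have inj: "\<sigma> ?x \<noteq> \<sigma> ?y" using xy permutes_inj[OF \<sigma>] by (metis injD)
    have f: "?y \<notin> b \<Longrightarrow> {\<sigma> ?x} \<noteq> A `` {?y}" "{?x} \<noteq> A `` {?y}"
      "?x \<notin> b \<Longrightarrow> A `` {?x} \<noteq> {\<sigma> ?y}" "A `` {?x} \<noteq> {?y}"
      using inj xy sing[OF N(1)] sing[OF N(2)] out_b[OF \<sigma>, of ?x] out_b[OF \<sigma>, of ?y] by metis+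
    show ?thesis
      unfolding class_in_shatter[OF A b in_N[OF \<sigma> N(1)]] class_in_shatter[OF A b in_N[OF \<sigma> N(2)]]
        class_in_shatter[OF A b N(1)] class_in_shatter[OF A b N(2)] in_b[OF \<sigma>]
      using inj xy f out_b[OF \<sigma>, of ?x] out_b[OF \<sigma>, of ?y]
      by (cases "?x \<in> b"; cases "?y \<in> b") simp_all
  qed
  have not_tied_b: "?x \<notin> b \<and> ?y \<notin> b" if "shatter A b `` {?x} = shatter A b `` {?y}"
    using that xy sing[OF N(1), of ?y] sing[OF N(2), of ?x]
    unfolding class_in_shatter[OF A b N(1)] class_in_shatter[OF A b N(2)]
    by (cases "?x \<in> b"; cases "?y \<in> b") simp_all
  have order: "\<sigma> ?x \<le> \<sigma> ?y \<longleftrightarrow> ?x \<le> ?y"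
    if "\<sigma> permutes b" "shatter A b `` {?x} = shatter A b `` {?y}" for \<sigma>
    using out_b[OF that(1)] not_tied_b[OF that(2)] by simp
  show ?thesis
  proof (cases "B = shatter A b")
    case True
    show ?thesis
      unfolding True by (rule alternate_commutes[OF tied_shatter order])
  next
    case False
    then have BA: "B = A" using B by simp
    show ?thesis
    proof (cases "?x \<in> b \<and> ?y \<in> b")
      case True
      then have "alternate b (braid_act q (adj i) f) (A, w) = alternate b f (A, w \<circ> adj i)"
        using cls by (intro alternate_braid_act_inside finb permutes_inj[OF w]) auto
      moreover have "shatter A b `` {?x} \<noteq> shatter A b `` {?y}" using not_tied_b True by blast
      ultimately show ?thesis unfolding BA act_formula_def by simp
    next
      case False
      have diff_cls: "A `` {?x} \<noteq> A `` {?y}" if "?x \<in> b \<or> ?y \<in> b"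
        using that False cls[of ?x] cls[of ?y] self[OF N(1)] self[OF N(2)] by metis
      have shatter_iff: "shatter A b `` {?x} = shatter A b `` {?y} \<longleftrightarrow> A `` {?x} = A `` {?y}"
        unfolding class_in_shatter[OF A b N(1)] class_in_shatter[OF A b N(2)]
        using False xy sing[OF N(1), of ?y] sing[OF N(2), of ?x] diff_cls
        by (cases "?x \<in> b"; cases "?y \<in> b") simp_all
      have cl_\<sigma>: "A `` {\<sigma> x} = A `` {x}" if "\<sigma> permutes b" for \<sigma> x
        using cls[of x] cls[of "\<sigma> x"] in_b[OF that, of x] out_b[OF that, of x] by (cases "x \<in> b") auto
      show ?thesis
        unfolding BA
      proof (rule alternate_commutes)
        show "A `` {\<sigma> ?x} = A `` {\<sigma> ?y} \<longleftrightarrow> shatter A b `` {?x} = shatter A b `` {?y}" if "\<sigma> permutes b" for \<sigma>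
          unfolding cl_\<sigma>[OF that] shatter_iff ..
      qed (rule order)
    qed
  qed
qed

lemma braid_stable_alternating_compatible:
  fixes q :: "'k::field"
  shows "braid_stable N q (alternating_compatible N)"
  unfolding braid_stable_def
proof (intro conjI ballI)
  show "fvs.subspace (alternating_compatible N :: 'k coloured_words set)"
  proof (rule fvs.subspaceI)
    show "0 \<in> (alternating_compatible N :: 'k coloured_words set)"
      by (simp add: alternating_compatible_def alternate_apply)
  next
    fix f g :: "'k coloured_words" assume fg: "f \<in> alternating_compatible N" "g \<in> alternating_compatible N"
    have "alternate b (f + g) (A, w) = alternate b f (A, w) + alternate b g (A, w)" for b A w
      unfolding alternate_apply by (simp add: distrib_left sum.distrib)
    moreover have "f (A, w) \<noteq> 0 \<or> g (A, w) \<noteq> 0" if "(f + g) (A, w) \<noteq> 0" for A w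
      using that by auto
    ultimately show "f + g \<in> alternating_compatible N"
      using fg unfolding alternating_compatible_def mem_Collect_eq by metis
  next
    fix c :: 'k and f :: "'k coloured_words" assume f: "f \<in> alternating_compatible N"
    have "alternate b (fscale c f) (A, w) = c * alternate b f (A, w)" for b A w
      unfolding alternate_apply fscale_def by (simp add: sum_distrib_left algebra_simps)
    moreover have "f (A, w) \<noteq> 0" if "fscale c f (A, w) \<noteq> 0" for A w
      using that by (auto simp: fscale_def)
    ultimately show "fscale c f \<in> alternating_compatible N"
      using f unfolding alternating_compatible_def mem_Collect_eq by metis
  qed
next
  fix i and f :: "'k coloured_words" assume i: "i \<in> {1..<N}" and f: "f \<in> alternating_compatible N"
  have supp: "\<And>A w. f (A, w) \<noteq> 0 \<Longrightarrow> equiv {1..N} A \<and> w permutes {1..N}"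
    and comp: "\<And>A b w. equiv {1..N} A \<Longrightarrow> b \<in> {1..N} // A \<Longrightarrow> w permutes {1..N} \<Longrightarrow>
        alternate b f (A, w) = alternate b f (shatter A b, w)"
    using f unfolding alternating_compatible_def by blast+
  show "braid_act q (adj i) f \<in> alternating_compatible N"
    unfolding alternating_compatible_def mem_Collect_eq
  proof (intro conjI allI impI)
    fix A w assume nz: "braid_act q (adj i) f (A, w) \<noteq> 0"
    then show "equiv {1..N} A" using braid_act_nonzero[OF nz] supp by blast
    show "w permutes {1..N}"
      using braid_act_nonzero[OF nz] supp permutes_comp_adj_iff[OF i, of w] by blast
  next
    fix A b w assume A: "equiv {1..N} A" and b: "b \<in> {1..N} // A" and w: "w permutes {1..N}"
    have ws: "w \<circ> adj i permutes {1..N}" using w permutes_comp_adj_iff[OF i, of w] by blast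
    show "alternate b (braid_act q (adj i) f) (A, w) = alternate b (braid_act q (adj i) f) (shatter A b, w)"
      unfolding alternate_braid_act_compatible[OF A b w i disjI1[OF refl]]
        alternate_braid_act_compatible[OF A b w i disjI2[OF refl]] act_formula_def
        comp[OF A b w] comp[OF A b ws] ..
  qed
qed

lemma word_vec_alternating_compatible: "word_vec N id \<in> alternating_compatible N"
  unfolding alternating_compatible_def mem_Collect_eq
proof (intro conjI allI impI)
  fix A and w :: "nat \<Rightarrow> nat" assume "word_vec N id (A, w) \<noteq> (0 :: 'a)"
  then show "equiv {1..N} A" "w permutes {1..N}" by (auto simp: word_vec_apply split: if_splits)
next
  fix A b w assume "equiv {1..N} A" "b \<in> {1..N} // A" "w permutes {1..N}"
  then show "alternate b (word_vec N id) (A, w) = alternate b (word_vec N id) (shatter A b, w)"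
    using equiv_shatter[of N A b] unfolding alternate_apply word_vec_apply by simp
qed

text \<open>
  Induction on the size of \<open>A\<close>, and for fixed \<open>A\<close> on the number of classes whose letters appear in
  increasing order in \<open>w\<close>. The shattered colouring is smaller, so the antisymmetrisation at \<open>(A, w)\<close> over
  each non-trivial class vanishes. For a class in increasing order, all its terms other than \<open>f (A, w)\<close>
  belong to words with fewer such classes.
\<close>

lemma alternating_compatible_determined:
  assumes f: "f \<in> alternating_compatible N"
    and zero: "\<And>A w. equiv {1..N} A \<Longrightarrow> w permutes {1..N} \<Longrightarrow>
      (\<And>b. b \<in> {1..N} // A \<Longrightarrow> 2 \<le> card b \<Longrightarrow> \<not> strict_mono_on b (inv' w)) \<Longrightarrow> f (A, w) = 0"
  shows "f = 0"
proof -
  have comp: "\<And>A b w. equiv {1..N} A \<Longrightarrow> b \<in> {1..N} // A \<Longrightarrow> w permutes {1..N} \<Longrightarrow>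
        alternate b f (A, w) = alternate b f (shatter A b, w)"
    using f unfolding alternating_compatible_def by blast
  have "f (A, w) = 0" if "equiv {1..N} A" "w permutes {1..N}" for A w
    using that
  proof (induction "card A" arbitrary: A w rule: less_induct)
    case (less A w)
    note A = less.prems(1)
    have finA: "finite A" by (rule finite_subset[of _ "{1..N} \<times> {1..N}"]) (use A in \<open>auto simp: equiv_def\<close>)
    have alt0: "alternate b f (A, w) = 0" if b: "b \<in> {1..N} // A" "2 \<le> card b" and w: "w permutes {1..N}" for b w
    proof -
      have bb: "b \<times> b \<subseteq> A" using quotient_eq_iff[OF A b(1) b(1)] by auto
      have sub: "shatter A b \<subseteq> A" using bb unfolding shatter_def by blast
      obtain x y where "x \<in> b" "y \<in> b" "x \<noteq> y"
        using b(2) by (rule two_elements)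
      then have "(x, y) \<in> A" "(x, y) \<notin> shatter A b" using bb unfolding shatter_def by blast+
      then have "shatter A b \<subset> A" using sub by blast
      then have "card (shatter A b) < card A" by (rule psubset_card_mono[OF finA])
      then have IH: "f (shatter A b, u) = 0" if "u permutes {1..N}" for u
        using less.hyps equiv_shatter[OF A b(1)] that by blast
      have "alternate b f (shatter A b, w) = 0"
        unfolding alternate_apply
      proof (rule sum.neutral, rule ballI)
        fix \<sigma> assume "\<sigma> \<in> {\<sigma>. \<sigma> permutes b}"
        then have "\<sigma> permutes {1..N}" using permutes_subset[OF _ class_subset[OF A b(1)]] by simp
        then show "of_int (sign \<sigma>) * f (shatter A b, \<sigma> \<circ> w) = 0"
          using IH[OF permutes_compose[OF w]] by simp
      qed
      then show ?thesis using comp[OF A b(1) w] by simp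
    qed
    (* The classes whose letters appear in increasing order. *)
    define bad where "bad w = {b \<in> {1..N} // A. 2 \<le> card b \<and> strict_mono_on b (inv' w)}" for w :: "nat \<Rightarrow> nat"
    have fin_bad: "finite (bad w)" for w
      unfolding bad_def using finite_classes[OF A] by simp
    show ?case
      using less.prems(2)
    proof (induction "card (bad w)" arbitrary: w rule: less_induct)
      case (less w)
      show ?case
      proof (cases "bad w = {}")
        case True
        then show ?thesis using less.prems by (intro zero[OF A]) (auto simp: bad_def)
      next
        case False
        then obtain b where b: "b \<in> bad w" by blast
        then have b': "b \<in> {1..N} // A" "2 \<le> card b" "strict_mono_on b (inv' w)" by (auto simp: bad_def)
        have finb: "finite b" by (rule finite_class[OF A b'(1)])
        have others: "f (A, \<sigma> \<circ> w) = 0" if \<sigma>: "\<sigma> permutes b" "\<sigma> \<noteq> id" for \<sigma>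
        proof -
          have \<sigma>N: "\<sigma> permutes {1..N}" by (rule permutes_subset[OF \<sigma>(1) class_subset[OF A b'(1)]])
          have inv: "inv' (\<sigma> \<circ> w) = inv' w \<circ> inv' \<sigma>"
            by (rule o_inv_distrib[OF permutes_bij[OF \<sigma>N] permutes_bij[OF less.prems]])
          have notb: "b \<notin> bad (\<sigma> \<circ> w)"
          proof
            assume "b \<in> bad (\<sigma> \<circ> w)"
            then have "strict_mono_on b (inv' w \<circ> inv' \<sigma>)" unfolding bad_def inv by simp
            then have "inv' \<sigma> = id"
              by (rule strict_mono_on_permuted_imp_id[OF permutes_inv[OF \<sigma>(1)] b'(3)])
            then show False using \<sigma>(2) permutes_inv_inv[OF \<sigma>(1)] by (metis inv_id)
          qed
          have "bad (\<sigma> \<circ> w) \<subseteq> bad w"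
          proof
            fix c assume c: "c \<in> bad (\<sigma> \<circ> w)"
            then have "c \<noteq> b" "c \<in> {1..N} // A" using notb by (auto simp: bad_def)
            then have "c \<inter> b = {}" using quotient_disj[OF A _ b'(1)] by blast
            then have "(inv' w \<circ> inv' \<sigma>) x = inv' w x" if "x \<in> c" for x
              using that permutes_not_in[OF permutes_inv[OF \<sigma>(1)], of x] by (metis disjoint_iff o_apply)
            then have "strict_mono_on c (inv' w \<circ> inv' \<sigma>) \<longleftrightarrow> strict_mono_on c (inv' w)"
              unfolding strict_mono_on_def by auto
            then show "c \<in> bad w" using c unfolding bad_def inv by simp
          qed
          then have "bad (\<sigma> \<circ> w) \<subset> bad w" using b notb by blast
          then have "card (bad (\<sigma> \<circ> w)) < card (bad w)" by (rule psubset_card_mono[OF fin_bad])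
          then show ?thesis by (rule less.hyps) (rule permutes_compose[OF less.prems \<sigma>N])
        qed
        have "0 = alternate b f (A, w)" using alt0[OF b'(1,2) less.prems] by simp
        also have "\<dots> = (\<Sum>\<sigma> \<in> {id}. of_int (sign \<sigma>) * f (A, \<sigma> \<circ> w))"
          unfolding alternate_apply
          by (rule sum.mono_neutral_right) (use others finite_permutations[OF finb] in auto)
        also have "\<dots> = f (A, w)" by simp
        finally show ?thesis by simp
      qed
    qed
  qed
  moreover have "f (A, w) = 0" if "\<not> (equiv {1..N} A \<and> w permutes {1..N})" for A w
    using f that unfolding alternating_compatible_def by blast
  ultimately show ?thesis by (auto simp: fun_eq_iff)
qed

section \<open>The free algebra acts on coloured words\<close>

interpretation fa: vector_space "\<lambda>(c::'k::field) (p::('x, 'k) free_alg). free_scalar c * p"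
proof
  fix a b :: 'k and x y :: "('x, 'k) free_alg"
  show "free_scalar a * (x + y) = free_scalar a * x + free_scalar a * y" by (rule distrib_left)
  show "free_scalar (a + b) * x = free_scalar a * x + free_scalar b * x"
    unfolding free_scalar_def single_add by (rule distrib_right)
  show "free_scalar a * (free_scalar b * x) = free_scalar (a * b) * x"
    unfolding free_scalar_def mult.assoc[symmetric] mult_single by simp
  show "free_scalar 1 * x = x" unfolding free_scalar_def by simp
qed

lemma free_poly_induct [case_names single plus]:
  assumes single: "\<And>u c. P (Poly_Mapping.single u c)" and plus: "\<And>p p'. P p \<Longrightarrow> P p' \<Longrightarrow> P (p + p')"
  shows "P (p :: ('x, 'k::field) free_alg)"
proof (induction p rule: update_induct)
  case const
  then show ?case using single[of 0 0] by simp
next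
  case (update f a b)
  have "Poly_Mapping.update a b f = Poly_Mapping.single a b + f"
    using update by (intro poly_mapping_eqI) (auto simp: lookup_update lookup_add lookup_single when_def in_keys_iff)
  then show ?case using single plus update.IH by simp
qed

lemma free_scalar_commute: "p * free_scalar c = free_scalar c * (p :: ('x, 'k::field) free_alg)"
  by (induction p rule: free_poly_induct)
    (simp_all add: free_scalar_def mult_single distrib_left distrib_right mult.commute)

fun gen_act :: "'k::field \<Rightarrow> (nat \<Rightarrow> nat) bt_gen \<Rightarrow> 'k coloured_words \<Rightarrow> 'k coloured_words" where
  "gen_act q (Braid s) = braid_act q s"
| "gen_act q (Tie r) = tie_act r"

definition word_act :: "'k::field \<Rightarrow> (nat \<Rightarrow> nat) bt_gen free_word \<Rightarrow> 'k coloured_words \<Rightarrow> 'k coloured_words" where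
  "word_act q u f = foldr (gen_act q) (letters u) f"

definition alg_act :: "'k::field \<Rightarrow> ((nat \<Rightarrow> nat) bt_gen, 'k) free_alg \<Rightarrow> 'k coloured_words \<Rightarrow> 'k coloured_words" where
  "alg_act q p f = (\<Sum>u \<in> Poly_Mapping.keys p. fscale (Poly_Mapping.lookup p u) (word_act q u f))"

lemma linear_gen_act: "Vector_Spaces.linear fscale fscale (gen_act q x)"
  by (cases x) (simp_all add: linear_braid_act linear_tie_act)

lemma word_act_zero: "word_act q 0 f = f"
  by (simp add: word_act_def zero_free_word_def)

lemma word_act_plus: "word_act q (u + u') f = word_act q u (word_act q u' f)"
  by (simp add: word_act_def plus_free_word_def)

lemma word_act_add_scale:
  "word_act q u (f + g) = word_act q u f + word_act q u g"
  "word_act q u (fscale c f) = fscale c (word_act q u f)"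
proof -
  have "foldr (gen_act q) xs (f + g) = foldr (gen_act q) xs f + foldr (gen_act q) xs g \<and>
      foldr (gen_act q) xs (fscale c f) = fscale c (foldr (gen_act q) xs f)" for xs
    by (induction xs)
      (simp_all add: module_hom.add[OF linear_imp_module_hom[OF linear_gen_act]]
        module_hom.scale[OF linear_imp_module_hom[OF linear_gen_act]] del: plus_fun_apply)
  then show "word_act q u (f + g) = word_act q u f + word_act q u g"
    "word_act q u (fscale c f) = fscale c (word_act q u f)" unfolding word_act_def by blast+
qed

lemma alg_act_single: "alg_act q (Poly_Mapping.single u c) f = fscale c (word_act q u f)"
  by (cases "c = 0") (simp_all add: alg_act_def)

lemma alg_act_plus: "alg_act q (p + p') f = alg_act q p f + alg_act q p' f"
  unfolding alg_act_def by (rule setsum_keys_plus_distrib) (rule fvs.scale_zero_left fvs.scale_left_distrib)+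

lemma alg_act_scale: "alg_act q p (fscale c f) = fscale c (alg_act q p f)"
  by (induction p rule: free_poly_induct)
    (simp_all add: alg_act_single alg_act_plus word_act_add_scale fvs.scale_right_distrib mult.commute del: plus_fun_apply)

lemma alg_act_mult: "alg_act q (p * p') f = alg_act q p (alg_act q p' f)"
proof (induction p rule: free_poly_induct)
  case (single u c)
  show ?case
    by (induction p' rule: free_poly_induct)
      (simp_all add: mult_single alg_act_single alg_act_plus word_act_plus word_act_add_scale
        distrib_left fvs.scale_right_distrib del: plus_fun_apply)
next
  case (plus p p')
  then show ?case by (simp add: distrib_right alg_act_plus)
qed

lemma alg_act_zero: "alg_act q 0 f = 0"
  by (simp add: alg_act_def)

lemma alg_act_uminus: "alg_act q (- p) f = - alg_act q p f"
  using alg_act_plus[of q p "- p" f] by (simp add: alg_act_zero minus_unique[symmetric] add_eq_0_iff)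

lemma alg_act_diff: "alg_act q (p - p') f = alg_act q p f - alg_act q p' f"
  using alg_act_plus[of q p "- p'" f] by (simp add: alg_act_uminus)

lemma alg_act_scalar: "alg_act q (free_scalar c) f = fscale c f"
  by (simp add: free_scalar_def alg_act_single word_act_zero)

lemma alg_act_one: "alg_act q 1 f = f"
  using alg_act_scalar[of q 1 f] by (simp add: free_scalar_def)

lemma alg_act_gen: "alg_act q (free_gen x) f = gen_act q x f"
  by (simp add: free_gen_def alg_act_single word_act_def)

lemma alg_act_g [simp]: "alg_act q (bt_g s) f = braid_act q s f"
  and alg_act_e [simp]: "alg_act q (bt_e r) f = tie_act r f"
  by (simp_all add: alg_act_gen)

lemma simple_transpositions_eq: "simple_transpositions n = adj ` {1..<n + 1}"
  by (auto simp: simple_transpositions_def)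

lemma sym_group_inv: "w permutes {1..N} \<Longrightarrow> inv\<^bsub>sym_group N\<^esub> w = inv' w"
  by (rule sym_group_inv_equality) (simp add: sym_group_carrier)

lemma transpose_conj: "bij w \<Longrightarrow> w \<circ> transpose a b \<circ> inv' w = transpose (w a) (w b)"
  by (auto simp: fun_eq_iff transpose_def bij_inv_eq_iff) (metis bij_inv_eq_iff)+

text \<open>
  Every transposition is conjugate to \<open>(1 2)\<close>.
\<close>

lemma reflections_eq:
  "reflections (sym_group (n + 1)) (simple_transpositions n) =
    {transpose a b | a b. a \<in> {1..n + 1} \<and> b \<in> {1..n + 1} \<and> a \<noteq> b}" (is "?L = ?R")
proof
  show "?L \<subseteq> ?R"
  proof
    fix r assume "r \<in> ?L"
    then obtain w i where w: "w permutes {1..n + 1}" and i: "i \<in> {1..<n + 1}"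
      and r: "r = w \<circ> adj i \<circ> inv' w"
      unfolding reflections_def simple_transpositions_eq
      by (auto simp: sym_group_carrier sym_group_mult sym_group_inv simp del: atLeastAtMost_iff)
    have "r = transpose (w i) (w (Suc i))" unfolding r by (rule transpose_conj[OF permutes_bij[OF w]])
    moreover have "w i \<in> {1..n + 1}" "w (Suc i) \<in> {1..n + 1}"
      using i permutes_in_image[OF w] by auto
    moreover have "w i \<noteq> w (Suc i)" using permutes_inj[OF w] by (metis injD n_not_Suc_n)
    ultimately show "r \<in> ?R" by blast
  qed
  show "?R \<subseteq> ?L"
  proof
    fix r assume "r \<in> ?R"
    then obtain a b where ab: "a \<in> {1..n + 1}" "b \<in> {1..n + 1}" "a \<noteq> b" and r: "r = transpose a b" by blast
    then have n: "1 \<in> {1..<n + 1}" by auto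
    define c where "c = transpose 1 a b"
    define w where "w = transpose 1 a \<circ> transpose 2 c"
    have c: "c \<in> {1..n + 1}" "c \<noteq> 1"
      unfolding c_def using ab by (auto simp: transpose_def)
    have w: "w permutes {1..n + 1}"
      unfolding w_def using ab c n by (intro permutes_compose permutes_swap_id) auto
    have "w 1 = a" "w (Suc 1) = b"
      unfolding w_def using c c_def by (auto simp: numeral_2_eq_2)
    then have "r = w \<circ> adj 1 \<circ> inv' w"
      unfolding r transpose_conj[OF permutes_bij[OF w]] by simp
    moreover have "adj 1 \<in> simple_transpositions n" unfolding simple_transpositions_eq using n by blast
    ultimately have "r = w \<otimes>\<^bsub>sym_group (n + 1)\<^esub> adj 1 \<otimes>\<^bsub>sym_group (n + 1)\<^esub> inv\<^bsub>sym_group (n + 1)\<^esub> w"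
      and "adj 1 \<in> simple_transpositions n" and "w \<in> carrier (sym_group (n + 1))"
      using w by (simp_all only: sym_group_mult sym_group_inv[OF w] sym_group_carrier)
    then show "r \<in> ?L" unfolding reflections_def by blast
  qed
qed

lemma sym_group_ord_eq_prime:
  assumes "x permutes {1..N}" "x \<noteq> id" "Factorial_Ring.prime p" "x [^]\<^bsub>sym_group N\<^esub> p = id"
  shows "group.ord (sym_group N) x = p"
proof -
  interpret group "sym_group N" by (rule sym_group_is_group)
  have x: "x \<in> carrier (sym_group N)" using assms(1) by (simp add: sym_group_carrier)
  have "ord x dvd p" using assms(4) pow_eq_id[OF x, of p] by (simp add: sym_group_one)
  then have "ord x = 1 \<or> ord x = p" using assms(3) by (meson prime_nat_iff)
  moreover have "ord x \<noteq> 1" using assms(2) ord_eq_1[OF x] by (simp add: sym_group_one)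
  ultimately show ?thesis by blast
qed

text \<open>
  The exponents of the braid relations.
\<close>

lemma ord_adj_adj:
  assumes "i \<in> {1..<N}" "j \<in> {1..<N}"
  shows "group.ord (sym_group N) (adj i \<otimes>\<^bsub>sym_group N\<^esub> adj j) =
    (if i = j then 1 else if j = Suc i \<or> i = Suc j then 3 else 2)"
proof -
  interpret group "sym_group N" by (rule sym_group_is_group)
  have perm: "adj i \<circ> adj j permutes {1..N}"
    by (intro permutes_compose adj_permutes assms)
  have pow2: "x [^]\<^bsub>sym_group N\<^esub> (2::nat) = x \<circ> x" if "x permutes {1..N}" for x
    using that by (simp add: numeral_2_eq_2 sym_group_mult sym_group_one nat_pow_Suc)
  have pow3: "x [^]\<^bsub>sym_group N\<^esub> (3::nat) = x \<circ> x \<circ> x" if "x permutes {1..N}" for x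
    using that by (simp add: numeral_3_eq_3 sym_group_mult sym_group_one nat_pow_Suc)
  consider "i = j" | "j = Suc i" | "i = Suc j" | "Suc i < j \<or> Suc j < i" by linarith
  then show ?thesis
  proof cases
    case 1
    then have "adj i \<otimes>\<^bsub>sym_group N\<^esub> adj j = \<one>\<^bsub>sym_group N\<^esub>"
      by (simp add: sym_group_mult sym_group_one)
    then show ?thesis using 1 ord_eq_1[OF one_closed] by simp
  next
    case 2
    have "group.ord (sym_group N) (adj i \<circ> adj j) = 3"
    proof (rule sym_group_ord_eq_prime[OF perm])
      show "adj i \<circ> adj j \<noteq> id" using 2 by (auto simp: fun_eq_iff transpose_def intro!: exI[of _ i])
      show "(adj i \<circ> adj j) [^]\<^bsub>sym_group N\<^esub> (3::nat) = id"
        unfolding pow3[OF perm] using 2 by (auto simp: fun_eq_iff transpose_def)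
    qed simp
    then show ?thesis using 2 by (simp add: sym_group_mult)
  next
    case 3
    have "group.ord (sym_group N) (adj i \<circ> adj j) = 3"
    proof (rule sym_group_ord_eq_prime[OF perm])
      show "adj i \<circ> adj j \<noteq> id" using 3 by (auto simp: fun_eq_iff transpose_def intro!: exI[of _ i])
      show "(adj i \<circ> adj j) [^]\<^bsub>sym_group N\<^esub> (3::nat) = id"
        unfolding pow3[OF perm] using 3 by (auto simp: fun_eq_iff transpose_def)
    qed simp
    then show ?thesis using 3 by (simp add: sym_group_mult)
  next
    case 4
    have "group.ord (sym_group N) (adj i \<circ> adj j) = 2"
    proof (rule sym_group_ord_eq_prime[OF perm])
      show "adj i \<circ> adj j \<noteq> id" using 4 by (auto simp: fun_eq_iff transpose_def intro!: exI[of _ i])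
      show "(adj i \<circ> adj j) [^]\<^bsub>sym_group N\<^esub> (2::nat) = id"
        unfolding pow2[OF perm] using 4 by (auto simp: fun_eq_iff transpose_def)
    qed simp
    then show ?thesis using 4 by (auto simp: sym_group_mult)
  qed
qed

lemma alg_act_relator:
  assumes "x \<in> bt_relators (sym_group (n + 1)) (simple_transpositions n) v"
  shows "alg_act (v\<^sup>2) x f = 0"
  using assms
proof (cases rule: bt_relators.cases)
  case (braid s t m)
  then obtain i j where ij: "i \<in> {1..<n + 1}" "j \<in> {1..<n + 1}" and st: "s = adj i" "t = adj j"
    unfolding simple_transpositions_eq by blast
  have alt2: "alternating_prod 2 a b = a * b" and alt3: "alternating_prod 3 a b = a * (b * a)"
    for a b :: "((nat \<Rightarrow> nat) bt_gen, 'a) free_alg"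
    by (simp_all add: numeral_2_eq_2 numeral_3_eq_3)
  have m: "m = (if i = j then 1 else if j = Suc i \<or> i = Suc j then 3 else 2)"
    unfolding braid(4) st by (rule ord_adj_adj[OF ij])
  consider "i = j" | "j = Suc i" | "i = Suc j" | "Suc i < j" | "Suc j < i" by linarith
  then show ?thesis
  proof cases
    case 1
    then show ?thesis using braid st by (simp add: alg_act_zero)
  next
    case 2
    then have "m = 3" using m by simp
    then show ?thesis
      unfolding braid(1) st 2 by (simp only: alt3 alg_act_diff alg_act_mult alg_act_g braid_act_braid diff_self)
  next
    case 3
    then have "m = 3" using m by simp
    then show ?thesis
      unfolding braid(1) st 3 by (simp only: alt3 alg_act_diff alg_act_mult alg_act_g braid_act_braid diff_self)
  next
    case 4
    then have "m = 2" using m by simp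
    then show ?thesis
      unfolding braid(1) st by (simp only: alt2 alg_act_diff alg_act_mult alg_act_g braid_act_far[OF 4] diff_self)
  next
    case 5
    then have "m = 2" using m by simp
    then show ?thesis
      unfolding braid(1) st by (simp only: alt2 alg_act_diff alg_act_mult alg_act_g braid_act_far[OF 5] diff_self)
  qed
next
  case (tie_idem r)
  then show ?thesis by (simp add: alg_act_diff alg_act_mult tie_act_idem)
next
  case (tie_commute r1 r2)
  then show ?thesis by (simp add: alg_act_diff alg_act_mult tie_act_commute[of r1])
next
  case (tie_conj r1 r2)
  have perm: "r1 permutes {1..n + 1}"
    using tie_conj(2) unfolding reflections_eq by (auto intro: permutes_swap_id)
  show ?thesis
    unfolding tie_conj(1) sym_group_mult sym_group_inv[OF perm] alg_act_diff alg_act_mult alg_act_e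
      tie_act_conj[OF permutes_bij[OF perm], symmetric] by simp
next
  case (braid_tie s r)
  then obtain i where s: "s = adj i" unfolding simple_transpositions_eq by blast
  show ?thesis
    unfolding braid_tie(1) s sym_group_mult alg_act_diff alg_act_mult alg_act_e alg_act_g braid_act_tie by simp
next
  case (quadratic s)
  then obtain i where s: "s = adj i" unfolding simple_transpositions_eq by blast
  show ?thesis
    unfolding quadratic(1) s alg_act_diff alg_act_mult alg_act_plus alg_act_one alg_act_scalar alg_act_e alg_act_g
      braid_act_quadratic by simp
qed

section \<open>The dimension of the orbit space\<close>

definition orbit_space :: "nat \<Rightarrow> 'k::field \<Rightarrow> 'k coloured_words set" where
  "orbit_space N q = \<Inter>{W. braid_stable N q W \<and> word_vec N id \<in> W}"

lemma braid_stable_orbit_space: "braid_stable N q (orbit_space N q)"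
  unfolding braid_stable_def
proof (intro conjI ballI)
  show "fvs.subspace (orbit_space N q)"
    unfolding orbit_space_def by (rule fvs.subspace_Inter) (auto simp: braid_stable_def)
qed (auto simp: orbit_space_def braid_stable_def)

lemma word_vec_in_orbit_space: "word_vec N id \<in> orbit_space N q"
  by (auto simp: orbit_space_def)

lemma orbit_space_minimal:
  "braid_stable N q W \<Longrightarrow> word_vec N id \<in> W \<Longrightarrow> orbit_space N q \<subseteq> W"
  by (auto simp: orbit_space_def)

lemma restriction_in_span:
  fixes f :: "'i \<Rightarrow> 'k::field"
  assumes "finite Y"
  shows "(\<lambda>y. if y \<in> Y then f y else 0) \<in> fvs.span ((\<lambda>y x. if x = y then 1 else 0) ` Y)"
proof -
  let ?d = "\<lambda>y x. if x = y then (1 :: 'k) else 0"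
  have "(\<Sum>y \<in> Y. fscale (f y) (?d y)) x = (\<Sum>y \<in> Y. if x = y then f y else 0)" for x
    by (induction Y rule: infinite_finite_induct) (auto simp: fscale_def)
  then have "(\<lambda>y. if y \<in> Y then f y else 0) = (\<Sum>y \<in> Y. fscale (f y) (?d y))"
    using assms by (simp add: fun_eq_iff sum.delta')
  also have "\<dots> \<in> fvs.span (?d ` Y)"
    by (intro fvs.span_sum fvs.span_scale fvs.span_base) auto
  finally show ?thesis .
qed

text \<open>
  Restriction to the coordinates in \<open>Y\<close> embeds \<open>W\<close> into a space of dimension \<open>card Y\<close>, so that many
  independent vectors span.
\<close>

lemma spanning_by_coordinates:
  fixes W :: "('i \<Rightarrow> 'k::field) set"
  assumes W: "fvs.subspace W" and Y: "finite Y"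
    and det: "\<And>f. f \<in> W \<Longrightarrow> (\<And>y. y \<in> Y \<Longrightarrow> f y = 0) \<Longrightarrow> f = 0"
    and B: "B \<subseteq> W" "finite B" "fvs.independent B" "card B = card Y"
  shows "W \<subseteq> fvs.span B"
proof
  fix f assume f: "f \<in> W"
  show "f \<in> fvs.span B"
  proof (rule ccontr)
    assume notin: "f \<notin> fvs.span B"
    define r where "r = (\<lambda>(g :: 'i \<Rightarrow> 'k) y. if y \<in> Y then g y else 0)"
    have lin: "Vector_Spaces.linear fscale fscale r"
      by unfold_locales (auto simp: r_def fscale_def fun_eq_iff)
    have ind: "fvs.independent (insert f B)"
      by (rule fvs.independent_insertI[OF notin B(3)])
    have sub: "fvs.span (insert f B) \<subseteq> W"
      by (rule fvs.span_minimal[OF _ W]) (use f B in auto)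
    have inj: "inj_on r W"
    proof (rule inj_onI)
      fix g h assume gh: "g \<in> W" "h \<in> W" "r g = r h"
      have "g - h = 0"
      proof (rule det)
        show "g - h \<in> W" by (rule fvs.subspace_diff[OF W gh(1,2)])
        show "(g - h) y = 0" if "y \<in> Y" for y
          using fun_cong[OF gh(3), of y] that by (simp add: r_def)
      qed
      then show "g = h" by simp
    qed
    have "fvs.independent (r ` insert f B)"
      by (rule module_hom.independent_injective_image[OF linear_imp_module_hom[OF lin] ind inj_on_subset[OF inj sub]])
    moreover have "r ` insert f B \<subseteq> fvs.span ((\<lambda>y x. if x = y then 1 else 0) ` Y)"
      unfolding r_def using restriction_in_span[OF Y] by blast
    ultimately have "card (r ` insert f B) \<le> card ((\<lambda>y x. if x = y then (1::'k) else 0) ` Y)"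
      using fvs.independent_span_bound Y by blast
    also have "\<dots> \<le> card Y" by (rule card_image_le[OF Y])
    finally have "card (r ` insert f B) \<le> card Y" .
    moreover have "card (r ` insert f B) = card (insert f B)"
      by (rule card_image[OF inj_on_subset[OF inj]]) (use f B in auto)
    moreover have "f \<notin> B" using notin fvs.span_base by blast
    ultimately show False using B by simp
  qed
qed

theorem orbit_space_basis:
  assumes q: "q \<noteq> 0" "q \<noteq> 1" "q \<noteq> - 1"
  shows "\<exists>B \<subseteq> orbit_space N q. finite B \<and> fvs.independent B \<and> orbit_space N q \<subseteq> fvs.span B \<and>
    rat_of_nat (card B) = dimension_formula N"
proof -
  let ?E = "{A. equiv {1..N} A}"
  define D where "D A = {w. w permutes {1..N} \<and>
      (\<forall>b \<in> {1..N} // A. 2 \<le> card b \<longrightarrow> \<not> strict_mono_on b (inv' w))}" for A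
  define Y where "Y = (SIGMA A : ?E. D A)"
  have finD: "finite (D A)" for A
    unfolding D_def by (rule finite_subset[OF _ finite_permutations[of "{1..N}"]]) auto
  have Y: "finite Y" unfolding Y_def by (intro finite_SigmaI finite_eqrels finD)
  have cardY: "rat_of_nat (card Y) = dimension_formula N"
    unfolding Y_def using finD card_nowhere_increasing_inverse
    by (intro card_dimension_family) (simp add: D_def)
  obtain B where B: "B \<subseteq> orbit_space N q" "finite B" "fvs.independent B" "rat_of_nat (card B) = dimension_formula N"
    using exists_independent_family[OF braid_stable_orbit_space word_vec_in_orbit_space q] by blast
  have "orbit_space N q \<subseteq> fvs.span B"
  proof (rule spanning_by_coordinates[OF _ Y _ B(1-3)])
    show "fvs.subspace (orbit_space N q)" using braid_stable_orbit_space[of N q] by (simp add: braid_stable_def)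
    show "card B = card Y" using B(4) cardY by (metis of_nat_eq_iff)
    fix f :: "'a coloured_words" assume f: "f \<in> orbit_space N q" and zero: "\<And>y. y \<in> Y \<Longrightarrow> f y = 0"
    have "f \<in> alternating_compatible N"
      using f orbit_space_minimal[OF braid_stable_alternating_compatible word_vec_alternating_compatible] by blast
    then show "f = 0"
      by (rule alternating_compatible_determined) (rule zero, simp add: Y_def D_def)
  qed
  then show ?thesis using B by blast
qed

section \<open>Normal forms in the algebra of braids and ties\<close>

lemma free_algebra_simps [simp]:
  "x \<otimes>\<^bsub>free_algebra A\<^esub> y = x * y" "x \<oplus>\<^bsub>free_algebra A\<^esub> y = x + y"
  "\<one>\<^bsub>free_algebra A\<^esub> = 1" "\<zero>\<^bsub>free_algebra A\<^esub> = 0"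
  by (simp_all add: free_algebra_def)

lemma free_algebra_carrier: "p \<in> carrier (free_algebra A) \<longleftrightarrow> Poly_Mapping.keys p \<subseteq> Word ` lists A"
  by (simp add: free_algebra_def)

lemma free_algebra_closed [intro, simp]:
  "p \<in> carrier (free_algebra A) \<Longrightarrow> p' \<in> carrier (free_algebra A) \<Longrightarrow> p + p' \<in> carrier (free_algebra A)"
  "p \<in> carrier (free_algebra A) \<Longrightarrow> p' \<in> carrier (free_algebra A) \<Longrightarrow> p * p' \<in> carrier (free_algebra A)"
  "p \<in> carrier (free_algebra A) \<Longrightarrow> - p \<in> carrier (free_algebra A)"
  "p \<in> carrier (free_algebra A) \<Longrightarrow> p' \<in> carrier (free_algebra A) \<Longrightarrow> p - p' \<in> carrier (free_algebra A)"
  "1 \<in> carrier (free_algebra A)" "0 \<in> carrier (free_algebra A)" "free_scalar c \<in> carrier (free_algebra A)"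
proof -
  show add: "p + p' \<in> carrier (free_algebra A)"
    if "p \<in> carrier (free_algebra A)" "p' \<in> carrier (free_algebra A)" for p p'
    using that keys_add[of p p'] unfolding free_algebra_carrier by blast
  show "p * p' \<in> carrier (free_algebra A)"
    if pp': "p \<in> carrier (free_algebra A)" "p' \<in> carrier (free_algebra A)"
    unfolding free_algebra_carrier
  proof
    fix u assume "u \<in> Poly_Mapping.keys (p * p')"
    then obtain a b where "u = a + b" "a \<in> Poly_Mapping.keys p" "b \<in> Poly_Mapping.keys p'"
      using keys_mult[of p p'] by blast
    moreover from this obtain xs ys where "a = Word xs" "b = Word ys" "xs \<in> lists A" "ys \<in> lists A"
      using pp' unfolding free_algebra_carrier by blast
    ultimately show "u \<in> Word ` lists A" by (auto simp: plus_free_word_def)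
  qed
  show neg: "- p \<in> carrier (free_algebra A)" if "p \<in> carrier (free_algebra A)" for p
  proof -
    have "Poly_Mapping.keys (- p) = Poly_Mapping.keys p" by (auto simp: in_keys_iff)
    then show ?thesis using that by (simp add: free_algebra_carrier)
  qed
  show "p - p' \<in> carrier (free_algebra A)"
    if "p \<in> carrier (free_algebra A)" "p' \<in> carrier (free_algebra A)"
    using add[OF that(1) neg[OF that(2)]] by simp
  have nil: "(0 :: 'a free_word) \<in> Word ` lists A" by (auto simp: zero_free_word_def)
  show scal: "free_scalar c \<in> carrier (free_algebra A)" for c
    using nil by (auto simp: free_algebra_carrier free_scalar_def)
  show "1 \<in> carrier (free_algebra A)" "0 \<in> carrier (free_algebra A)"
    using nil by (simp_all add: free_algebra_carrier)
qed

lemma free_gen_closed [intro, simp]: "x \<in> A \<Longrightarrow> free_gen x \<in> carrier (free_algebra A)"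
  by (auto simp: free_algebra_carrier free_gen_def)

lemma ring_free_algebra: "ring (free_algebra A)"
proof (rule ringI)
  show "abelian_group (free_algebra A)"
  proof (rule abelian_groupI)
    show "\<exists>y \<in> carrier (free_algebra A). y \<oplus>\<^bsub>free_algebra A\<^esub> x = \<zero>\<^bsub>free_algebra A\<^esub>"
      if "x \<in> carrier (free_algebra A)" for x
      using that by (intro bexI[of _ "- x"]) auto
  qed (auto simp: add_ac)
  show "monoid (free_algebra A)"
    by (rule monoidI) (auto simp: mult.assoc)
qed (auto simp: distrib_left distrib_right)

abbreviation type_A_algebra :: "nat \<Rightarrow> ((nat \<Rightarrow> nat) bt_gen, 'k::field) free_alg ring" where
  "type_A_algebra n \<equiv> free_algebra (bt_gens (sym_group (n + 1)) (simple_transpositions n))"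

abbreviation type_A_ideal :: "nat \<Rightarrow> 'k::field \<Rightarrow> ((nat \<Rightarrow> nat) bt_gen, 'k) free_alg set" where
  "type_A_ideal n v \<equiv> bt_ideal (sym_group (n + 1)) (simple_transpositions n) v"

abbreviation type_A_reflections :: "nat \<Rightarrow> (nat \<Rightarrow> nat) set" where
  "type_A_reflections n \<equiv> reflections (sym_group (n + 1)) (simple_transpositions n)"

abbreviation gen_g :: "nat \<Rightarrow> ((nat \<Rightarrow> nat) bt_gen, 'k::field) free_alg" where
  "gen_g i \<equiv> bt_g (adj i)"

lemma reflection_cases:
  assumes "r \<in> type_A_reflections n"
  obtains a b where "r = transpose a b" "a \<in> {1..n + 1}" "b \<in> {1..n + 1}" "a \<noteq> b"
  using assms unfolding reflections_eq by blast

lemma transpose_reflection: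
  "a \<in> {1..n + 1} \<Longrightarrow> b \<in> {1..n + 1} \<Longrightarrow> a \<noteq> b \<Longrightarrow> transpose a b \<in> type_A_reflections n"
  unfolding reflections_eq by blast

lemma reflection_conj:
  assumes r: "r \<in> type_A_reflections n" and w: "w permutes {1..n + 1}"
  shows "w \<circ> r \<circ> inv' w \<in> type_A_reflections n"
proof -
  obtain a b where ab: "r = transpose a b" "a \<in> {1..n + 1}" "b \<in> {1..n + 1}" "a \<noteq> b"
    using r by (rule reflection_cases)
  have "w a \<in> {1..n + 1}" "w b \<in> {1..n + 1}" "w a \<noteq> w b"
    using ab permutes_in_image[OF w] permutes_inj[OF w] by (simp_all add: inj_eq)
  then show ?thesis
    unfolding ab(1) transpose_conj[OF permutes_bij[OF w]] by (rule transpose_reflection)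
qed

lemma reflection_conj_adj:
  assumes "i \<in> {1..<n + 1}" "r \<in> type_A_reflections n"
  shows "adj i \<circ> r \<circ> adj i \<in> type_A_reflections n"
  using reflection_conj[OF assms(2) adj_permutes[OF assms(1)]] by simp

lemma adj_reflection: "i \<in> {1..<n + 1} \<Longrightarrow> adj i \<in> type_A_reflections n"
  by (rule transpose_reflection) auto

lemma gen_g_closed [simp]: "i \<in> {1..<n + 1} \<Longrightarrow> gen_g i \<in> carrier (type_A_algebra n)"
  unfolding bt_gens_def simple_transpositions_eq by (intro free_gen_closed) blast

lemma gen_e_closed [simp]: "r \<in> type_A_reflections n \<Longrightarrow> bt_e r \<in> carrier (type_A_algebra n)"
  unfolding bt_gens_def by (intro free_gen_closed) blast

lemma alternating_prod_closed:
  "a \<in> carrier (free_algebra A) \<Longrightarrow> b \<in> carrier (free_algebra A) \<Longrightarrow>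
    alternating_prod m a b \<in> carrier (free_algebra A)"
  by (induction m arbitrary: a b) auto

lemma relators_closed:
  "bt_relators (sym_group (n + 1)) (simple_transpositions n) v \<subseteq> carrier (type_A_algebra n)"
proof
  fix x assume "x \<in> bt_relators (sym_group (n + 1)) (simple_transpositions n) v"
  then show "x \<in> carrier (type_A_algebra n)"
  proof (cases rule: bt_relators.cases)
    case (braid s t m)
    then obtain i j where st: "s = adj i" "t = adj j" and ij: "i \<in> {1..<n + 1}" "j \<in> {1..<n + 1}"
      unfolding simple_transpositions_eq by blast
    show ?thesis
      unfolding braid(1) st
      by (intro free_algebra_closed alternating_prod_closed gen_g_closed[OF ij(1)] gen_g_closed[OF ij(2)])
  next
    case (tie_idem r)
    show ?thesis
      unfolding tie_idem(1) by (intro free_algebra_closed gen_e_closed tie_idem(2))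
  next
    case (tie_commute r1 r2)
    show ?thesis
      unfolding tie_commute(1) by (intro free_algebra_closed gen_e_closed tie_commute(2,3))
  next
    case (tie_conj r1 r2)
    have r1: "r1 permutes {1..n + 1}"
      by (rule reflection_cases[OF tie_conj(2)]) (simp only: permutes_swap_id)
    have "inv\<^bsub>sym_group (n + 1)\<^esub> r1 \<otimes>\<^bsub>sym_group (n + 1)\<^esub> r2 \<otimes>\<^bsub>sym_group (n + 1)\<^esub> r1 \<in> type_A_reflections n"
      using reflection_conj[OF tie_conj(3) permutes_inv[OF r1]]
      unfolding sym_group_inv[OF r1] sym_group_mult permutes_inv_inv[OF r1] .
    then show ?thesis unfolding tie_conj(1) using tie_conj(2,3) by (intro free_algebra_closed gen_e_closed)
  next
    case (braid_tie s r)
    then obtain i where i: "s = adj i" "i \<in> {1..<n + 1}" unfolding simple_transpositions_eq by blast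
    then show ?thesis
      unfolding braid_tie(1) sym_group_mult i(1) using braid_tie(3) reflection_conj_adj[OF i(2) braid_tie(3)]
      by (intro free_algebra_closed gen_e_closed gen_g_closed)
  next
    case (quadratic s)
    then obtain i where i: "s = adj i" "i \<in> {1..<n + 1}" unfolding simple_transpositions_eq by blast
    then show ?thesis
      unfolding quadratic(1) i(1) using adj_reflection[OF i(2)]
      by (intro free_algebra_closed gen_e_closed gen_g_closed)
  qed
qed

lemma ideal_type_A: "ideal (type_A_ideal n v) (type_A_algebra n)"
  unfolding bt_ideal_def by (rule ring.genideal_ideal[OF ring_free_algebra relators_closed])

lemma relators_in_ideal:
  "bt_relators (sym_group (n + 1)) (simple_transpositions n) v \<subseteq> type_A_ideal n v"
  unfolding bt_ideal_def by (rule ring.genideal_self[OF ring_free_algebra relators_closed])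

lemma ideal_add: "x \<in> type_A_ideal n v \<Longrightarrow> y \<in> type_A_ideal n v \<Longrightarrow> x + y \<in> type_A_ideal n v"
  using additive_subgroup.a_closed[OF ideal.axioms(1)[OF ideal_type_A], of x n v y] by simp

lemma ideal_lmult: "c \<in> carrier (type_A_algebra n) \<Longrightarrow> x \<in> type_A_ideal n v \<Longrightarrow> c * x \<in> type_A_ideal n v"
  using ideal.I_l_closed[OF ideal_type_A, of x n v c] by simp

lemma ideal_rmult: "c \<in> carrier (type_A_algebra n) \<Longrightarrow> x \<in> type_A_ideal n v \<Longrightarrow> x * c \<in> type_A_ideal n v"
  using ideal.I_r_closed[OF ideal_type_A, of x n v c] by simp

lemma ideal_zero: "0 \<in> type_A_ideal n v"
  using additive_subgroup.zero_closed[OF ideal.axioms(1)[OF ideal_type_A], of n v] by simp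

lemma ideal_uminus: "x \<in> type_A_ideal n v \<Longrightarrow> - x \<in> type_A_ideal n v"
  using ideal_lmult[of "- 1" n x v] by simp

lemma ideal_scale: "x \<in> type_A_ideal n v \<Longrightarrow> free_scalar c * x \<in> type_A_ideal n v"
  by (rule ideal_lmult) simp_all

text \<open>
  The annihilator of all functions is an ideal that contains the relators.
\<close>

lemma alg_act_ideal:
  assumes "p \<in> type_A_ideal n v"
  shows "alg_act (v\<^sup>2) p f = 0"
proof -
  let ?J = "{p \<in> carrier (type_A_algebra n). \<forall>f. alg_act (v\<^sup>2) p f = 0}"
  have zero: "alg_act (v\<^sup>2) p 0 = 0" for p
    using alg_act_scale[of "v\<^sup>2" p 0 0] by (simp add: fscale_def zero_fun_def)
  have "ideal ?J (type_A_algebra n)"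
  proof (rule idealI[OF ring_free_algebra])
    show "subgroup ?J (add_monoid (type_A_algebra n))"
    proof (rule group.subgroupI[OF abelian_group.a_group[OF ring.is_abelian_group[OF ring_free_algebra]]])
      fix a assume a: "a \<in> ?J"
      have "\<ominus>\<^bsub>type_A_algebra n\<^esub> a = - a"
        by (rule abelian_group.minus_equality[OF ring.is_abelian_group[OF ring_free_algebra]]) (use a in simp_all)
      then show "inv\<^bsub>add_monoid (type_A_algebra n)\<^esub> a \<in> ?J"
        using a by (simp add: a_inv_def alg_act_uminus)
    qed (auto simp: alg_act_zero alg_act_plus)
  qed (auto simp: alg_act_mult zero)
  moreover have "bt_relators (sym_group (n + 1)) (simple_transpositions n) v \<subseteq> ?J"
    using relators_closed[of n v] alg_act_relator[of _ n v] by blast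
  ultimately have "type_A_ideal n v \<subseteq> ?J"
    unfolding bt_ideal_def by (rule ring.genideal_minimal[OF ring_free_algebra])
  then show ?thesis using assms by blast
qed

text \<open>
  Equality in the algebra of braids and ties, expressed between representatives in the free algebra.
\<close>

definition tcong :: "nat \<Rightarrow> 'k::field \<Rightarrow> ((nat \<Rightarrow> nat) bt_gen, 'k) free_alg \<Rightarrow> ((nat \<Rightarrow> nat) bt_gen, 'k) free_alg \<Rightarrow> bool" where
  "tcong n v x y \<longleftrightarrow> x - y \<in> type_A_ideal n v"

lemma tcong_refl [simp]: "tcong n v x x"
  unfolding tcong_def diff_self by (rule ideal_zero)

lemma tcong_sym: "tcong n v x y \<Longrightarrow> tcong n v y x"
  unfolding tcong_def using ideal_uminus by fastforce

lemma tcong_trans [trans]: "tcong n v x y \<Longrightarrow> tcong n v y z \<Longrightarrow> tcong n v x z"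
  unfolding tcong_def using ideal_add[of "x - y" n v "y - z"] by simp

lemma tcong_lmult: "tcong n v x y \<Longrightarrow> c \<in> carrier (type_A_algebra n) \<Longrightarrow> tcong n v (c * x) (c * y)"
  unfolding tcong_def right_diff_distrib[symmetric] by (rule ideal_lmult)

lemma tcong_rmult: "tcong n v x y \<Longrightarrow> c \<in> carrier (type_A_algebra n) \<Longrightarrow> tcong n v (x * c) (y * c)"
  unfolding tcong_def left_diff_distrib[symmetric] by (rule ideal_rmult)

lemma tcong_relator:
  "x - y \<in> bt_relators (sym_group (n + 1)) (simple_transpositions n) v \<Longrightarrow> tcong n v x y"
  unfolding tcong_def using relators_in_ideal by blast

lemma adj_simple: "i \<in> {1..<n + 1} \<Longrightarrow> adj i \<in> simple_transpositions n"
  unfolding simple_transpositions_eq by blast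

lemma tcong_far:
  assumes "i \<in> {1..<n + 1}" "j \<in> {1..<n + 1}" "Suc i < j \<or> Suc j < i"
  shows "tcong n v (gen_g i * gen_g j) (gen_g j * gen_g i)"
proof -
  have "group.ord (sym_group (n + 1)) (adj i \<otimes>\<^bsub>sym_group (n + 1)\<^esub> adj j) = 2"
    using ord_adj_adj[OF assms(1,2)] assms(3) by auto
  then show ?thesis
    using bt_relators.braid[OF adj_simple[OF assms(1)] adj_simple[OF assms(2)], of 2 "sym_group (n + 1)" v]
    by (intro tcong_relator) (simp add: numeral_2_eq_2)
qed

lemma tcong_braid:
  assumes "i \<in> {1..<n + 1}" "Suc i \<in> {1..<n + 1}"
  shows "tcong n v (gen_g i * gen_g (Suc i) * gen_g i) (gen_g (Suc i) * gen_g i * gen_g (Suc i))"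
proof -
  have "group.ord (sym_group (n + 1)) (adj i \<otimes>\<^bsub>sym_group (n + 1)\<^esub> adj (Suc i)) = 3"
    using ord_adj_adj[OF assms] by auto
  then show ?thesis
    using bt_relators.braid[OF adj_simple[OF assms(1)] adj_simple[OF assms(2)], of 3 "sym_group (n + 1)" v]
    by (intro tcong_relator) (simp add: numeral_3_eq_3 mult.assoc)
qed

lemma tcong_quadratic:
  "i \<in> {1..<n + 1} \<Longrightarrow>
    tcong n v (gen_g i * gen_g i) (1 + free_scalar (v\<^sup>2 - 1) * bt_e (adj i) * (1 + gen_g i))"
  by (intro tcong_relator bt_relators.quadratic adj_simple)

lemma tcong_braid_tie:
  assumes "i \<in> {1..<n + 1}" "r \<in> type_A_reflections n"
  shows "tcong n v (gen_g i * bt_e r) (bt_e (adj i \<circ> r \<circ> adj i) * gen_g i)"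
  using bt_relators.braid_tie[OF adj_simple[OF assms(1)] assms(2), of v]
  unfolding sym_group_mult by (rule tcong_relator)

lemma tcong_tie_idem: "r \<in> type_A_reflections n \<Longrightarrow> tcong n v (bt_e r * bt_e r) (bt_e r)"
  by (intro tcong_relator bt_relators.tie_idem)

lemma tcong_tie_commute:
  "r \<in> type_A_reflections n \<Longrightarrow> r' \<in> type_A_reflections n \<Longrightarrow> tcong n v (bt_e r * bt_e r') (bt_e r' * bt_e r)"
  by (intro tcong_relator bt_relators.tie_commute)

lemma tcong_tie_conj:
  assumes "a \<in> {1..n + 1}" "b \<in> {1..n + 1}" "c \<in> {1..n + 1}" "a \<noteq> b" "b \<noteq> c" "a \<noteq> c"
  shows "tcong n v (bt_e (transpose a b) * bt_e (transpose b c)) (bt_e (transpose a b) * bt_e (transpose a c))"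
proof -
  have perm: "transpose a b permutes {1..n + 1}" by (rule permutes_swap_id[OF assms(1,2)])
  have "transpose a b \<circ> transpose b c \<circ> transpose a b = transpose a c"
    using assms(4-6) by (auto simp: fun_eq_iff transpose_def)
  then show ?thesis
    using bt_relators.tie_conj[OF transpose_reflection[OF assms(1,2,4)] transpose_reflection[OF assms(2,3,5)], of v]
    unfolding sym_group_mult sym_group_inv[OF perm] by (intro tcong_relator) simp
qed

definition gword :: "nat list \<Rightarrow> ((nat \<Rightarrow> nat) bt_gen, 'k::field) free_alg" where
  "gword xs = prod_list (map gen_g xs)"

definition tword :: "(nat \<Rightarrow> nat) list \<Rightarrow> ((nat \<Rightarrow> nat) bt_gen, 'k::field) free_alg" where
  "tword rs = prod_list (map bt_e rs)"

lemma gword_simps [simp]: "gword [] = 1" "gword (i # xs) = gen_g i * gword xs" "gword (xs @ ys) = gword xs * gword ys"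
  by (simp_all add: gword_def)

lemma tword_simps [simp]: "tword [] = 1" "tword (r # rs) = bt_e r * tword rs" "tword (rs @ rs') = tword rs * tword rs'"
  by (simp_all add: tword_def)

lemma gword_closed: "set xs \<subseteq> {1..<n + 1} \<Longrightarrow> gword xs \<in> carrier (type_A_algebra n)"
proof (induction xs)
  case (Cons i xs)
  have i: "i \<in> {1..<n + 1}" and xs: "set xs \<subseteq> {1..<n + 1}" using Cons.prems by simp_all
  show ?case unfolding gword_simps by (intro free_algebra_closed gen_g_closed i Cons.IH xs)
qed simp

lemma tword_closed: "set rs \<subseteq> type_A_reflections n \<Longrightarrow> tword rs \<in> carrier (type_A_algebra n)"
proof (induction rs)
  case (Cons r rs)
  have r: "r \<in> type_A_reflections n" and rs: "set rs \<subseteq> type_A_reflections n" using Cons.prems by simp_all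
  show ?case unfolding tword_simps by (intro free_algebra_closed gen_e_closed r Cons.IH rs)
qed simp

lemma gword_tie:
  assumes "set xs \<subseteq> {1..<n + 1}" "r \<in> type_A_reflections n"
  shows "\<exists>r' \<in> type_A_reflections n. tcong n v (gword xs * bt_e r) (bt_e r' * gword xs)"
  using assms(1)
proof (induction xs)
  case Nil
  then show ?case using assms(2) by (intro bexI[of _ r]) simp_all
next
  case (Cons i xs)
  then obtain r' where r': "r' \<in> type_A_reflections n" "tcong n v (gword xs * bt_e r) (bt_e r' * gword xs)"
    by auto
  have i: "i \<in> {1..<n + 1}" and xs: "set xs \<subseteq> {1..<n + 1}" using Cons.prems by auto
  have "tcong n v (gen_g i * (gword xs * bt_e r)) (gen_g i * (bt_e r' * gword xs))"
    by (rule tcong_lmult[OF r'(2) gen_g_closed[OF i]])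
  also have "tcong n v (gen_g i * (bt_e r' * gword xs)) (bt_e (adj i \<circ> r' \<circ> adj i) * gen_g i * gword xs)"
    unfolding mult.assoc[symmetric] by (rule tcong_rmult[OF tcong_braid_tie[OF i r'(1)] gword_closed[OF xs]])
  finally show ?case
    using reflection_conj_adj[OF i r'(1)] by (intro bexI[of _ "adj i \<circ> r' \<circ> adj i"]) (simp_all only: gword_simps mult.assoc)
qed

lemma gword_far:
  assumes "set xs \<subseteq> {1..<n + 1}" "i \<in> {1..<n + 1}" "\<And>l. l \<in> set xs \<Longrightarrow> Suc i < l \<or> Suc l < i"
  shows "tcong n v (gword xs * gen_g i) (gen_g i * gword xs)"
  using assms(1,3)
proof (induction xs)
  case (Cons l xs)
  have l: "l \<in> {1..<n + 1}" and xs: "set xs \<subseteq> {1..<n + 1}" using Cons.prems by auto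
  have "tcong n v (gen_g l * (gword xs * gen_g i)) (gen_g l * (gen_g i * gword xs))"
    using Cons xs by (intro tcong_lmult gen_g_closed l) simp
  also have "tcong n v (gen_g l * (gen_g i * gword xs)) (gen_g i * gen_g l * gword xs)"
    unfolding mult.assoc[symmetric]
    by (intro tcong_rmult tcong_far gword_closed xs l assms(2)) (use Cons.prems(2)[of l] in auto)
  finally show ?case by (simp only: gword_simps mult.assoc)
qed simp

text \<open>
  Reduced words of the symmetric group on \<open>k\<close> points: a word for \<open>k - 1\<close> points followed by a descending
  run \<open>k - 1, k - 2, \<dots>, j\<close>, which represents the coset of the smaller group and is empty for \<open>j = k\<close>.
\<close>

fun normal_words :: "nat \<Rightarrow> nat list set" where
  "normal_words 0 = {[]}"
| "normal_words (Suc k) = (\<lambda>(b, j). b @ rev [j..<Suc k]) ` (normal_words k \<times> {1..Suc k})"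

lemma finite_normal_words: "finite (normal_words k)"
  by (induction k) auto

lemma card_normal_words: "card (normal_words k) \<le> fact k"
proof (induction k)
  case (Suc k)
  have "card (normal_words (Suc k)) \<le> card (normal_words k \<times> {1..Suc k})"
    unfolding normal_words.simps by (rule card_image_le) (simp add: finite_normal_words)
  also have "\<dots> = card (normal_words k) * Suc k" by (simp add: card_cartesian_product)
  also have "\<dots> \<le> fact k * Suc k" using Suc.IH by (intro mult_le_mono1) simp
  finally show ?case by (simp add: mult.commute)
qed simp

lemma set_normal_words: "b \<in> normal_words k \<Longrightarrow> set b \<subseteq> {1..<k}"
  by (induction k arbitrary: b) fastforce+

lemma nil_in_normal_words: "[] \<in> normal_words k"
  by (induction k) force+

text \<open>
  The ideal is included in the span, so that membership is invariant under congruence.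
\<close>

definition normal_span :: "nat \<Rightarrow> 'k::field \<Rightarrow> nat \<Rightarrow> ((nat \<Rightarrow> nat) bt_gen, 'k) free_alg set" where
  "normal_span n v k = fa.span (type_A_ideal n v \<union>
     {tword rs * gword b | rs b. set rs \<subseteq> type_A_reflections n \<and> b \<in> normal_words k})"

lemma span_map_mem:
  assumes add: "\<And>p p'. T (p + p') = T p + T p'" and scale: "\<And>c p. T (free_scalar c * p) = free_scalar c * T p"
    and gens: "\<And>h. h \<in> H \<Longrightarrow> T h \<in> fa.span H'" and p: "p \<in> fa.span H"
  shows "T p \<in> fa.span (H' :: ('x, 'k::field) free_alg set)"
proof -
  have "T 0 = 0" using add[of 0 0] by simp
  then have "fa.subspace {p. T p \<in> fa.span H'}"
    by (intro fa.subspaceI) (simp_all add: add scale fa.span_zero fa.span_add fa.span_scale)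
  then have "fa.span H \<subseteq> {p. T p \<in> fa.span H'}" using gens by (intro fa.span_minimal) auto
  then show ?thesis using p by blast
qed

lemma normal_span_ideal: "x \<in> type_A_ideal n v \<Longrightarrow> x \<in> normal_span n v k"
  unfolding normal_span_def by (intro fa.span_base) simp

lemma normal_span_base:
  "set rs \<subseteq> type_A_reflections n \<Longrightarrow> b \<in> normal_words k \<Longrightarrow> tword rs * gword b \<in> normal_span n v k"
  unfolding normal_span_def by (intro fa.span_base) blast

lemma normal_span_add: "x \<in> normal_span n v k \<Longrightarrow> y \<in> normal_span n v k \<Longrightarrow> x + y \<in> normal_span n v k"
  unfolding normal_span_def by (rule fa.span_add)

lemma normal_span_scale: "x \<in> normal_span n v k \<Longrightarrow> free_scalar c * x \<in> normal_span n v k"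
  unfolding normal_span_def by (rule fa.span_scale)

lemma normal_span_tcong:
  assumes "tcong n v x y" "y \<in> normal_span n v k"
  shows "x \<in> normal_span n v k"
  using normal_span_add[OF normal_span_ideal assms(2), of "x - y"] assms(1) by (simp add: tcong_def)

lemma normal_span_rmult:
  assumes c: "c \<in> carrier (type_A_algebra n)"
    and gens: "\<And>rs b. set rs \<subseteq> type_A_reflections n \<Longrightarrow> b \<in> normal_words k \<Longrightarrow>
      tword rs * gword b * c \<in> normal_span n v k'"
    and p: "p \<in> normal_span n v k"
  shows "p * c \<in> normal_span n v k'"
  unfolding normal_span_def
proof (rule span_map_mem[where T = "\<lambda>p. p * c", OF _ _ _ p[unfolded normal_span_def]])
  fix h assume "h \<in> type_A_ideal n v \<union> {tword rs * gword b | rs b. set rs \<subseteq> type_A_reflections n \<and> b \<in> normal_words k}"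
  then have "h * c \<in> normal_span n v k'"
    using gens normal_span_ideal ideal_rmult[OF c] by blast
  then show "h * c \<in> fa.span (type_A_ideal n v \<union> {tword rs * gword b | rs b. set rs \<subseteq> type_A_reflections n \<and> b \<in> normal_words k'})"
    unfolding normal_span_def .
qed (simp_all add: distrib_right mult.assoc)

lemma normal_span_tail:
  assumes "p \<in> normal_span n v k" "j \<in> {1..Suc k}" "k < n + 1"
  shows "p * gword (rev [j..<Suc k]) \<in> normal_span n v (Suc k)"
proof (rule normal_span_rmult[OF _ _ assms(1)])
  show "gword (rev [j..<Suc k]) \<in> carrier (type_A_algebra n)"
    using assms(2,3) by (intro gword_closed) auto
  fix rs b assume rs: "set rs \<subseteq> type_A_reflections n" and b: "b \<in> normal_words k"
  have "b @ rev [j..<Suc k] \<in> normal_words (Suc k)"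
    unfolding normal_words.simps using b assms(2) by (intro image_eqI[where x = "(b, j)"]) simp_all
  then show "tword rs * gword b * gword (rev [j..<Suc k]) \<in> normal_span n v (Suc k)"
    unfolding mult.assoc gword_simps(3)[symmetric] by (rule normal_span_base[OF rs])
qed

text \<open>
  Commute \<open>g\<^sub>i\<close> past the letters below \<open>i - 1\<close>, apply the braid relation, and commute \<open>g\<^sub>i\<^sub>-\<^sub>1\<close> past the letters
  above \<open>i\<close>.
\<close>

lemma tail_shift:
  assumes "1 \<le> j" "j < i" "i \<le> k" "k < n + 1"
  shows "tcong n v (gword (rev [j..<Suc k]) * gen_g i) (gen_g (i - 1) * gword (rev [j..<Suc k]))"
proof -
  obtain m where m: "i = Suc m" using assms(2) by (cases i) auto
  let ?A = "gword (rev [Suc i..<Suc k])" and ?B = "gword (rev [j..<m])"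
  have "[j..<Suc k] = [j..<m] @ [m..<Suc k]"
    using upt_add_eq_append[of j m "Suc k - m"] assms m by simp
  moreover have "[m..<Suc k] = m # i # [Suc i..<Suc k]"
    using assms m by (simp only: upt_conv_Cons less_Suc_eq_le Suc_le_lessD less_imp_le_nat)
  ultimately have "rev [j..<Suc k] = rev [Suc i..<Suc k] @ [i, m] @ rev [j..<m]" by simp
  then have split: "gword (rev [j..<Suc k]) = ?A * gen_g i * gen_g m * ?B"
    by (simp only: gword_simps mult.assoc mult_1_right)
  have im: "i \<in> {1..<n + 1}" "m \<in> {1..<n + 1}" using assms m by auto
  have A: "set (rev [Suc i..<Suc k]) \<subseteq> {1..<n + 1}" and B: "set (rev [j..<m]) \<subseteq> {1..<n + 1}"
    using assms m by auto
  note closed = gword_closed[OF A] gword_closed[OF B] gen_g_closed[OF im(1)] gen_g_closed[OF im(2)]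
  have "tcong n v (?A * gen_g i * gen_g m * (?B * gen_g i)) (?A * gen_g i * gen_g m * (gen_g i * ?B))"
    by (intro tcong_lmult gword_far B im free_algebra_closed closed) (use m in auto)
  also have "tcong n v (?A * gen_g i * gen_g m * (gen_g i * ?B)) (?A * (gen_g m * gen_g i * gen_g m) * ?B)"
  proof -
    have "tcong n v (gen_g i * gen_g m * gen_g i) (gen_g m * gen_g i * gen_g m)"
      using tcong_sym[OF tcong_braid[of m n v]] im unfolding m by simp
    then have "tcong n v (?A * (gen_g i * gen_g m * gen_g i) * ?B) (?A * (gen_g m * gen_g i * gen_g m) * ?B)"
      by (intro tcong_rmult tcong_lmult closed)
    then show ?thesis by (simp only: mult.assoc)
  qed
  also have "tcong n v (?A * (gen_g m * gen_g i * gen_g m) * ?B) (gen_g m * ?A * (gen_g i * gen_g m * ?B))"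
  proof -
    have "tcong n v (?A * gen_g m) (gen_g m * ?A)"
      by (rule gword_far[OF A im(2)]) (use m in auto)
    then have "tcong n v (?A * gen_g m * (gen_g i * gen_g m * ?B)) (gen_g m * ?A * (gen_g i * gen_g m * ?B))"
      by (intro tcong_rmult free_algebra_closed closed)
    then show ?thesis by (simp only: mult.assoc)
  qed
  finally show ?thesis unfolding split using m by (simp only: mult.assoc diff_Suc_1)
qed

text \<open>
  Multiply a normal word with final run \<open>k, \<dots>, j\<close> by \<open>g\<^sub>i\<close>. If \<open>i < j - 1\<close> or \<open>i > j\<close>, then \<open>g\<^sub>i\<close> passes
  through the run, with its index lowered by one in the second case, and the induction hypothesis
  applies to the part for fewer points. If \<open>i = j - 1\<close>, the run becomes longer. If \<open>i = j\<close>, the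
  quadratic relation produces a tie, which moves to the left through the word.
\<close>

lemma normal_span_gen_g:
  "k \<le> n + 1 \<Longrightarrow> i \<in> {1..<k} \<Longrightarrow> p \<in> normal_span n v k \<Longrightarrow> p * gen_g i \<in> normal_span n v k"
proof (induction k arbitrary: i p)
  case (Suc k)
  have kn: "k < n + 1" and i: "i \<in> {1..<n + 1}" using Suc.prems by auto
  show ?case
  proof (rule normal_span_rmult[OF gen_g_closed[OF i] _ Suc.prems(3)])
    fix rs c assume rs: "set rs \<subseteq> type_A_reflections n" and c: "c \<in> normal_words (Suc k)"
    obtain b j where b: "b \<in> normal_words k" and j: "j \<in> {1..Suc k}" and c: "c = b @ rev [j..<Suc k]"
      using c by auto
    let ?x = "tword rs * gword b :: ((nat \<Rightarrow> nat) bt_gen, 'a) free_alg"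
    let ?t = "\<lambda>j. gword (rev [j..<Suc k]) :: ((nat \<Rightarrow> nat) bt_gen, 'a) free_alg"
    have bset: "set b \<subseteq> {1..<n + 1}" using set_normal_words[OF b] kn by auto
    have x: "?x \<in> normal_span n v k" by (rule normal_span_base[OF rs b])
    have xc: "?x \<in> carrier (type_A_algebra n)"
      by (intro free_algebra_closed tword_closed[OF rs] gword_closed[OF bset])
    have tset: "set (rev [j..<Suc k]) \<subseteq> {1..<n + 1}" if "1 \<le> j" for j using that kn by auto
    have eq: "tword rs * gword c * gen_g i = ?x * (?t j * gen_g i)"
      unfolding c by (simp only: gword_simps mult.assoc)
    have swap: "?x * (?t j * gen_g i) \<in> normal_span n v (Suc k)"
      if h: "tcong n v (?t j * gen_g i) (gen_g l * ?t j)" and l: "l \<in> {1..<k}" for l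
    proof -
      have "?x * gen_g l * ?t j \<in> normal_span n v (Suc k)"
        by (intro normal_span_tail j kn Suc.IH x l) (use kn in simp)
      moreover have "tcong n v (?x * (?t j * gen_g i)) (?x * gen_g l * ?t j)"
        using tcong_lmult[OF h xc] by (simp only: mult.assoc)
      ultimately show ?thesis by (rule normal_span_tcong[rotated])
    qed
    consider "Suc i < j" | "j = Suc i" | "j = i" | "j < i" by linarith
    then show "tword rs * gword c * gen_g i \<in> normal_span n v (Suc k)"
      unfolding eq
    proof cases
      case 1
      have "tcong n v (?t j * gen_g i) (gen_g i * ?t j)"
        by (rule gword_far[OF tset i]) (use 1 j in auto)
      then show "?x * (?t j * gen_g i) \<in> normal_span n v (Suc k)"
        by (rule swap) (use 1 j Suc.prems in auto)
    next
      case 2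
      have "[i..<Suc k] = i # [j..<Suc k]" using 2 Suc.prems by (simp add: upt_conv_Cons)
      then have "?t i = ?t j * gen_g i" by simp
      then show "?x * (?t j * gen_g i) \<in> normal_span n v (Suc k)"
        using normal_span_tail[OF x _ kn, of i] Suc.prems by simp
    next
      case 3
      let ?t' = "?t (Suc i)"
      have t'set: "set (rev [Suc i..<Suc k]) \<subseteq> {1..<n + 1}" using kn by auto
      have "[i..<Suc k] = i # [Suc i..<Suc k]" using Suc.prems by (simp add: upt_conv_Cons)
      then have t: "?t j = ?t' * gen_g i" unfolding 3 by simp
      have t'c: "?t' \<in> carrier (type_A_algebra n)" by (rule gword_closed[OF t'set])
      obtain r where r: "r \<in> type_A_reflections n"
        and mv: "tcong n v (gword (b @ rev [Suc i..<Suc k]) * bt_e (adj i)) (bt_e r * gword (b @ rev [Suc i..<Suc k]))"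
        using gword_tie[of "b @ rev [Suc i..<Suc k]" n "adj i" v] bset t'set adj_reflection[OF i] by auto
      let ?y = "tword (rs @ [r]) * gword b :: ((nat \<Rightarrow> nat) bt_gen, 'a) free_alg"
      have y: "?y \<in> normal_span n v k" using rs r by (intro normal_span_base b) auto
      let ?c = "free_scalar (v\<^sup>2 - 1)"
      have "tcong n v (?x * ?t' * (gen_g i * gen_g i)) (?x * ?t' * (1 + ?c * bt_e (adj i) * (1 + gen_g i)))"
        by (intro tcong_lmult tcong_quadratic i free_algebra_closed xc t'c)
      moreover have "?x * ?t' * (1 + ?c * bt_e (adj i) * (1 + gen_g i)) \<in> normal_span n v (Suc k)"
      proof -
        have "?x * ?t' * (1 + ?c * bt_e (adj i) * (1 + gen_g i)) =
            ?x * ?t' + ?x * ?t' * ?c * bt_e (adj i) * (1 + gen_g i)"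
          by (simp only: distrib_left mult_1_right mult.assoc)
        also have "?x * ?t' * ?c = ?c * (?x * ?t')" by (rule free_scalar_commute)
        finally have split: "?x * ?t' * (1 + ?c * bt_e (adj i) * (1 + gen_g i)) =
            ?x * ?t' + ?c * (?x * ?t' * bt_e (adj i) * (1 + gen_g i))"
          by (simp only: mult.assoc)
        have eq: "?y * ?t' * (1 + gen_g i) = ?y * ?t' + ?y * ?t i"
          using t unfolding 3 by (simp add: distrib_left mult.assoc)
        have "tcong n v (tword rs * (gword (b @ rev [Suc i..<Suc k]) * bt_e (adj i)) * (1 + gen_g i))
            (tword rs * (bt_e r * gword (b @ rev [Suc i..<Suc k])) * (1 + gen_g i))"
          by (intro tcong_rmult tcong_lmult mv tword_closed[OF rs] free_algebra_closed gen_g_closed i)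
        then have "tcong n v (?x * ?t' * bt_e (adj i) * (1 + gen_g i)) (?y * ?t' + ?y * ?t i)"
          unfolding eq[symmetric]
          by (simp only: gword_simps tword_simps mult.assoc mult_1_right)
        moreover have "?y * ?t' + ?y * ?t i \<in> normal_span n v (Suc k)"
          by (intro normal_span_add normal_span_tail y kn) (use Suc.prems in auto)
        ultimately have "?x * ?t' * bt_e (adj i) * (1 + gen_g i) \<in> normal_span n v (Suc k)"
          by (rule normal_span_tcong)
        then show ?thesis
          unfolding split by (intro normal_span_add normal_span_scale normal_span_tail x kn) (use Suc.prems in auto)
      qed
      ultimately have "?x * ?t' * (gen_g i * gen_g i) \<in> normal_span n v (Suc k)" by (rule normal_span_tcong)
      then show "?x * (?t j * gen_g i) \<in> normal_span n v (Suc k)" unfolding t by (simp only: mult.assoc)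
    next
      case 4
      have "tcong n v (?t j * gen_g i) (gen_g (i - 1) * ?t j)"
        by (rule tail_shift) (use 4 j kn Suc.prems in auto)
      then show "?x * (?t j * gen_g i) \<in> normal_span n v (Suc k)"
        by (rule swap) (use 4 j Suc.prems in auto)
    qed
  qed
qed simp

lemma normal_span_gen_e:
  assumes r: "r \<in> type_A_reflections n" and p: "p \<in> normal_span n v (n + 1)"
  shows "p * bt_e r \<in> normal_span n v (n + 1)"
proof (rule normal_span_rmult[OF gen_e_closed[OF r] _ p])
  fix rs b assume rs: "set rs \<subseteq> type_A_reflections n" and b: "b \<in> normal_words (n + 1)"
  obtain r' where r': "r' \<in> type_A_reflections n" "tcong n v (gword b * bt_e r) (bt_e r' * gword b)"
    using gword_tie[OF set_normal_words[OF b] r] by blast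
  have "tcong n v (tword rs * gword b * bt_e r) (tword (rs @ [r']) * gword b)"
    using tcong_lmult[OF r'(2) tword_closed[OF rs]] by (simp add: mult.assoc)
  then show "tword rs * gword b * bt_e r \<in> normal_span n v (n + 1)"
    by (rule normal_span_tcong) (use rs r' b in \<open>intro normal_span_base; auto\<close>)
qed

lemma single_word: "Poly_Mapping.single (Word (xs @ [x])) c = Poly_Mapping.single (Word xs) c * free_gen x"
  by (simp add: free_gen_def mult_single plus_free_word_def)

lemma free_poly_sum_singles:
  "(p :: ('x, 'k::field) free_alg) = (\<Sum>u \<in> Poly_Mapping.keys p. Poly_Mapping.single u (Poly_Mapping.lookup p u))"
  by (rule poly_mapping_eqI)
    (simp add: lookup_sum lookup_single when_def in_keys_iff sum.delta')

text \<open>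
  The span contains the scalars and is stable under right multiplication by all generators.
\<close>

lemma carrier_in_normal_span:
  assumes "p \<in> carrier (type_A_algebra n)"
  shows "p \<in> normal_span n v (n + 1)"
proof -
  have word: "Poly_Mapping.single (Word xs) c \<in> normal_span n v (n + 1)"
    if "xs \<in> lists (bt_gens (sym_group (n + 1)) (simple_transpositions n))" for xs c
    using that
  proof (induction xs rule: rev_induct)
    case Nil
    have "free_scalar c * (tword [] * gword []) \<in> normal_span n v (n + 1)"
      by (intro normal_span_scale normal_span_base nil_in_normal_words) simp
    then show ?case by (simp add: free_scalar_def zero_free_word_def)
  next
    case (snoc x xs)
    then have IH: "Poly_Mapping.single (Word xs) c \<in> normal_span n v (n + 1)"
      and x: "x \<in> bt_gens (sym_group (n + 1)) (simple_transpositions n)" by auto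
    consider i where "x = Braid (adj i)" "i \<in> {1..<n + 1}" | r where "x = Tie r" "r \<in> type_A_reflections n"
      using x unfolding bt_gens_def simple_transpositions_eq by blast
    then show ?case
      unfolding single_word
    proof cases
      case 1
      then show "Poly_Mapping.single (Word xs) c * free_gen x \<in> normal_span n v (n + 1)"
        using normal_span_gen_g[OF order_refl _ IH] by blast
    next
      case 2
      then show "Poly_Mapping.single (Word xs) c * free_gen x \<in> normal_span n v (n + 1)"
        using normal_span_gen_e[OF _ IH] by blast
    qed
  qed
  have "(\<Sum>u \<in> Poly_Mapping.keys p. Poly_Mapping.single u (Poly_Mapping.lookup p u)) \<in> normal_span n v (n + 1)"
    unfolding normal_span_def
  proof (rule fa.span_sum)
    fix u assume "u \<in> Poly_Mapping.keys p"
    then obtain xs where "u = Word xs" "xs \<in> lists (bt_gens (sym_group (n + 1)) (simple_transpositions n))"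
      using assms unfolding free_algebra_carrier by blast
    then show "Poly_Mapping.single u (Poly_Mapping.lookup p u) \<in> fa.span (type_A_ideal n v \<union>
        {tword rs * gword b | rs b. set rs \<subseteq> type_A_reflections n \<and> b \<in> normal_words (n + 1)})"
      using word unfolding normal_span_def by blast
  qed
  then show ?thesis using free_poly_sum_singles[of p] by simp
qed

section \<open>Faithfulness of the action\<close>

lemma tword_commute:
  assumes "set rs \<subseteq> type_A_reflections n" "r \<in> type_A_reflections n"
  shows "tcong n v (tword rs * bt_e r) (bt_e r * tword rs)"
  using assms(1)
proof (induction rs)
  case (Cons x rs)
  then have x: "x \<in> type_A_reflections n" and rs: "set rs \<subseteq> type_A_reflections n" by auto
  have "tcong n v (bt_e x * (tword rs * bt_e r)) (bt_e x * (bt_e r * tword rs))"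
    by (rule tcong_lmult[OF Cons.IH[OF rs] gen_e_closed[OF x]])
  also have "tcong n v (bt_e x * (bt_e r * tword rs)) (bt_e r * bt_e x * tword rs)"
    unfolding mult.assoc[symmetric]
    by (rule tcong_rmult[OF tcong_tie_commute[OF x assms(2)] tword_closed[OF rs]])
  finally show ?case by (simp only: tword_simps mult.assoc)
qed simp

lemma tword_commute_tword:
  assumes "set rs \<subseteq> type_A_reflections n" "set rs' \<subseteq> type_A_reflections n"
  shows "tcong n v (tword rs * tword rs') (tword rs' * tword rs)"
  using assms(2)
proof (induction rs')
  case (Cons r rs')
  then have r: "r \<in> type_A_reflections n" and rs': "set rs' \<subseteq> type_A_reflections n" by auto
  have "tcong n v (tword rs * bt_e r * tword rs') (bt_e r * tword rs * tword rs')"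
    by (rule tcong_rmult[OF tword_commute[OF assms(1) r] tword_closed[OF rs']])
  also have "tcong n v (bt_e r * tword rs * tword rs') (bt_e r * (tword rs' * tword rs))"
    unfolding mult.assoc by (rule tcong_lmult[OF Cons.IH[OF rs'] gen_e_closed[OF r]])
  finally show ?case by (simp only: tword_simps mult.assoc)
qed simp

lemma tword_absorb_mem:
  assumes "set rs \<subseteq> type_A_reflections n" "r \<in> set rs"
  shows "tcong n v (tword rs * bt_e r) (tword rs)"
  using assms
proof (induction rs)
  case (Cons x rs)
  then have x: "x \<in> type_A_reflections n" and rs: "set rs \<subseteq> type_A_reflections n" by auto
  show ?case
  proof (cases "r \<in> set rs")
    case True
    show ?thesis
      unfolding tword_simps mult.assoc by (rule tcong_lmult[OF Cons.IH[OF rs True] gen_e_closed[OF x]])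
  next
    case False
    then have rx: "r = x" using Cons.prems by simp
    have "tcong n v (bt_e x * (tword rs * bt_e x)) (bt_e x * (bt_e x * tword rs))"
      by (rule tcong_lmult[OF tword_commute[OF rs x] gen_e_closed[OF x]])
    also have "tcong n v (bt_e x * (bt_e x * tword rs)) (bt_e x * tword rs)"
      unfolding mult.assoc[symmetric] by (rule tcong_rmult[OF tcong_tie_idem[OF x] tword_closed[OF rs]])
    finally show ?thesis unfolding rx by (simp only: tword_simps mult.assoc)
  qed
qed simp

lemma tword_absorb_all:
  assumes x: "x \<in> carrier (type_A_algebra n)" and rs: "set rs \<subseteq> type_A_reflections n"
    and abs: "\<And>r. r \<in> set rs \<Longrightarrow> tcong n v (x * bt_e r) x"
  shows "tcong n v (x * tword rs) x"
  using rs abs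
proof (induction rs)
  case (Cons r rs)
  then have r: "r \<in> type_A_reflections n" and rs: "set rs \<subseteq> type_A_reflections n" by auto
  have "tcong n v (x * bt_e r * tword rs) (x * tword rs)"
    by (rule tcong_rmult[OF _ tword_closed[OF rs]]) (use Cons.prems(2) in simp)
  also have "tcong n v (x * tword rs) x" using Cons by simp
  finally show ?case by (simp only: tword_simps mult.assoc)
qed simp

text \<open>
  The pairs that a product of ties already implies. They form an equivalence relation by the relation
  \<open>e\<^sub>r e\<^sub>t = e\<^sub>r e\<^sub>r\<^sub>t\<^sub>r\<close> for reflections \<open>r\<close> and \<open>t\<close>.
\<close>

definition tied_pairs :: "nat \<Rightarrow> 'k::field \<Rightarrow> ((nat \<Rightarrow> nat) bt_gen, 'k) free_alg \<Rightarrow> (nat \<times> nat) set" where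
  "tied_pairs n v x = {(a, b). a \<in> {1..n + 1} \<and> b \<in> {1..n + 1} \<and>
     (a = b \<or> tcong n v (x * bt_e (transpose a b)) x)}"

lemma equiv_tied_pairs:
  assumes x: "x \<in> carrier (type_A_algebra n)"
  shows "equiv {1..n + 1} (tied_pairs n v x)"
proof (rule equivI)
  show "tied_pairs n v x \<subseteq> {1..n + 1} \<times> {1..n + 1}" unfolding tied_pairs_def by blast
  show "refl_on {1..n + 1} (tied_pairs n v x)" unfolding tied_pairs_def refl_on_def by blast
  show "sym (tied_pairs n v x)" unfolding tied_pairs_def sym_def by (auto simp: transpose_commute)
  show "trans (tied_pairs n v x)"
  proof (rule transI)
    fix a b c assume ab: "(a, b) \<in> tied_pairs n v x" and bc: "(b, c) \<in> tied_pairs n v x"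
    then have N: "a \<in> {1..n + 1}" "b \<in> {1..n + 1}" "c \<in> {1..n + 1}" unfolding tied_pairs_def by blast+
    show "(a, c) \<in> tied_pairs n v x"
    proof (cases "a = b \<or> b = c \<or> a = c")
      case True
      then show ?thesis using ab bc N unfolding tied_pairs_def by blast
    next
      case False
      let ?ab = "bt_e (transpose a b)" and ?bc = "bt_e (transpose b c)" and ?ac = "bt_e (transpose a c)"
      have e: "tcong n v (x * ?ab) x" "tcong n v (x * ?bc) x"
        using ab bc False unfolding tied_pairs_def by blast+
      have cl: "?bc \<in> carrier (type_A_algebra n)" "?ac \<in> carrier (type_A_algebra n)"
        by (intro gen_e_closed transpose_reflection[OF N(2,3)], use False in blast)
          (intro gen_e_closed transpose_reflection[OF N(1,3)], use False in blast)
      have "tcong n v (x * ?ac) (x * ?ab * ?ac)"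
        by (rule tcong_rmult[OF tcong_sym[OF e(1)] cl(2)])
      also have "tcong n v (x * ?ab * ?ac) (x * ?ab * ?bc)"
        unfolding mult.assoc
        by (rule tcong_lmult[OF tcong_sym[OF tcong_tie_conj[OF N]] x]) (use False in blast)+
      also have "tcong n v (x * ?ab * ?bc) (x * ?bc)"
        by (rule tcong_rmult[OF e(1) cl(1)])
      also have "tcong n v (x * ?bc) x" by (rule e(2))
      finally show ?thesis unfolding tied_pairs_def using N by blast
    qed
  qed
qed

text \<open>
  The order of the ties is immaterial because they commute.
\<close>

definition tie_list :: "(nat \<times> nat) set \<Rightarrow> (nat \<Rightarrow> nat) list" where
  "tie_list P = (SOME rs. set rs = {transpose a b | a b. (a, b) \<in> P \<and> a \<noteq> b})"

lemma set_tie_list: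
  assumes "equiv {1..n + 1} P"
  shows "set (tie_list P) = {transpose a b | a b. (a, b) \<in> P \<and> a \<noteq> b}"
proof -
  have "finite P" by (rule finite_subset[of _ "{1..n + 1} \<times> {1..n + 1}"]) (use assms in \<open>auto simp: equiv_def\<close>)
  moreover have "{transpose a b | a b. (a, b) \<in> P \<and> a \<noteq> b} \<subseteq> (\<lambda>(a, b). transpose a b) ` P" by force
  ultimately have "finite {transpose a b | a b. (a, b) \<in> P \<and> a \<noteq> b}" by (meson finite_imageI finite_subset)
  then show ?thesis unfolding tie_list_def by (rule someI_ex[OF finite_list])
qed

lemma tie_list_reflections:
  assumes "equiv {1..n + 1} P"
  shows "set (tie_list P) \<subseteq> type_A_reflections n"
proof
  fix r assume "r \<in> set (tie_list P)"
  then obtain a b where "r = transpose a b" "(a, b) \<in> P" "a \<noteq> b" unfolding set_tie_list[OF assms] by blast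
  moreover have "a \<in> {1..n + 1}" "b \<in> {1..n + 1}" using calculation(2) assms by (auto simp: equiv_def)
  ultimately show "r \<in> type_A_reflections n" using transpose_reflection by blast
qed

text \<open>
  A product of ties absorbs every tie that it implies, and conversely the product of all implied ties
  absorbs the original ones.
\<close>

lemma tword_normal_form:
  assumes rs: "set rs \<subseteq> type_A_reflections n"
  shows "\<exists>P. equiv {1..n + 1} P \<and> tcong n v (tword rs) (tword (tie_list P))"
proof (intro exI conjI)
  let ?P = "tied_pairs n v (tword rs)"
  show P: "equiv {1..n + 1} ?P" by (rule equiv_tied_pairs[OF tword_closed[OF rs]])
  let ?L = "tie_list ?P"
  have L: "set ?L \<subseteq> type_A_reflections n" by (rule tie_list_reflections[OF P])
  have "tcong n v (tword rs) (tword rs * tword ?L)"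
  proof (rule tcong_sym[OF tword_absorb_all[OF tword_closed[OF rs] L]])
    fix r assume "r \<in> set ?L"
    then obtain a b where "r = transpose a b" "(a, b) \<in> ?P" "a \<noteq> b" unfolding set_tie_list[OF P] by blast
    then show "tcong n v (tword rs * bt_e r) (tword rs)" unfolding tied_pairs_def by blast
  qed
  also have "tcong n v (tword rs * tword ?L) (tword ?L * tword rs)"
    by (rule tword_commute_tword[OF rs L])
  also have "tcong n v (tword ?L * tword rs) (tword ?L)"
  proof (rule tword_absorb_all[OF tword_closed[OF L] rs])
    fix r assume r: "r \<in> set rs"
    then obtain a b where ab: "r = transpose a b" "a \<in> {1..n + 1}" "b \<in> {1..n + 1}" "a \<noteq> b"
      using rs reflection_cases by blast
    have "(a, b) \<in> ?P"
      unfolding tied_pairs_def using tword_absorb_mem[OF rs r] ab by blast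
    then have "r \<in> set ?L" unfolding set_tie_list[OF P] using ab by blast
    then show "tcong n v (tword ?L * bt_e r) (tword ?L)" by (rule tword_absorb_mem[OF L])
  qed
  finally show "tcong n v (tword rs) (tword ?L)" .
qed

definition normal_elements :: "nat \<Rightarrow> ((nat \<Rightarrow> nat) bt_gen, 'k::field) free_alg set" where
  "normal_elements n = (\<lambda>(P, b). tword (tie_list P) * gword b) ` ({P. equiv {1..n + 1} P} \<times> normal_words (n + 1))"

lemma finite_normal_elements: "finite (normal_elements n)"
  unfolding normal_elements_def by (intro finite_imageI finite_cartesian_product finite_eqrels finite_normal_words)

lemma card_normal_elements: "card (normal_elements n) \<le> card {P. equiv {1..n + 1} P} * fact (n + 1)"
proof -
  have "card (normal_elements n) \<le> card ({P. equiv {1..n + 1} P} \<times> normal_words (n + 1))"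
    unfolding normal_elements_def
    by (intro card_image_le finite_cartesian_product finite_eqrels finite_normal_words)
  also have "\<dots> = card {P. equiv {1..n + 1} P} * card (normal_words (n + 1))" by (rule card_cartesian_product)
  also have "\<dots> \<le> card {P. equiv {1..n + 1} P} * fact (n + 1)"
    by (rule mult_le_mono2[OF card_normal_words])
  finally show ?thesis .
qed

lemma carrier_spanned:
  assumes "p \<in> carrier (type_A_algebra n)"
  obtains x y where "p = x + y" "x \<in> type_A_ideal n v" "y \<in> fa.span (normal_elements n)"
proof -
  let ?H = "type_A_ideal n v \<union> normal_elements n"
  have "normal_span n v (n + 1) \<subseteq> fa.span ?H"
    unfolding normal_span_def
  proof (rule fa.span_minimal[OF _ fa.subspace_span], rule Un_least)
    show "type_A_ideal n v \<subseteq> fa.span ?H" using fa.span_superset[of ?H] by blast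
    show "{tword rs * gword b | rs b. set rs \<subseteq> type_A_reflections n \<and> b \<in> normal_words (n + 1)} \<subseteq> fa.span ?H"
    proof
      fix h :: "((nat \<Rightarrow> nat) bt_gen, 'a) free_alg"
      assume "h \<in> {tword rs * gword b | rs b. set rs \<subseteq> type_A_reflections n \<and> b \<in> normal_words (n + 1)}"
      then obtain rs b where h: "h = tword rs * gword b" and rs: "set rs \<subseteq> type_A_reflections n"
        and b: "b \<in> normal_words (n + 1)" by blast
      obtain P where P: "equiv {1..n + 1} P" "tcong n v (tword rs) (tword (tie_list P))"
        using tword_normal_form[OF rs] by blast
      let ?h = "tword (tie_list P) * gword b"
      have "h - ?h \<in> type_A_ideal n v"
        using tcong_rmult[OF P(2) gword_closed[OF set_normal_words[OF b]]] unfolding h tcong_def .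
      moreover have "?h \<in> normal_elements n" unfolding normal_elements_def using P b by force
      ultimately have "h - ?h + ?h \<in> fa.span ?H" by (intro fa.span_add fa.span_base) auto
      then show "h \<in> fa.span ?H" by simp
    qed
  qed
  then have "p \<in> fa.span ?H" using carrier_in_normal_span[OF assms, of v] by blast
  then obtain x y where "p = x + y" "x \<in> fa.span (type_A_ideal n v)" "y \<in> fa.span (normal_elements n)"
    unfolding fa.span_Un by blast
  moreover have "fa.subspace (type_A_ideal n v)"
    by (rule fa.subspaceI) (assumption | rule ideal_zero ideal_add ideal_scale)+
  then have "fa.span (type_A_ideal n v) = type_A_ideal n v" by (simp add: fa.span_eq_iff)
  ultimately show ?thesis using that by blast
qed

definition act_on_words :: "nat \<Rightarrow> 'k::field \<Rightarrow> ((nat \<Rightarrow> nat) bt_gen, 'k) free_alg \<Rightarrow> 'k coloured_words" where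
  "act_on_words n v p = alg_act (v\<^sup>2) p (word_vec (n + 1) id)"

lemma act_on_words_add: "act_on_words n v (p + p') = act_on_words n v p + act_on_words n v p'"
  by (simp add: act_on_words_def alg_act_plus)

lemma act_on_words_scale: "act_on_words n v (free_scalar c * p) = fscale c (act_on_words n v p)"
  by (simp add: act_on_words_def alg_act_mult alg_act_scalar)

lemma act_on_words_ideal: "p \<in> type_A_ideal n v \<Longrightarrow> act_on_words n v p = 0"
  by (simp add: act_on_words_def alg_act_ideal)

definition point_vec :: "'i \<Rightarrow> 'i \<Rightarrow> 'k::field" where
  "point_vec x = (\<lambda>y. if y = x then 1 else 0)"

text \<open>
  The braids turn \<open>\<xi>\<close> into the sum of \<open>(A, w)\<close> over all \<open>A\<close>. For each pair of positions, the tie or one minus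
  the tie then keeps the colourings that agree with the given \<open>A\<close> on that pair of letters.
\<close>

lemma point_vec_in_image:
  assumes A: "equiv {1..n + 1} A" and w: "w permutes {1..n + 1}"
  shows "point_vec (A, w) \<in> act_on_words n v ` carrier (type_A_algebra n)"
proof -
  let ?V = "act_on_words n v ` carrier (type_A_algebra n)" and ?N = "n + 1"
  have sub: "fvs.subspace ?V"
  proof (rule fvs.subspaceI)
    show "0 \<in> ?V" by (rule image_eqI[of _ _ 0]) (simp_all add: act_on_words_def alg_act_zero)
    show "f + g \<in> ?V" if "f \<in> ?V" "g \<in> ?V" for f g
      using that by (auto simp: act_on_words_add[symmetric])
    show "fscale c f \<in> ?V" if "f \<in> ?V" for c f
      using that by (auto simp: act_on_words_scale[symmetric])
  qed
  have braid: "braid_act (v\<^sup>2) (adj i) f \<in> ?V" if i: "i \<in> {1..<?N}" and f: "f \<in> ?V" for i f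
  proof -
    obtain p where p: "p \<in> carrier (type_A_algebra n)" "f = act_on_words n v p" using f by blast
    then have "braid_act (v\<^sup>2) (adj i) f = act_on_words n v (gen_g i * p)"
      by (simp add: act_on_words_def alg_act_mult)
    then show ?thesis using p(1) gen_g_closed[OF i] by blast
  qed
  have tie: "tie_act r f \<in> ?V" if r: "r \<in> type_A_reflections n" and f: "f \<in> ?V" for r f
  proof -
    obtain p where p: "p \<in> carrier (type_A_algebra n)" "f = act_on_words n v p" using f by blast
    then have "tie_act r f = act_on_words n v (bt_e r * p)"
      by (simp add: act_on_words_def alg_act_mult)
    then show ?thesis using p(1) gen_e_closed[OF r] by blast
  qed
  have "braid_stable ?N (v\<^sup>2) ?V" unfolding braid_stable_def using sub braid by blast
  moreover have "word_vec ?N id \<in> ?V"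
    by (rule image_eqI[of _ _ 1]) (simp_all add: act_on_words_def alg_act_one)
  ultimately have wv: "word_vec ?N w \<in> ?V" by (rule braid_stable_word_vec[OF _ _ w])
  (* B and u agree with the target (A, w) on the pairs of positions in T. *)
  define ok where "ok T B u \<longleftrightarrow> (\<forall>(a, b) \<in> T. B `` {u a} = B `` {u b} \<longleftrightarrow> A `` {w a} = A `` {w b})"
    for T :: "(nat \<times> nat) set" and B :: "(nat \<times> nat) set" and u :: "nat \<Rightarrow> nat"
  define cut where "cut T = (\<lambda>(B, u). if ok T B u then word_vec ?N w (B, u) else (0 :: 'a))" for T
  have "cut T \<in> ?V" if "finite T" "T \<subseteq> {1..?N} \<times> {1..?N}" for T
    using that
  proof (induction T rule: finite_induct)
    case empty
    have "cut {} = word_vec ?N w" unfolding cut_def ok_def by auto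
    then show ?case using wv by simp
  next
    case (insert x T)
    obtain a b where x: "x = (a, b)" by (cases x)
    have IH: "cut T \<in> ?V" using insert by simp
    have ok_insert: "ok (insert x T) B u \<longleftrightarrow> (B `` {u a} = B `` {u b} \<longleftrightarrow> A `` {w a} = A `` {w b}) \<and> ok T B u" for B u
      unfolding ok_def x by simp
    show ?case
    proof (cases "a = b")
      case True
      then have "cut (insert x T) = cut T" unfolding cut_def ok_insert by simp
      then show ?thesis using IH by simp
    next
      case False
      have r: "transpose a b \<in> type_A_reflections n"
        using insert.prems False unfolding x by (intro transpose_reflection) auto
      show ?thesis
      proof (cases "A `` {w a} = A `` {w b}")
        case True
        have "cut (insert x T) = tie_act (transpose a b) (cut T)"
        proof
          fix y show "cut (insert x T) y = tie_act (transpose a b) (cut T) y"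
            by (cases y) (auto simp only: tie_act_apply tie_transpose_iff cut_def prod.case ok_insert True simp_thms split: if_split)
        qed
        then show ?thesis using tie[OF r IH] by simp
      next
        case False
        have "cut (insert x T) = cut T - tie_act (transpose a b) (cut T)"
        proof
          fix y show "cut (insert x T) y = (cut T - tie_act (transpose a b) (cut T)) y"
            by (cases y) (auto simp only: tie_act_apply tie_transpose_iff cut_def prod.case ok_insert False
              simp_thms minus_apply diff_zero diff_self split: if_split)
        qed
        then show ?thesis using fvs.subspace_diff[OF sub IH tie[OF r IH]] by (simp only:)
      qed
    qed
  qed
  then have "cut ({1..?N} \<times> {1..?N}) \<in> ?V" by simp
  moreover have "cut ({1..?N} \<times> {1..?N}) = point_vec (A, w)"
  proof
    fix y :: "(nat \<times> nat) set \<times> (nat \<Rightarrow> nat)"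
    obtain B u where y: "y = (B, u)" by (cases y)
    have AB: "B = A" if B: "equiv {1..?N} B" and u: "u = w" and ok: "ok ({1..?N} \<times> {1..?N}) B u"
    proof -
      have iff: "(x, y) \<in> B \<longleftrightarrow> (x, y) \<in> A" if xy: "x \<in> {1..?N}" "y \<in> {1..?N}" for x y
      proof -
        have inv: "inv' w x \<in> {1..?N}" "inv' w y \<in> {1..?N}"
          using xy permutes_in_image[OF permutes_inv[OF w]] by blast+
        then have "B `` {w (inv' w x)} = B `` {w (inv' w y)} \<longleftrightarrow> A `` {w (inv' w x)} = A `` {w (inv' w y)}"
          using ok unfolding ok_def u by blast
        then have "B `` {x} = B `` {y} \<longleftrightarrow> A `` {x} = A `` {y}" unfolding permutes_inverses(1)[OF w] .
        then show ?thesis using tied_iff_related[OF B permutes_id xy(1), of y] tied_iff_related[OF A permutes_id xy(1), of y] by simp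
      qed
      have "B \<subseteq> {1..?N} \<times> {1..?N}" "A \<subseteq> {1..?N} \<times> {1..?N}" using A B by (auto simp: equiv_def)
      then show ?thesis using iff by blast
    qed
    have "ok ({1..?N} \<times> {1..?N}) A w" unfolding ok_def by simp
    then have eq: "equiv {1..?N} B \<and> u = w \<and> ok ({1..?N} \<times> {1..?N}) B u \<longleftrightarrow> (B, u) = (A, w)"
      using A AB by blast
    have "cut ({1..?N} \<times> {1..?N}) y =
        (if equiv {1..?N} B \<and> u = w \<and> ok ({1..?N} \<times> {1..?N}) B u then 1 else 0)"
      unfolding y cut_def prod.case word_vec_apply by (simp only: split: if_split) blast
    then show "cut ({1..?N} \<times> {1..?N}) y = point_vec (A, w) y"
      unfolding eq point_vec_def y .
  qed
  ultimately show ?thesis by simp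
qed

text \<open>
  There are at most as many normal elements as pairs \<open>(A, w)\<close>, and their images span a space that contains
  the indicator functions of all these pairs. So the images of the normal elements are independent
  and pairwise different, and the normal elements span the algebra modulo the ideal.
\<close>

theorem act_on_words_injective:
  assumes p: "p \<in> carrier (type_A_algebra n)" and zero: "act_on_words n v p = 0"
  shows "p \<in> type_A_ideal n v"
proof -
  let ?\<Phi> = "act_on_words n v" and ?H = "normal_elements n :: ((nat \<Rightarrow> nat) bt_gen, 'a) free_alg set"
  let ?Y = "{A. equiv {1..n + 1} A} \<times> {w. w permutes {1..n + 1}}"
  have finY: "finite ?Y" by (intro finite_cartesian_product finite_eqrels finite_permutations) simp
  have cardY: "card ?Y = card {P. equiv {1..n + 1} P} * fact (n + 1)"
    unfolding card_cartesian_product using card_permutations[of "{1..n + 1}" "n + 1"] by simp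
  have \<Phi>_sum: "?\<Phi> (\<Sum>h \<in> T. free_scalar (c h) * h) = (\<Sum>h \<in> T. fscale (c h) (?\<Phi> h))" for T c
    by (induction T rule: infinite_finite_induct)
      (simp_all add: act_on_words_add act_on_words_scale act_on_words_def[of n v 0] alg_act_zero)
  have \<Phi>_span: "?\<Phi> y \<in> fvs.span (?\<Phi> ` ?H)" if y: "y \<in> fa.span ?H" for y
  proof -
    obtain c where "y = (\<Sum>h \<in> ?H. free_scalar (c h) * h)"
      using y unfolding fa.span_finite[OF finite_normal_elements] by blast
    then have "?\<Phi> y = (\<Sum>h \<in> ?H. fscale (c h) (?\<Phi> h))" by (simp only: \<Phi>_sum)
    then show ?thesis by (simp only:) (intro fvs.span_sum fvs.span_scale fvs.span_base imageI)
  qed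
  have image: "?\<Phi> ` carrier (type_A_algebra n) \<subseteq> fvs.span (?\<Phi> ` ?H)"
  proof
    fix f assume "f \<in> ?\<Phi> ` carrier (type_A_algebra n)"
    then obtain p where p: "p \<in> carrier (type_A_algebra n)" "f = ?\<Phi> p" by blast
    obtain x y where xy: "p = x + y" "x \<in> type_A_ideal n v" "y \<in> fa.span ?H" using carrier_spanned[OF p(1)] .
    have "f = ?\<Phi> y" unfolding p(2) xy(1) act_on_words_add act_on_words_ideal[OF xy(2)] by simp
    then show "f \<in> fvs.span (?\<Phi> ` ?H)" using \<Phi>_span[OF xy(3)] by simp
  qed
  have points: "inj_on (point_vec :: _ \<Rightarrow> 'a coloured_words) ?Y" "fvs.independent ((point_vec :: _ \<Rightarrow> 'a coloured_words) ` ?Y)"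
    by (rule triangular_independent[OF finY, where y = "\<lambda>x. x" and m = "\<lambda>_. 0"]; simp add: point_vec_def)+
  obtain B where B: "B \<subseteq> ?\<Phi> ` ?H" "fvs.independent B" "?\<Phi> ` ?H \<subseteq> fvs.span B"
    using fvs.maximal_independent_subset by blast
  have finH: "finite (?\<Phi> ` ?H)" by (rule finite_imageI[OF finite_normal_elements])
  have finB: "finite B" by (rule finite_subset[OF B(1) finH])
  have "(point_vec :: _ \<Rightarrow> 'a coloured_words) ` ?Y \<subseteq> ?\<Phi> ` carrier (type_A_algebra n)"
    using point_vec_in_image by blast
  also have "\<dots> \<subseteq> fvs.span (?\<Phi> ` ?H)" by (rule image)
  also have "\<dots> \<subseteq> fvs.span B" by (rule fvs.span_minimal[OF B(3) fvs.subspace_span])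
  finally have "card ((point_vec :: _ \<Rightarrow> 'a coloured_words) ` ?Y) \<le> card B"
    using fvs.independent_span_bound[OF finB points(2)] by blast
  then have YB: "card ?Y \<le> card B" unfolding card_image[OF points(1)] .
  have BH: "card B \<le> card (?\<Phi> ` ?H)" by (rule card_mono[OF finH B(1)])
  have HH: "card (?\<Phi> ` ?H) \<le> card ?H" by (rule card_image_le[OF finite_normal_elements])
  have HY: "card ?H \<le> card ?Y" unfolding cardY by (rule card_normal_elements)
  have "B = ?\<Phi> ` ?H" by (rule card_subset_eq[OF finH B(1)]) (use YB BH HH HY in linarith)
  then have ind: "fvs.independent (?\<Phi> ` ?H)" using B(2) by simp
  have inj: "inj_on ?\<Phi> ?H"
    by (rule eq_card_imp_inj_on[OF finite_normal_elements]) (use YB BH HH HY in linarith)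
  obtain x y where xy: "p = x + y" "x \<in> type_A_ideal n v" "y \<in> fa.span ?H" using carrier_spanned[OF p] .
  obtain c where c: "y = (\<Sum>h \<in> ?H. free_scalar (c h) * h)"
    using xy(3) unfolding fa.span_finite[OF finite_normal_elements] by blast
  have "0 = ?\<Phi> y" using zero unfolding xy(1) act_on_words_add act_on_words_ideal[OF xy(2)] by simp
  also have "\<dots> = (\<Sum>h \<in> ?H. fscale (c h) (?\<Phi> h))" unfolding c \<Phi>_sum ..
  also have "\<dots> = (\<Sum>f \<in> ?\<Phi> ` ?H. fscale (c (inv_into ?H ?\<Phi> f)) f)"
    unfolding sum.reindex[OF inj] by (rule sum.cong) (simp_all add: inv_into_f_f[OF inj])
  finally have "(\<Sum>f \<in> ?\<Phi> ` ?H. fscale (c (inv_into ?H ?\<Phi> f)) f) = 0" by simp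
  then have "c (inv_into ?H ?\<Phi> f) = 0" if "f \<in> ?\<Phi> ` ?H" for f
    by (rule fvs.independentD[where u = "\<lambda>f. c (inv_into ?H ?\<Phi> f)", OF ind finH subset_refl _ that])
  note coeff = this
  have "c h = 0" if "h \<in> ?H" for h
    using coeff[OF imageI[OF that]] unfolding inv_into_f_f[OF inj that] .
  then have "y = 0" unfolding c by (intro sum.neutral) (simp add: free_scalar_def)
  then show ?thesis using xy by simp
qed

section \<open>The braid image as a vector space\<close>

abbreviation braid_algebra :: "nat \<Rightarrow> ((nat \<Rightarrow> nat) bt_gen, 'k::field) free_alg ring" where
  "braid_algebra n \<equiv> free_algebra (Braid ` simple_transpositions n)"

lemma braid_algebra_subset: "p \<in> carrier (braid_algebra n) \<Longrightarrow> p \<in> carrier (type_A_algebra n)"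
  unfolding free_algebra_carrier bt_gens_def by (meson Un_upper1 image_mono lists_mono subset_trans)

lemma act_on_words_braid_algebra:
  "act_on_words n v ` carrier (braid_algebra n) = orbit_space (n + 1) (v\<^sup>2)"
proof
  let ?V = "act_on_words n v ` carrier (braid_algebra n)" and ?O = "orbit_space (n + 1) (v\<^sup>2)"
  have sub: "fvs.subspace ?O" and act: "\<And>i f. i \<in> {1..<n + 1} \<Longrightarrow> f \<in> ?O \<Longrightarrow> braid_act (v\<^sup>2) (adj i) f \<in> ?O"
    using braid_stable_orbit_space[of "n + 1" "v\<^sup>2"] unfolding braid_stable_def by blast+
  have word: "foldr (gen_act (v\<^sup>2)) xs (word_vec (n + 1) id) \<in> ?O"
    if "xs \<in> lists (Braid ` simple_transpositions n)" for xs
    using that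
  proof (induction xs)
    case Nil
    show ?case using word_vec_in_orbit_space by (metis foldr_Nil id_apply)
  next
    case (Cons x xs)
    then obtain i where "x = Braid (adj i)" "i \<in> {1..<n + 1}" unfolding simple_transpositions_eq by auto
    then show ?case using Cons act by simp
  qed
  show "?V \<subseteq> ?O"
  proof
    fix f assume "f \<in> ?V"
    then obtain p where p: "p \<in> carrier (braid_algebra n)" "f = act_on_words n v p" by blast
    show "f \<in> ?O"
      unfolding p(2) act_on_words_def alg_act_def
    proof (intro fvs.subspace_sum[OF sub] fvs.subspace_scale[OF sub])
      fix u assume "u \<in> Poly_Mapping.keys p"
      then obtain xs where "u = Word xs" "xs \<in> lists (Braid ` simple_transpositions n)"
        using p(1) unfolding free_algebra_carrier by blast
      then show "word_act (v\<^sup>2) u (word_vec (n + 1) id) \<in> ?O" using word by (simp add: word_act_def)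
    qed
  qed
  show "?O \<subseteq> ?V"
  proof (rule orbit_space_minimal)
    show "word_vec (n + 1) id \<in> ?V"
      by (rule image_eqI[of _ _ 1]) (simp_all add: act_on_words_def alg_act_one)
    show "braid_stable (n + 1) (v\<^sup>2) ?V"
      unfolding braid_stable_def
    proof (intro conjI ballI)
      show "fvs.subspace ?V"
      proof (rule fvs.subspaceI)
        show "0 \<in> ?V" by (rule image_eqI[of _ _ 0]) (simp_all add: act_on_words_def alg_act_zero)
        show "f + g \<in> ?V" if "f \<in> ?V" "g \<in> ?V" for f g
          using that by (auto simp: act_on_words_add[symmetric])
        show "fscale c f \<in> ?V" if "f \<in> ?V" for c f
          using that by (auto simp: act_on_words_scale[symmetric])
      qed
      fix i and f :: "'a coloured_words" assume i: "i \<in> {1..<n + 1}" and f: "f \<in> ?V"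
      then obtain p where p: "p \<in> carrier (braid_algebra n)" "f = act_on_words n v p" by blast
      then have "braid_act (v\<^sup>2) (adj i) f = act_on_words n v (gen_g i * p)"
        by (simp add: act_on_words_def alg_act_mult)
      moreover have "gen_g i * p \<in> carrier (braid_algebra n)"
        using p(1) adj_simple[OF i] by (intro free_algebra_closed free_gen_closed imageI)
      ultimately show "braid_act (v\<^sup>2) (adj i) f \<in> ?V" by (rule image_eqI)
    qed
  qed
qed

text \<open>
  The braid image consists of the classes of the elements of the free algebra on the \<open>g\<^sub>i\<close>. Two of them
  coincide exactly if they agree on \<open>\<xi>\<close>, so preimages of a basis of the orbit space form a basis.
\<close>

theorem braid_image_dimension:
  fixes v :: "'k::field" and n :: nat
  assumes v: "v\<^sup>2 \<noteq> 0" "v\<^sup>2 \<noteq> 1" "v\<^sup>2 \<noteq> - 1"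
  defines "G \<equiv> sym_group (n + 1)" and "S \<equiv> simple_transpositions n"
  shows "ring.finite_dimension (bt_algebra G S v) (bt_scalars G S v) (braid_image G S v) \<and>
    rat_of_nat (ring.dim (bt_algebra G S v) (bt_scalars G S v) (braid_image G S v)) = dimension_formula (n + 1)"
proof -
  let ?F = "type_A_algebra n :: ((nat \<Rightarrow> nat) bt_gen, 'k) free_alg ring" and ?I = "type_A_ideal n v"
  let ?\<Phi> = "act_on_words n v" and ?B = "carrier (braid_algebra n) :: ((nat \<Rightarrow> nat) bt_gen, 'k) free_alg set"
  define E where "E = ?F Quot ?I"
  define h where "h p = ?I +>\<^bsub>?F\<^esub> p" for p
  interpret F: ring ?F by (rule ring_free_algebra)
  interpret I: ideal ?I ?F by (rule ideal_type_A)
  interpret E: ring E unfolding E_def by (rule I.quotient_is_ring)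
  interpret h: ring_hom_ring ?F E h
    unfolding E_def h_def by (rule I.rcos_ring_hom_ring)
  have E_eq: "bt_algebra G S v = E" unfolding bt_algebra_def E_def G_def S_def ..
  have class_eq: "bt_class G S v p = h p" for p unfolding bt_class_def h_def G_def S_def ..
  have h_add: "h (p + p') = h p \<oplus>\<^bsub>E\<^esub> h p'" and h_mult: "h (p * p') = h p \<otimes>\<^bsub>E\<^esub> h p'"
    if "p \<in> carrier ?F" "p' \<in> carrier ?F" for p p'
    using h.hom_add[OF that] h.hom_mult[OF that] by simp_all
  have h_zero_iff: "h p = \<zero>\<^bsub>E\<^esub> \<longleftrightarrow> p \<in> ?I" if "p \<in> carrier ?F" for p
  proof -
    have zero: "\<zero>\<^bsub>E\<^esub> = ?I" unfolding E_def FactRing_def by simp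
    show ?thesis
      unfolding zero h_def using I.a_rcos_const[of p] I.a_rcos_self[OF that] by blast
  qed
  have h_eq: "h p = h p'" if "p \<in> carrier ?F" "p' \<in> carrier ?F" "p - p' \<in> ?I" for p p'
  proof -
    have "h p = h (p - p' + p')" by simp
    also have "\<dots> = h (p - p') \<oplus>\<^bsub>E\<^esub> h p'" using that by (intro h_add) simp_all
    also have "h (p - p') = \<zero>\<^bsub>E\<^esub>" using h_zero_iff[of "p - p'"] that by simp
    finally show ?thesis using h.hom_closed[OF that(2)] by simp
  qed
  have BF: "?B \<subseteq> carrier ?F" using braid_algebra_subset by blast
  define K where "K = range (free_scalar :: 'k \<Rightarrow> ((nat \<Rightarrow> nat) bt_gen, 'k) free_alg)"
  have scalar_mult: "free_scalar a * free_scalar b = (free_scalar (a * b) :: ((nat \<Rightarrow> nat) bt_gen, 'k) free_alg)" for a b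
    by (simp add: free_scalar_def mult_single)
  have scalar_add: "free_scalar a + free_scalar b = (free_scalar (a + b) :: ((nat \<Rightarrow> nat) bt_gen, 'k) free_alg)" for a b
    by (simp add: free_scalar_def single_add)
  have scalar_uminus: "- free_scalar a = (free_scalar (- a) :: ((nat \<Rightarrow> nat) bt_gen, 'k) free_alg)" for a
    by (simp add: free_scalar_def single_uminus)
  have scalar_01: "free_scalar 0 = (0 :: ((nat \<Rightarrow> nat) bt_gen, 'k) free_alg)"
    "free_scalar 1 = (1 :: ((nat \<Rightarrow> nat) bt_gen, 'k) free_alg)"
    by (simp_all add: free_scalar_def)
  have F_minus: "\<ominus>\<^bsub>?F\<^esub> p = - p" if "p \<in> carrier ?F" for p
    using that by (intro F.minus_equality) simp_all
  have K_sub: "subring K ?F"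
  proof (rule F.subringI)
    show "K \<subseteq> carrier ?F" unfolding K_def by (auto intro: free_algebra_closed)
    show "\<one>\<^bsub>?F\<^esub> \<in> K" unfolding K_def using scalar_01 by (metis free_algebra_simps(3) rangeI)
    show "\<ominus>\<^bsub>?F\<^esub> x \<in> K" if "x \<in> K" for x
    proof -
      obtain a where "x = free_scalar a" using \<open>x \<in> K\<close> unfolding K_def by blast
      then show ?thesis unfolding K_def using F_minus[of x] scalar_uminus[of a] by simp
    qed
    show "x \<otimes>\<^bsub>?F\<^esub> y \<in> K" "x \<oplus>\<^bsub>?F\<^esub> y \<in> K" if "x \<in> K" "y \<in> K" for x y
      using that unfolding K_def by (auto simp: scalar_mult scalar_add)
  qed
  have K_field: "subfield K ?F"
  proof (rule F.subfieldI[OF F.subcringI[OF K_sub]])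
    show "x \<otimes>\<^bsub>?F\<^esub> y = y \<otimes>\<^bsub>?F\<^esub> x" if "x \<in> K" "y \<in> K" for x y
      using that unfolding K_def by (auto simp: scalar_mult mult.commute)
    show "Units (?F\<lparr>carrier := K\<rparr>) = K - {\<zero>\<^bsub>?F\<^esub>}"
    proof
      show "Units (?F\<lparr>carrier := K\<rparr>) \<subseteq> K - {\<zero>\<^bsub>?F\<^esub>}"
        by (auto simp: Units_def)
      show "K - {\<zero>\<^bsub>?F\<^esub>} \<subseteq> Units (?F\<lparr>carrier := K\<rparr>)"
      proof
        fix x assume x: "x \<in> K - {\<zero>\<^bsub>?F\<^esub>}"
        then obtain a where a: "x = free_scalar a" unfolding K_def by blast
        have "a \<noteq> 0" using x scalar_01 unfolding a by auto
        then have "free_scalar (inverse a) * x = 1" "x * free_scalar (inverse a) = 1"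
          unfolding a scalar_mult by (simp_all add: scalar_01)
        moreover have "free_scalar (inverse a) \<in> K" unfolding K_def by blast
        ultimately show "x \<in> Units (?F\<lparr>carrier := K\<rparr>)" using x unfolding Units_def by auto
      qed
    qed
  qed
  have one_ne: "\<one>\<^bsub>E\<^esub> \<noteq> \<zero>\<^bsub>E\<^esub>"
  proof
    assume "\<one>\<^bsub>E\<^esub> = \<zero>\<^bsub>E\<^esub>"
    then have "h 1 = \<zero>\<^bsub>E\<^esub>" using h.hom_one by simp
    then have "1 \<in> ?I" using h_zero_iff[of 1] by simp
    then have "word_vec (n + 1) id = (0 :: 'k coloured_words)"
      using act_on_words_ideal[of 1 n v] by (simp add: act_on_words_def alg_act_one)
    moreover have "equiv {1..n + 1} ({1..n + 1} \<times> {1..n + 1})"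
      by (auto simp: equiv_def refl_on_def sym_def trans_def)
    ultimately have "word_vec (n + 1) id ({1..n + 1} \<times> {1..n + 1}, id) = (0 :: 'k)" by simp
    then show False unfolding word_vec_apply using \<open>equiv {1..n + 1} ({1..n + 1} \<times> {1..n + 1})\<close> by simp
  qed
  have scalars: "bt_scalars G S v = h ` K"
    unfolding bt_scalars_def class_eq K_def by (simp add: image_image)
  have hK: "subfield (h ` K) E" by (rule h.img_is_subfield(2)[OF K_field one_ne])
  have KB: "K \<subseteq> ?B" unfolding K_def by (auto intro: free_algebra_closed)
  have image: "braid_image G S v = h ` ?B"
  proof
    have "subring (h ` ?B) E"
    proof (rule E.subringI)
      show "h ` ?B \<subseteq> carrier E" using BF by auto
      show "\<one>\<^bsub>E\<^esub> \<in> h ` ?B" using h.hom_one by (intro image_eqI[of _ _ 1]) simp_all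
      show "\<ominus>\<^bsub>E\<^esub> x \<in> h ` ?B" if "x \<in> h ` ?B" for x
      proof -
        obtain p where p: "p \<in> ?B" "x = h p" using \<open>x \<in> h ` ?B\<close> by blast
        have "\<ominus>\<^bsub>E\<^esub> x = h (- p)"
          using p BF F_minus[of p] h.hom_a_inv[of p] by auto
        then show ?thesis using p(1) by (intro image_eqI[where x = "- p"]) simp_all
      qed
      show "x \<otimes>\<^bsub>E\<^esub> y \<in> h ` ?B" "x \<oplus>\<^bsub>E\<^esub> y \<in> h ` ?B" if xy: "x \<in> h ` ?B" "y \<in> h ` ?B" for x y
      proof -
        obtain p p' where p: "p \<in> ?B" "x = h p" "p' \<in> ?B" "y = h p'" using xy by blast
        then have "p \<in> carrier ?F" "p' \<in> carrier ?F" using BF by blast+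
        then have "x \<otimes>\<^bsub>E\<^esub> y = h (p * p')" "x \<oplus>\<^bsub>E\<^esub> y = h (p + p')" unfolding p(2,4) by (simp_all only: h_mult h_add)
        then show "x \<otimes>\<^bsub>E\<^esub> y \<in> h ` ?B" "x \<oplus>\<^bsub>E\<^esub> y \<in> h ` ?B" using p(1,3) by auto
      qed
    qed
    moreover from this have "subalgebra (h ` K) (h ` ?B) E"
      unfolding subalgebra_def subalgebra_axioms_def subring_def
      using KB BF by (auto simp: h_mult[symmetric] subset_iff intro!: imageI)
    moreover have "(\<lambda>s. bt_class G S v (bt_g s)) ` S \<subseteq> h ` ?B"
      unfolding class_eq by (intro image_subsetI imageI free_gen_closed) (simp only: S_def)
    ultimately show "braid_image G S v \<subseteq> h ` ?B"
      unfolding braid_image_def generated_subalgebra_def E_eq scalars by blast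
    show "h ` ?B \<subseteq> braid_image G S v"
      unfolding braid_image_def generated_subalgebra_def E_eq scalars
    proof (intro subsetI InterI)
      fix x V assume x: "x \<in> h ` ?B"
        and "V \<in> {V. subring V E \<and> subalgebra (h ` K) V E \<and> (\<lambda>s. bt_class G S v (bt_g s)) ` S \<subseteq> V}"
      then have V: "subring V E" "subalgebra (h ` K) V E" and gens: "\<And>s. s \<in> S \<Longrightarrow> h (bt_g s) \<in> V"
        unfolding class_eq by blast+
      have scal: "h (free_scalar c) \<in> V" for c
      proof -
        have "h (free_scalar c) \<in> carrier E" by (intro h.hom_closed) simp
        moreover have "h (free_scalar c) \<otimes>\<^bsub>E\<^esub> \<one>\<^bsub>E\<^esub> \<in> V"
          by (rule subalgebra.smult_closed[OF V(2)]) (auto simp: K_def subringE(3)[OF V(1)])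
        ultimately show ?thesis by simp
      qed
      have word: "h (Poly_Mapping.single (Word xs) c) \<in> V \<and> Poly_Mapping.single (Word xs) c \<in> ?B"
        if "xs \<in> lists (Braid ` S)" for xs c
        using that
      proof (induction xs rule: rev_induct)
        case Nil
        have "(Poly_Mapping.single (Word []) c :: ((nat \<Rightarrow> nat) bt_gen, 'k) free_alg) = free_scalar c"
          by (simp add: free_scalar_def zero_free_word_def)
        then show ?case using scal[of c] by simp
      next
        case (snoc y xs)
        then have IH: "h (Poly_Mapping.single (Word xs) c) \<in> V" "Poly_Mapping.single (Word xs) c \<in> ?B"
          and y: "y \<in> Braid ` S" by auto
        then obtain s where s: "y = Braid s" "s \<in> S" by blast
        have gB: "free_gen y \<in> ?B" using y unfolding S_def by (rule free_gen_closed)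
        have "h (Poly_Mapping.single (Word xs) c * free_gen y) = h (Poly_Mapping.single (Word xs) c) \<otimes>\<^bsub>E\<^esub> h (free_gen y)"
          using IH(2) gB BF by (intro h_mult) auto
        also have "\<dots> \<in> V" using subringE(6)[OF V(1) IH(1)] gens[OF s(2)] s(1) by simp
        finally show ?case unfolding single_word using free_algebra_closed(2)[OF IH(2) gB] by blast
      qed
      obtain p where p: "p \<in> ?B" "x = h p" using x by blast
      have "h (\<Sum>u \<in> T. Poly_Mapping.single u (Poly_Mapping.lookup p u)) \<in> V \<and>
          (\<Sum>u \<in> T. Poly_Mapping.single u (Poly_Mapping.lookup p u)) \<in> ?B"
        if "finite T" "T \<subseteq> Poly_Mapping.keys p" for T
        using that
      proof (induction T rule: finite_induct)
        case empty
        then show ?case using scal[of 0] by (simp add: scalar_01)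
      next
        case (insert u T)
        obtain xs where u: "u = Word xs" "xs \<in> lists (Braid ` S)"
          using insert.prems p(1) unfolding free_algebra_carrier S_def by blast
        note w = word[OF u(2), of "Poly_Mapping.lookup p u", folded u(1)]
        have IH: "h (\<Sum>u \<in> T. Poly_Mapping.single u (Poly_Mapping.lookup p u)) \<in> V"
          "(\<Sum>u \<in> T. Poly_Mapping.single u (Poly_Mapping.lookup p u)) \<in> ?B" using insert by auto
        have "h (Poly_Mapping.single u (Poly_Mapping.lookup p u) + (\<Sum>u \<in> T. Poly_Mapping.single u (Poly_Mapping.lookup p u))) =
            h (Poly_Mapping.single u (Poly_Mapping.lookup p u)) \<oplus>\<^bsub>E\<^esub> h (\<Sum>u \<in> T. Poly_Mapping.single u (Poly_Mapping.lookup p u))"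
          using w IH BF by (intro h_add) auto
        also have "\<dots> \<in> V" using subringE(7)[OF V(1)] w IH by blast
        finally show ?case
          unfolding sum.insert[OF insert.hyps] using free_algebra_closed(1)[OF conjunct2[OF w] IH(2)] by blast
      qed
      from this[of "Poly_Mapping.keys p"] show "x \<in> V"
        unfolding p(2) using free_poly_sum_singles[of p] by simp
    qed
  qed
  obtain B where B: "B \<subseteq> orbit_space (n + 1) (v\<^sup>2)" "finite B" "fvs.independent B"
    "orbit_space (n + 1) (v\<^sup>2) \<subseteq> fvs.span B" "rat_of_nat (card B) = dimension_formula (n + 1)"
    using orbit_space_basis[OF v] by blast
  obtain bs where bs: "set bs = B" "distinct bs" using finite_distinct_list[OF B(2)] by blast
  define lift where "lift f = (SOME p. p \<in> ?B \<and> ?\<Phi> p = f)" for f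
  have lift: "lift f \<in> ?B \<and> ?\<Phi> (lift f) = f" if "f \<in> B" for f
  proof -
    have "f \<in> ?\<Phi> ` ?B" using that B(1) act_on_words_braid_algebra[of n v] by blast
    then obtain p where "p \<in> ?B \<and> ?\<Phi> p = f" by blast
    then show ?thesis unfolding lift_def by (rule someI)
  qed
  define ps where "ps = map lift bs"
  have psB: "set ps \<subseteq> ?B" unfolding ps_def using lift bs(1) by auto
  then have psF: "set ps \<subseteq> carrier ?F" using BF by blast
  have comb: "F.combine (map free_scalar cs) (map lift fs) \<in> ?B \<and>
      ?\<Phi> (F.combine (map free_scalar cs) (map lift fs)) = (\<Sum>i < length fs. fscale (cs ! i) (fs ! i))"
    if "length cs = length fs" "set fs \<subseteq> B" for cs fs
    using that
  proof (induction cs fs rule: list_induct2)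
    case Nil
    show ?case
      unfolding list.map F.combine.simps by (simp add: act_on_words_def alg_act_zero)
  next
    case (Cons c cs f fs)
    then have f: "lift f \<in> ?B" "?\<Phi> (lift f) = f" using lift by simp_all
    have IH: "F.combine (map free_scalar cs) (map lift fs) \<in> ?B"
      "?\<Phi> (F.combine (map free_scalar cs) (map lift fs)) = (\<Sum>i < length fs. fscale (cs ! i) (fs ! i))"
      using Cons by simp_all
    have eq: "F.combine (map free_scalar (c # cs)) (map lift (f # fs)) =
        free_scalar c * lift f + F.combine (map free_scalar cs) (map lift fs)"
      unfolding list.map F.combine.simps free_algebra_simps ..
    show ?case
    proof
      show "F.combine (map free_scalar (c # cs)) (map lift (f # fs)) \<in> ?B"
        unfolding eq by (intro free_algebra_closed f IH)
      show "?\<Phi> (F.combine (map free_scalar (c # cs)) (map lift (f # fs))) =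
          (\<Sum>i < length (f # fs). fscale ((c # cs) ! i) ((f # fs) ! i))"
        unfolding eq act_on_words_add act_on_words_scale f(2) IH(2)
        by (simp add: sum.lessThan_Suc_shift del: sum.lessThan_Suc)
    qed
  qed
  have coeffs: "\<exists>cs. Ks = map h (map free_scalar cs)" if "set Ks \<subseteq> h ` K" for Ks
    using that
  proof (induction Ks)
    case (Cons k Ks)
    then obtain cs c where "Ks = map h (map free_scalar cs)" "k = h (free_scalar c)" unfolding K_def by auto
    then show ?case by (intro exI[of _ "c # cs"]) simp
  qed simp
  have lengths: "length ps = length bs" by (simp add: ps_def)
  have scalF: "set (map free_scalar cs) \<subseteq> carrier ?F" for cs by auto
  have psE: "set (map h ps) \<subseteq> carrier E" using psF by auto
  have combE: "E.combine (map h (map free_scalar cs)) (map h ps) = h (F.combine (map free_scalar cs) ps)" for cs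
    by (rule h.combine_hom[OF scalF psF])
  have lin: "(\<Sum>i < length bs. fscale (c i) (bs ! i)) = (\<Sum>f \<in> B. fscale (c (inv_into {..<length bs} ((!) bs) f)) f)" for c
  proof -
    have bij: "bij_betw ((!) bs) {..<length bs} B" using bij_betw_nth[OF bs(2)] bs(1) by blast
    show ?thesis
      by (subst sum.reindex_bij_betw[OF bij, symmetric])
        (rule sum.cong, simp_all add: inv_into_f_f[OF bij_betw_imp_inj_on[OF bij]])
  qed
  have indep: "E.independent (h ` K) (map h ps)"
  proof (rule E.trivial_combine_imp_independent[OF hK psE])
    fix Ks assume Ks: "set Ks \<subseteq> h ` K" and zero: "E.combine Ks (map h ps) = \<zero>\<^bsub>E\<^esub>"
    (* A coefficient list may be longer or shorter than the list of vectors: cut it off, or extend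
       it by zeros. *)
    let ?Ks = "take (length ps) Ks"
    have "set ?Ks \<subseteq> h ` K" using Ks by (meson set_take_subset subset_trans)
    then obtain cs where cs: "?Ks = map h (map free_scalar cs)" using coeffs by blast
    have len: "length cs \<le> length ps"
      using arg_cong[OF cs, of length] by simp
    define ds where "ds = cs @ replicate (length ps - length cs) 0"
    have dslen: "length ds = length bs" unfolding ds_def using len lengths by simp
    have "map free_scalar ds = map free_scalar cs @ replicate (length ps - length cs) \<zero>\<^bsub>?F\<^esub>"
      unfolding ds_def by (simp add: scalar_01)
    then have "F.combine (map free_scalar ds) ps = F.combine (map free_scalar cs) ps"
      using F.combine_append_replicate[OF psF] by simp
    then have "h (F.combine (map free_scalar ds) ps) = E.combine ?Ks (map h ps)"
      unfolding cs combE by simp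
    also have "\<dots> = \<zero>\<^bsub>E\<^esub>" using zero E.combine_take[of "map h ps" Ks] by simp
    finally have h0: "h (F.combine (map free_scalar ds) ps) = \<zero>\<^bsub>E\<^esub>" .
    have c: "F.combine (map free_scalar ds) ps \<in> ?B"
      "?\<Phi> (F.combine (map free_scalar ds) ps) = (\<Sum>i < length bs. fscale (ds ! i) (bs ! i))"
      unfolding ps_def using comb[OF dslen] bs(1) by simp_all
    have "F.combine (map free_scalar ds) ps \<in> ?I" using h0 h_zero_iff c(1) BF by blast
    then have "(\<Sum>i < length bs. fscale (ds ! i) (bs ! i)) = 0" using act_on_words_ideal c(2) by metis
    then have "(\<Sum>f \<in> B. fscale (ds ! inv_into {..<length bs} ((!) bs) f) f) = 0" unfolding lin .
    then have z: "ds ! inv_into {..<length bs} ((!) bs) f = 0" if "f \<in> B" for f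
      by (rule fvs.independentD[where u = "\<lambda>f. ds ! inv_into {..<length bs} ((!) bs) f",
            OF B(3) B(2) subset_refl _ that])
    have "ds ! i = 0" if "i < length bs" for i
    proof -
      have "inv_into {..<length bs} ((!) bs) (bs ! i) = i"
        using that bs(2) by (intro inv_into_f_f) (auto simp: inj_on_nth)
      then show ?thesis using z that bs(1) by (metis nth_mem)
    qed
    then have "d = 0" if "d \<in> set ds" for d using that dslen by (metis in_set_conv_nth)
    then have cs0: "c = 0" if "c \<in> set cs" for c using that unfolding ds_def by simp
    have "h (free_scalar c) = h 0" if "c \<in> set cs" for c unfolding cs0[OF that] scalar_01 ..
    then have "set (map h (map free_scalar cs)) \<subseteq> {h 0}" unfolding set_map by blast
    moreover have "h 0 = \<zero>\<^bsub>E\<^esub>" using h_zero_iff[of 0] ideal_zero by simp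
    ultimately show "set (take (length (map h ps)) Ks) \<subseteq> {\<zero>\<^bsub>E\<^esub>}" unfolding length_map cs by simp
  qed
  have span: "E.Span (h ` K) (map h ps) = braid_image G S v"
  proof (intro equalityI subsetI)
    fix x assume "x \<in> E.Span (h ` K) (map h ps)"
    then obtain Ks where Ks: "set Ks \<subseteq> h ` K" "length Ks = length (map h ps)" "x = E.combine Ks (map h ps)"
      using E.Span_mem_iff_length_version[OF hK psE] by blast
    obtain cs where cs: "Ks = map h (map free_scalar cs)" using coeffs[OF Ks(1)] by blast
    have "length cs = length bs" using Ks(2) unfolding cs lengths[symmetric] by simp
    then have "F.combine (map free_scalar cs) ps \<in> ?B" unfolding ps_def using comb bs(1) by blast
    then show "x \<in> braid_image G S v" unfolding image Ks(3) cs combE by blast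
  next
    fix x assume "x \<in> braid_image G S v"
    then obtain p where p: "p \<in> ?B" "x = h p" unfolding image by blast
    have "?\<Phi> p \<in> fvs.span B" using p(1) act_on_words_braid_algebra[of n v] B(4) by blast
    then obtain u where u: "?\<Phi> p = (\<Sum>f \<in> B. fscale (u f) f)" unfolding fvs.span_finite[OF B(2)] by blast
    let ?cs = "map u bs"
    let ?c = "F.combine (map free_scalar ?cs) ps"
    have c: "?c \<in> ?B" "?\<Phi> ?c = (\<Sum>i < length bs. fscale (?cs ! i) (bs ! i))"
      unfolding ps_def using comb[of ?cs bs] bs(1) by simp_all
    have "(\<Sum>i < length bs. fscale (?cs ! i) (bs ! i)) = (\<Sum>i < length bs. fscale (u (bs ! i)) (bs ! i))"
      by (rule sum.cong) simp_all
    also have "\<dots> = (\<Sum>f \<in> B. fscale (u f) f)"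
      using bij_betw_nth[OF bs(2)] bs(1) by (intro sum.reindex_bij_betw[where g = "\<lambda>f. fscale (u f) f"]) blast
    finally have "(\<Sum>i < length bs. fscale (?cs ! i) (bs ! i)) = (\<Sum>f \<in> B. fscale (u f) f)" .
    then have "?\<Phi> (p - ?c) = 0"
      using c(2) u act_on_words_add[of n v "p - ?c" ?c] by simp
    then have "p - ?c \<in> ?I" using p(1) c(1) BF by (intro act_on_words_injective free_algebra_closed) auto
    then have "x = h ?c" unfolding p(2) using p(1) c(1) BF by (intro h_eq) auto
    then have "x = E.combine (map h (map free_scalar ?cs)) (map h ps)" unfolding combE .
    moreover have "set (map h (map free_scalar ?cs)) \<subseteq> h ` K" unfolding K_def by auto
    moreover have "length (map h (map free_scalar ?cs)) = length (map h ps)" using lengths by simp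
    ultimately show "x \<in> E.Span (h ` K) (map h ps)"
      using E.Span_mem_iff_length_version[OF hK psE] by blast
  qed
  have dim: "E.dimension (length (map h ps)) (h ` K) (braid_image G S v)"
    by (rule E.dimensionI[OF hK indep span])
  have "card B = length (map h ps)" using distinct_card[OF bs(2)] bs(1) lengths by simp
  then show ?thesis
    using E.finite_dimensionI[OF dim] E.dimI[OF hK dim] B(5) unfolding E_eq scalars over_def by simp
qed

section \<open>Coxeter length, blocks and parabolic subgroups\<close>

lemma foldr_comp: "foldr (\<circ>) xs v = foldr (\<circ>) xs id \<circ> v"
  by (induction xs) (simp_all only: foldr.simps o_apply comp_assoc id_comp id_apply)

text \<open>
  Every factor changes the number of inversions by at most one, and sorting uses exactly one factor per
  inversion.
\<close>

lemma coxeter_length_eq_inversions: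
  assumes w: "w permutes {1..n + 1}"
  shows "coxeter_length (sym_group (n + 1)) (simple_transpositions n) w = card (inversions (n + 1) w)"
  unfolding coxeter_length_def sym_group_mult sym_group_one simple_transpositions_eq
proof (rule Least_equality)
  show "\<exists>xs. length xs = card (inversions (n + 1) w) \<and> set xs \<subseteq> adj ` {1..<n + 1} \<and> foldr (\<circ>) xs id = w"
    using w
  proof (induction rule: perm_adj_induct)
    case id
    have "inversions (n + 1) id = {}" by (auto simp: inversions_def)
    show ?case unfolding \<open>inversions (n + 1) id = {}\<close> by (intro exI[of _ "[]"]) simp
  next
    case (ascent w i)
    then obtain xs where xs: "length xs = card (inversions (n + 1) w)" "set xs \<subseteq> adj ` {1..<n + 1}"
      "foldr (\<circ>) xs id = w" by blast
    have "foldr (\<circ>) (xs @ [adj i]) id = w \<circ> adj i"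
      unfolding foldr_append using foldr_comp[of xs "adj i"] xs(3) by simp
    moreover have "length (xs @ [adj i]) = card (inversions (n + 1) (w \<circ> adj i))"
      using card_inversions_adj[OF ascent.hyps(2,3)] xs(1) by simp
    moreover have "set (xs @ [adj i]) \<subseteq> adj ` {1..<n + 1}"
      using xs(2) ascent.hyps(2) by simp
    ultimately show ?case by blast
  qed
next
  fix k assume "\<exists>xs. length xs = k \<and> set xs \<subseteq> adj ` {1..<n + 1} \<and> foldr (\<circ>) xs id = w"
  then obtain xs where xs: "length xs = k" "set xs \<subseteq> adj ` {1..<n + 1}" "foldr (\<circ>) xs id = w" by blast
  have "card (inversions (n + 1) (foldr (\<circ>) xs id)) \<le> length xs"
    using xs(2)
  proof (induction xs rule: rev_induct)
    case Nil
    have "inversions (n + 1) id = {}" by (auto simp: inversions_def)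
    show ?case unfolding foldr.simps id_apply[of id] \<open>inversions (n + 1) id = {}\<close> by simp
  next
    case (snoc s xs)
    then obtain i where s: "s = adj i" and i: "i \<in> {1..<n + 1}" by auto
    let ?u = "foldr (\<circ>) xs id"
    have fold: "foldr (\<circ>) (xs @ [s]) id = ?u \<circ> adj i"
      unfolding foldr_append using foldr_comp[of xs s] s by simp
    have "card (inversions (n + 1) (?u \<circ> adj i)) \<le> Suc (card (inversions (n + 1) ?u))"
      using card_inversions_comp_adj_le[OF i, of "?u \<circ> adj i"] unfolding comp_adj_adj .
    moreover have "card (inversions (n + 1) ?u) \<le> length xs"
      by (rule snoc.IH) (use snoc.prems in simp)
    ultimately show ?case unfolding fold length_append list.size by linarith
  qed
  then show "card (inversions (n + 1) w) \<le> k" using xs by simp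
qed

lemma coxeter_descent_iff:
  assumes w: "w permutes {1..n + 1}" and i: "i \<in> {1..<n + 1}"
  shows "coxeter_length (sym_group (n + 1)) (simple_transpositions n) (w \<otimes>\<^bsub>sym_group (n + 1)\<^esub> adj i) <
      coxeter_length (sym_group (n + 1)) (simple_transpositions n) w \<longleftrightarrow> w (Suc i) < w i"
proof -
  have ws: "w \<circ> adj i permutes {1..n + 1}" by (rule permutes_compose[OF adj_permutes[OF i] w])
  have "w i \<noteq> w (Suc i)" using permutes_inj[OF w] by (metis injD n_not_Suc_n)
  then consider "w i < w (Suc i)" | "w (Suc i) < w i" by linarith
  then show ?thesis
    unfolding sym_group_mult coxeter_length_eq_inversions[OF w] coxeter_length_eq_inversions[OF ws]
    using card_inversions_adj[OF i, of w] card_inversions_adj_desc[OF i, of w] by cases simp_all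
qed

text \<open>
  The orbit relation of the parabolic subgroup \<open>W\<^sub>I\<close>: \<open>a\<close> and \<open>b\<close> are related if \<open>I\<close> contains all adjacent
  transpositions between them.
\<close>

definition run_rel :: "nat \<Rightarrow> (nat \<Rightarrow> nat) set \<Rightarrow> (nat \<times> nat) set" where
  "run_rel N I = {(a, b). a \<in> {1..N} \<and> b \<in> {1..N} \<and>
     (\<forall>k. a \<le> k \<and> k < b \<or> b \<le> k \<and> k < a \<longrightarrow> adj k \<in> I)}"

lemma equiv_run_rel: "equiv {1..N} (run_rel N I)"
proof (rule equivI)
  show "run_rel N I \<subseteq> {1..N} \<times> {1..N}" by (auto simp: run_rel_def)
  show "refl_on {1..N} (run_rel N I)" by (auto simp: refl_on_def run_rel_def)
  show "sym (run_rel N I)" unfolding sym_def run_rel_def by blast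
  show "trans (run_rel N I)"
  proof (rule transI)
    fix a b c assume ab: "(a, b) \<in> run_rel N I" and bc: "(b, c) \<in> run_rel N I"
    have "adj k \<in> I" if "a \<le> k \<and> k < c \<or> c \<le> k \<and> k < a" for k
    proof (cases "a \<le> k \<and> k < b \<or> b \<le> k \<and> k < a")
      case True
      then show ?thesis using ab unfolding run_rel_def by blast
    next
      case False
      then have "b \<le> k \<and> k < c \<or> c \<le> k \<and> k < b" using that by linarith
      then show ?thesis using bc unfolding run_rel_def by blast
    qed
    then show "(a, c) \<in> run_rel N I" using ab bc unfolding run_rel_def by blast
  qed
qed

lemma adj_inj: "adj i = adj j \<longleftrightarrow> i = j"
proof
  assume eq: "adj i = adj j"
  show "i = j"
  proof (rule ccontr)
    assume "i \<noteq> j"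
    moreover have "adj i i = adj j i" "adj i j = adj j j" using eq by simp_all
    ultimately show False by (auto simp: transpose_def split: if_splits)
  qed
qed simp

lemma block_reachable_iff:
  assumes I: "I \<subseteq> simple_transpositions n" and i: "adj i \<in> I"
  shows "(adj i, t) \<in> (dynkin_edges (sym_group (n + 1)) (simple_transpositions n) \<inter> I \<times> I)\<^sup>* \<longleftrightarrow>
    (\<exists>j. t = adj j \<and> (\<forall>k. i \<le> k \<and> k \<le> j \<or> j \<le> k \<and> k \<le> i \<longrightarrow> adj k \<in> I))"
    (is "_ \<in> ?R\<^sup>* \<longleftrightarrow> _")
proof
  have range: "k \<in> {1..<n + 1}" if "adj k \<in> I" for k
    using I that unfolding simple_transpositions_eq by (auto simp: adj_inj)
  have edge: "(adj a, adj b) \<in> ?R \<longleftrightarrow> adj a \<in> I \<and> adj b \<in> I \<and> (b = Suc a \<or> a = Suc b)" for a b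
  proof (cases "adj a \<in> I \<and> adj b \<in> I")
    case True
    then show ?thesis
      unfolding dynkin_edges_def using ord_adj_adj[OF range range, of a b] I by (auto simp: adj_inj)
  qed blast
  {
    assume "(adj i, t) \<in> ?R\<^sup>*"
    then show "\<exists>j. t = adj j \<and> (\<forall>k. i \<le> k \<and> k \<le> j \<or> j \<le> k \<and> k \<le> i \<longrightarrow> adj k \<in> I)"
    proof (induction rule: rtrancl_induct)
      case base
      then show ?case using i by (intro exI[of _ i]) (auto dest: antisym)
    next
      case (step y z)
      then obtain j where j: "y = adj j" "\<forall>k. i \<le> k \<and> k \<le> j \<or> j \<le> k \<and> k \<le> i \<longrightarrow> adj k \<in> I" by blast
      have "z \<in> I" using step.hyps(2) by blast
      then obtain j' where j': "z = adj j'" using I unfolding simple_transpositions_eq by blast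
      have e: "adj j' \<in> I" "j' = Suc j \<or> j = Suc j'" using step.hyps(2) unfolding j(1) j' edge by blast+
      have "adj k \<in> I" if "i \<le> k \<and> k \<le> j' \<or> j' \<le> k \<and> k \<le> i" for k
      proof (cases "k = j'")
        case False
        then have "i \<le> k \<and> k \<le> j \<or> j \<le> k \<and> k \<le> i" using that e(2) by linarith
        then show ?thesis using j(2) by blast
      qed (use e in simp)
      then show ?case using j' by blast
    qed
  }
  assume "\<exists>j. t = adj j \<and> (\<forall>k. i \<le> k \<and> k \<le> j \<or> j \<le> k \<and> k \<le> i \<longrightarrow> adj k \<in> I)"
  then obtain j where j: "t = adj j" "\<And>k. i \<le> k \<and> k \<le> j \<or> j \<le> k \<and> k \<le> i \<Longrightarrow> adj k \<in> I" by blast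
  have edges: "(adj (a + d), adj (a + Suc d)) \<in> ?R" "(adj (a + Suc d), adj (a + d)) \<in> ?R"
    if "\<And>k. a \<le> k \<Longrightarrow> k \<le> a + Suc d \<Longrightarrow> adj k \<in> I" for a d
    unfolding edge using that[of "a + d"] that[of "a + Suc d"] by simp_all
  have up: "(adj a, adj (a + d)) \<in> ?R\<^sup>*" if "\<And>k. a \<le> k \<Longrightarrow> k \<le> a + d \<Longrightarrow> adj k \<in> I" for a d
    using that
  proof (induction d)
    case (Suc d)
    have "(adj a, adj (a + d)) \<in> ?R\<^sup>*" by (rule Suc.IH) (rule Suc.prems; simp)
    then show ?case by (rule rtrancl_into_rtrancl[OF _ edges(1)[OF Suc.prems]])
  qed simp
  have down: "(adj (a + d), adj a) \<in> ?R\<^sup>*" if "\<And>k. a \<le> k \<Longrightarrow> k \<le> a + d \<Longrightarrow> adj k \<in> I" for a d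
    using that
  proof (induction d)
    case (Suc d)
    have "(adj (a + d), adj a) \<in> ?R\<^sup>*" by (rule Suc.IH) (rule Suc.prems; simp)
    moreover have "(adj (a + Suc d), adj (a + d)) \<in> ?R" by (rule edges(2)) (rule Suc.prems)
    ultimately show ?case by (meson r_into_rtrancl rtrancl_trans)
  qed simp
  show "(adj i, t) \<in> ?R\<^sup>*"
  proof (cases "i \<le> j")
    case True
    then obtain d where d: "j = i + d" by (metis le_iff_add)
    show ?thesis unfolding j(1) d by (rule up) (use j(2) d in blast)
  next
    case False
    then obtain d where d: "i = j + d" by (metis le_iff_add nat_le_linear)
    show ?thesis unfolding j(1) d by (rule down) (use j(2) d in blast)
  qed
qed

text \<open>
  The blocks of \<open>I\<close> correspond to the classes of \<open>run_rel\<close> with at least two elements: the block of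
  \<open>(i i+1)\<close> consists of the adjacent transpositions inside the class of \<open>i\<close>. On an interval, having no
  descent means being increasing.
\<close>

lemma block_descents_iff:
  assumes I: "I \<subseteq> simple_transpositions n" and w: "w permutes {1..n + 1}"
  shows "(\<forall>B \<in> blocks (sym_group (n + 1)) (simple_transpositions n) I. \<exists>s \<in> B.
      coxeter_length (sym_group (n + 1)) (simple_transpositions n) (w \<otimes>\<^bsub>sym_group (n + 1)\<^esub> s) <
      coxeter_length (sym_group (n + 1)) (simple_transpositions n) w) \<longleftrightarrow>
    (\<forall>c \<in> {1..n + 1} // run_rel (n + 1) I. 2 \<le> card c \<longrightarrow> \<not> strict_mono_on c w)"
    (is "?L \<longleftrightarrow> ?R")
proof -
  let ?N = "n + 1" and ?P = "run_rel (n + 1) I"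
  let ?E = "(dynkin_edges (sym_group (n + 1)) (simple_transpositions n) \<inter> I \<times> I)\<^sup>*"
  note P = equiv_run_rel[of ?N I]
  have range: "k \<in> {1..<?N}" if "adj k \<in> I" for k
    using I that unfolding simple_transpositions_eq by (auto simp: adj_inj)
  show ?thesis
  proof
    assume L: ?L
    show ?R
    proof (intro ballI impI notI)
      fix c assume c: "c \<in> {1..?N} // ?P" "2 \<le> card c" and mono: "strict_mono_on c w"
      obtain a b where "a \<in> c" "b \<in> c" "a \<noteq> b"
        using c(2) by (rule two_elements)
      then obtain a b where ab: "a \<in> c" "b \<in> c" "a < b" by (metis linorder_neqE_nat)
      then have rel: "(a, b) \<in> ?P" using quotient_eq_iff[OF P c(1) c(1)] by simp
      then have aI: "adj a \<in> I" using ab(3) unfolding run_rel_def by blast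
      then have "?E `` {adj a} \<in> blocks (sym_group (n + 1)) (simple_transpositions n) I"
        unfolding blocks_def by (rule quotientI)
      with L obtain s where s: "s \<in> ?E `` {adj a}"
        and less: "coxeter_length (sym_group (n + 1)) (simple_transpositions n) (w \<otimes>\<^bsub>sym_group (n + 1)\<^esub> s) <
          coxeter_length (sym_group (n + 1)) (simple_transpositions n) w" by blast
      from s obtain j where j: "s = adj j" "\<forall>k. a \<le> k \<and> k \<le> j \<or> j \<le> k \<and> k \<le> a \<longrightarrow> adj k \<in> I"
        using block_reachable_iff[OF I aI] by blast
      then have jI: "adj j \<in> I" by (metis nat_le_linear order_refl)
      have desc: "w (Suc j) < w j"
        using less unfolding j(1) coxeter_descent_iff[OF w range[OF jI]] .
      have "a \<in> {1..?N}" using rel unfolding run_rel_def by blast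
      moreover have "j \<in> {1..?N}" "Suc j \<in> {1..?N}" using range[OF jI] by auto
      ultimately have "(a, j) \<in> ?P" "(a, Suc j) \<in> ?P"
        unfolding run_rel_def using j(2) by auto
      then have "j \<in> c" "Suc j \<in> c" using in_quotient_imp_closed[OF P c(1) ab(1)] by blast+
      then show False using mono desc unfolding strict_mono_on_def by (metis lessI order_less_asym)
    qed
  next
    assume R: ?R
    show ?L
    proof
      fix B assume "B \<in> blocks (sym_group (n + 1)) (simple_transpositions n) I"
      then obtain s where s: "s \<in> I" "B = ?E `` {s}" unfolding blocks_def by (auto simp: quotient_def)
      then obtain i where i: "s = adj i" using I unfolding simple_transpositions_eq by blast
      have iI: "adj i \<in> I" using s i by simp
      let ?c = "?P `` {i}"
      have iN: "i \<in> {1..?N}" "Suc i \<in> {1..?N}" using range[OF iI] by auto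
      have c: "?c \<in> {1..?N} // ?P" using iN by (intro quotientI)
      have "(i, Suc i) \<in> ?P" unfolding run_rel_def using iN iI by (auto dest: antisym simp: less_Suc_eq_le)
      then have "{i, Suc i} \<subseteq> ?c" using equiv_class_self[OF P iN(1)] by simp
      then have "card {i, Suc i} \<le> card ?c" by (rule card_mono[OF finite_class[OF P c]])
      then have "\<not> strict_mono_on ?c w" using R c by simp
      moreover have "strict_mono_on ?c w" if asc: "\<And>k. k \<in> ?c \<Longrightarrow> Suc k \<in> ?c \<Longrightarrow> w k < w (Suc k)"
      proof (rule strict_mono_onI)
        have conv: "k \<in> ?c" if "x \<in> ?c" "y \<in> ?c" "x \<le> k" "k \<le> y" for x y k
        proof -
          have "(x, y) \<in> ?P" using that(1,2) quotient_eq_iff[OF P c c] by simp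
          then have "(x, k) \<in> ?P" using that(3,4) unfolding run_rel_def by auto
          then show ?thesis using in_quotient_imp_closed[OF P c that(1)] by blast
        qed
        fix x y assume xy: "x \<in> ?c" "y \<in> ?c" "x < y"
        have "w x < w (Suc (x + d))" if "Suc (x + d) \<le> y" for d
          using that
        proof (induction d)
          case 0
          then show ?case using asc[of x] conv[OF xy(1,2)] xy by simp
        next
          case (Suc d)
          then have "w x < w (Suc (x + d))" by simp
          also have "\<dots> < w (Suc (Suc (x + d)))"
            using Suc.prems by (intro asc conv[OF xy(1,2)]) auto
          finally show ?case by simp
        qed
        then show "w x < w y" using xy(3) by (metis less_iff_Suc_add order_refl)
      qed
      ultimately obtain k where k: "k \<in> ?c" "Suc k \<in> ?c" "\<not> w k < w (Suc k)" by blast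
      have "(k, Suc k) \<in> ?P" using k quotient_eq_iff[OF P c c] by simp
      then have kI: "adj k \<in> I" unfolding run_rel_def by blast
      have "adj l \<in> I" if "i \<le> l \<and> l \<le> k \<or> k \<le> l \<and> l \<le> i" for l
      proof (cases "l = k \<or> l = i")
        case False
        then show ?thesis using that k(1) unfolding run_rel_def by auto
      qed (use kI iI in blast)
      then have "adj k \<in> B" unfolding s(2) i using block_reachable_iff[OF I iI] by blast
      moreover have "w (Suc k) < w k"
        using k(3) permutes_inj[OF w] by (metis injD linorder_neqE_nat n_not_Suc_n)
      ultimately show "\<exists>s \<in> B. coxeter_length (sym_group (n + 1)) (simple_transpositions n) (w \<otimes>\<^bsub>sym_group (n + 1)\<^esub> s) <
          coxeter_length (sym_group (n + 1)) (simple_transpositions n) w"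
        using coxeter_descent_iff[OF w range[OF kI]] by blast
    qed
  qed
qed

lemma block_descent_count_eq:
  assumes I: "I \<subseteq> simple_transpositions n"
  shows "rat_of_nat (block_descent_count (sym_group (n + 1)) (simple_transpositions n) I) =
    fact (n + 1) * rel_weight (n + 1) (run_rel (n + 1) I)"
proof -
  have "{w \<in> carrier (sym_group (n + 1)). \<forall>B \<in> blocks (sym_group (n + 1)) (simple_transpositions n) I. \<exists>s \<in> B.
      coxeter_length (sym_group (n + 1)) (simple_transpositions n) (w \<otimes>\<^bsub>sym_group (n + 1)\<^esub> s) <
      coxeter_length (sym_group (n + 1)) (simple_transpositions n) w} =
    {w. w permutes {1..n + 1} \<and> (\<forall>c \<in> {1..n + 1} // run_rel (n + 1) I. 2 \<le> card c \<longrightarrow> \<not> strict_mono_on c w)}"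
    unfolding sym_group_carrier by (intro Collect_cong conj_cong refl block_descents_iff[OF I])
  then show ?thesis
    unfolding block_descent_count_def using card_nowhere_increasing_classes[OF equiv_run_rel] by simp
qed

text \<open>
  Parametrising conjugates of parabolic subgroups by equivalence relations makes the conjugacy classes
  comparable with the sum over equivalence relations.
\<close>

definition young_subgroup :: "nat \<Rightarrow> (nat \<times> nat) set \<Rightarrow> (nat \<Rightarrow> nat) set" where
  "young_subgroup N P = generate (sym_group N) {transpose a b | a b. (a, b) \<in> P \<and> a \<noteq> b}"

lemma young_subgroup_run_rel:
  assumes I: "I \<subseteq> simple_transpositions n"
  shows "young_subgroup (n + 1) (run_rel (n + 1) I) = generate (sym_group (n + 1)) I"
proof -
  let ?G = "sym_group (n + 1)" and ?T = "{transpose a b | a b. (a, b) \<in> run_rel (n + 1) I \<and> a \<noteq> b}"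
  interpret group ?G by (rule sym_group_is_group)
  have Ic: "I \<subseteq> carrier ?G"
    using I adj_permutes unfolding simple_transpositions_eq sym_group_carrier[symmetric] by blast
  have range: "k \<in> {1..<n + 1}" if "adj k \<in> I" for k
    using I that unfolding simple_transpositions_eq by (auto simp: adj_inj)
  have up: "transpose a (Suc (a + d)) \<in> generate ?G I"
    if "\<And>k. a \<le> k \<Longrightarrow> k \<le> a + d \<Longrightarrow> adj k \<in> I" for a d
    using that
  proof (induction d)
    case 0
    then show ?case by (simp add: generate.incl)
  next
    case (Suc d)
    let ?b = "Suc (a + d)"
    have s: "adj ?b \<in> generate ?G I" using Suc.prems by (intro generate.incl) simp
    moreover have "transpose a ?b \<in> generate ?G I" using Suc by simp
    ultimately have "adj ?b \<otimes>\<^bsub>?G\<^esub> transpose a ?b \<otimes>\<^bsub>?G\<^esub> adj ?b \<in> generate ?G I"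
      by (intro generate.eng)
    moreover have "adj ?b \<circ> transpose a ?b \<circ> adj ?b = transpose a (Suc ?b)"
      by (rule ext) (simp add: transpose_def)
    ultimately show ?case by (simp add: sym_group_mult)
  qed
  have "?T \<subseteq> generate ?G I"
  proof
    fix t assume "t \<in> ?T"
    then obtain a b where t: "t = transpose a b" "(a, b) \<in> run_rel (n + 1) I" "a \<noteq> b" by blast
    have main: "transpose a b \<in> generate ?G I" if "(a, b) \<in> run_rel (n + 1) I" "a < b" for a b
    proof -
      obtain d where d: "b = Suc (a + d)" using \<open>a < b\<close> by (metis less_iff_Suc_add)
      show ?thesis unfolding d by (rule up) (use that d in \<open>auto simp: run_rel_def\<close>)
    qed
    have "(b, a) \<in> run_rel (n + 1) I" using t(2) unfolding run_rel_def by blast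
    then show "t \<in> generate ?G I"
      using main[of a b] main[of b a] t by (metis linorder_neqE_nat transpose_commute)
  qed
  moreover have "I \<subseteq> ?T"
  proof
    fix s assume s: "s \<in> I"
    then obtain k where k: "s = adj k" using I unfolding simple_transpositions_eq by blast
    have "adj l \<in> I" if "k \<le> l \<and> l < Suc k \<or> Suc k \<le> l \<and> l < k" for l
    proof -
      have "l = k" using that by linarith
      then show ?thesis using s k by simp
    qed
    then have "(k, Suc k) \<in> run_rel (n + 1) I"
      using range[of k] s k unfolding run_rel_def by simp
    then show "s \<in> ?T" using k by (metis (mono_tags, lifting) mem_Collect_eq n_not_Suc_n)
  qed
  ultimately show ?thesis
    unfolding young_subgroup_def
    by (intro equalityI generate_subgroup_incl[OF _ generate_is_subgroup[OF Ic]] mono_generate)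
qed

lemma transpositions_in_sym_group:
  assumes "equiv {1..N} P"
  shows "{transpose a b | a b. (a, b) \<in> P \<and> a \<noteq> b} \<subseteq> carrier (sym_group N)"
proof
  fix t assume "t \<in> {transpose a b | a b. (a, b) \<in> P \<and> a \<noteq> b}"
  then obtain a b where t: "t = transpose a b" "(a, b) \<in> P" by blast
  then have "a \<in> {1..N}" "b \<in> {1..N}" using assms by (auto simp: equiv_def)
  then show "t \<in> carrier (sym_group N)" unfolding t(1) sym_group_carrier by (rule permutes_swap_id)
qed

text \<open>
  The relation is recovered from the subgroup as its orbit relation; this makes the parametrisation
  injective.
\<close>

lemma young_subgroup_orbits:
  assumes P: "equiv {1..N} P"
  shows "P = {(a, b). a \<in> {1..N} \<and> (\<exists>h \<in> young_subgroup N P. h a = b)}" (is "P = ?Q")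
proof
  have dom: "a \<in> {1..N}" if "(a, b) \<in> P" for a b using P that by (auto simp: equiv_def)
  have refl: "(a, a) \<in> P" if "a \<in> {1..N}" for a using P that by (meson equivE refl_onD)
  have sym: "(b, a) \<in> P" if "(a, b) \<in> P" for a b using P that by (meson equivE symD)
  have tr: "(a, c) \<in> P" if "(a, b) \<in> P" "(b, c) \<in> P" for a b c using P that by (meson equivE transD)
  have pres: "h permutes {1..N} \<and> (\<forall>a \<in> {1..N}. (a, h a) \<in> P)" if "h \<in> young_subgroup N P" for h
    using that unfolding young_subgroup_def
  proof (induction rule: generate.induct)
    case one
    show ?case unfolding sym_group_one using refl permutes_id[of "{1..N}"] by (metis id_apply)
  next
    case (incl t)
    then have perm: "t permutes {1..N}"
      using transpositions_in_sym_group[OF P] unfolding sym_group_carrier[symmetric] by blast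
    then show ?case using incl refl sym by (auto simp: transpose_def)
  next
    case (inv t)
    then have perm: "t permutes {1..N}"
      using transpositions_in_sym_group[OF P] unfolding sym_group_carrier[symmetric] by blast
    obtain a b where t: "t = transpose a b" "(a, b) \<in> P" using inv by blast
    have "inv\<^bsub>sym_group N\<^esub> t = t" unfolding sym_group_inv[OF perm] unfolding t(1) by simp
    then show ?case using perm inv.hyps refl sym unfolding t(1) by (metis t(2) transpose_apply_first transpose_apply_other transpose_apply_second)
  next
    case (eng h1 h2)
    then have "h1 \<circ> h2 permutes {1..N}" by (intro permutes_compose) auto
    moreover have "(a, h1 (h2 a)) \<in> P" if a: "a \<in> {1..N}" for a
      using eng a permutes_in_image[of h2 "{1..N}" a] tr by blast
    ultimately show ?case unfolding sym_group_mult o_apply by blast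
  qed
  then show "?Q \<subseteq> P" by auto
  show "P \<subseteq> ?Q"
  proof (rule subrelI)
    fix a b assume ab: "(a, b) \<in> P"
    show "(a, b) \<in> ?Q"
    proof (cases "a = b")
      case True
      have "id \<in> young_subgroup N P"
        unfolding young_subgroup_def sym_group_one[of N, symmetric] by (rule generate.one)
      then have "\<exists>h \<in> young_subgroup N P. h a = b" using True by (metis id_apply)
      then show ?thesis using dom[OF ab] by blast
    next
      case False
      then have "transpose a b \<in> young_subgroup N P"
        unfolding young_subgroup_def using ab by (intro generate.incl) blast
      then show ?thesis using dom[OF ab] by (auto intro!: bexI[of _ "transpose a b"])
    qed
  qed
qed

lemma inj_on_young_subgroup: "inj_on (young_subgroup N) {P. equiv {1..N} P}"
proof (rule inj_onI)
  fix P P' assume P: "P \<in> {P. equiv {1..N} P}" and P': "P' \<in> {P. equiv {1..N} P}"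
    and eq: "young_subgroup N P = young_subgroup N P'"
  have "P = {(a, b). a \<in> {1..N} \<and> (\<exists>h \<in> young_subgroup N P. h a = b)}"
    by (rule young_subgroup_orbits) (use P in blast)
  also have "\<dots> = P'"
    unfolding eq by (rule young_subgroup_orbits[symmetric]) (use P' in blast)
  finally show "P = P'" .
qed

lemma young_subgroup_conj:
  assumes P: "equiv {1..N} P" and g: "g permutes {1..N}"
  shows "g <#\<^bsub>sym_group N\<^esub> young_subgroup N P #>\<^bsub>sym_group N\<^esub> inv\<^bsub>sym_group N\<^esub> g =
    young_subgroup N (inv_image P (inv' g))"
proof -
  let ?G = "sym_group N"
  interpret group ?G by (rule sym_group_is_group)
  let ?c = "\<lambda>h. g \<otimes>\<^bsub>?G\<^esub> h \<otimes>\<^bsub>?G\<^esub> inv\<^bsub>?G\<^esub> g"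
  have gc: "g \<in> carrier ?G" using g by (simp add: sym_group_carrier)
  have "?c \<in> hom ?G ?G"
  proof (rule homI)
    show "?c x \<in> carrier ?G" if "x \<in> carrier ?G" for x
      by (intro m_closed inv_closed gc that)
    fix x y assume xy: "x \<in> carrier ?G" "y \<in> carrier ?G"
    have "?c x \<otimes>\<^bsub>?G\<^esub> ?c y = g \<otimes>\<^bsub>?G\<^esub> x \<otimes>\<^bsub>?G\<^esub> (inv\<^bsub>?G\<^esub> g \<otimes>\<^bsub>?G\<^esub> g) \<otimes>\<^bsub>?G\<^esub> y \<otimes>\<^bsub>?G\<^esub> inv\<^bsub>?G\<^esub> g"
      by (simp only: m_assoc m_closed inv_closed gc xy)
    then show "?c (x \<otimes>\<^bsub>?G\<^esub> y) = ?c x \<otimes>\<^bsub>?G\<^esub> ?c y"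
      by (simp only: l_inv r_one m_assoc m_closed inv_closed gc xy)
  qed
  then interpret c: group_hom ?G ?G ?c
    by unfold_locales
  have conj: "?c (transpose a b) = transpose (g a) (g b)" for a b
    unfolding sym_group_mult sym_group_inv[OF g] by (rule transpose_conj[OF permutes_bij[OF g]])
  have "g <#\<^bsub>?G\<^esub> young_subgroup N P #>\<^bsub>?G\<^esub> inv\<^bsub>?G\<^esub> g = ?c ` young_subgroup N P"
    by (auto simp: l_coset_def r_coset_def)
  also have "\<dots> = generate ?G (?c ` {transpose a b | a b. (a, b) \<in> P \<and> a \<noteq> b})"
    unfolding young_subgroup_def by (rule c.generate_img[OF transpositions_in_sym_group[OF P], symmetric])
  also have "?c ` {transpose a b | a b. (a, b) \<in> P \<and> a \<noteq> b} =
      {transpose a b | a b. (a, b) \<in> inv_image P (inv' g) \<and> a \<noteq> b}"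
  proof (intro equalityI subsetI)
    fix t assume "t \<in> ?c ` {transpose a b | a b. (a, b) \<in> P \<and> a \<noteq> b}"
    then obtain a b where "t = ?c (transpose a b)" and ab: "(a, b) \<in> P" "a \<noteq> b" by blast
    then have "t = transpose (g a) (g b)" using conj by metis
    moreover have "(g a, g b) \<in> inv_image P (inv' g)" "g a \<noteq> g b"
      using ab permutes_inverses(2)[OF g] permutes_inj[OF g] by (simp_all add: inj_eq)
    ultimately show "t \<in> {transpose a b | a b. (a, b) \<in> inv_image P (inv' g) \<and> a \<noteq> b}" by blast
  next
    fix t assume "t \<in> {transpose a b | a b. (a, b) \<in> inv_image P (inv' g) \<and> a \<noteq> b}"
    then obtain a b where t: "t = transpose a b" "(inv' g a, inv' g b) \<in> P" "a \<noteq> b" by auto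
    then have "t = ?c (transpose (inv' g a) (inv' g b))"
      unfolding conj permutes_inverses(1)[OF g] by simp
    moreover have "inv' g a \<noteq> inv' g b" using t(3) permutes_inverses(1)[OF g] by metis
    ultimately show "t \<in> ?c ` {transpose a b | a b. (a, b) \<in> P \<and> a \<noteq> b}" using t(2) by blast
  qed
  finally show ?thesis unfolding young_subgroup_def .
qed

lemma parabolic_class_eq:
  assumes I: "I \<subseteq> simple_transpositions n"
  shows "parabolic_class (sym_group (n + 1)) I =
    young_subgroup (n + 1) ` {inv_image (run_rel (n + 1) I) \<pi> | \<pi>. \<pi> permutes {1..n + 1}}"
proof (intro equalityI subsetI)
  fix H assume "H \<in> parabolic_class (sym_group (n + 1)) I"
  then obtain g where g: "g permutes {1..n + 1}"
    and H: "H = g <#\<^bsub>sym_group (n + 1)\<^esub> generate (sym_group (n + 1)) I #>\<^bsub>sym_group (n + 1)\<^esub> inv\<^bsub>sym_group (n + 1)\<^esub> g"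
    unfolding parabolic_class_def sym_group_carrier by blast
  have "H = young_subgroup (n + 1) (inv_image (run_rel (n + 1) I) (inv' g))"
    using H unfolding young_subgroup_run_rel[OF I, symmetric] young_subgroup_conj[OF equiv_run_rel g] .
  then show "H \<in> young_subgroup (n + 1) ` {inv_image (run_rel (n + 1) I) \<pi> | \<pi>. \<pi> permutes {1..n + 1}}"
    using permutes_inv[OF g] by blast
next
  fix H assume "H \<in> young_subgroup (n + 1) ` {inv_image (run_rel (n + 1) I) \<pi> | \<pi>. \<pi> permutes {1..n + 1}}"
  then obtain \<pi> where \<pi>: "\<pi> permutes {1..n + 1}" and H: "H = young_subgroup (n + 1) (inv_image (run_rel (n + 1) I) \<pi>)"
    by blast
  have g: "inv' \<pi> permutes {1..n + 1}" by (rule permutes_inv[OF \<pi>])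
  have "H = inv' \<pi> <#\<^bsub>sym_group (n + 1)\<^esub> generate (sym_group (n + 1)) I #>\<^bsub>sym_group (n + 1)\<^esub> inv\<^bsub>sym_group (n + 1)\<^esub> (inv' \<pi>)"
    unfolding H young_subgroup_run_rel[OF I, symmetric] young_subgroup_conj[OF equiv_run_rel g] permutes_inv_inv[OF \<pi>] ..
  then show "H \<in> parabolic_class (sym_group (n + 1)) I"
    unfolding parabolic_class_def sym_group_carrier using g by blast
qed

lemma exists_run_rel_conjugate:
  assumes P: "equiv {1..n + 1} P"
  shows "\<exists>I \<subseteq> simple_transpositions n. \<exists>\<tau>. \<tau> permutes {1..n + 1} \<and> P = inv_image (run_rel (n + 1) I) \<tau>"
proof -
  let ?N = "n + 1"
  obtain P0 \<tau> where P0: "equiv {1..?N} P0" and \<tau>: "\<tau> permutes {1..?N}" "P = inv_image P0 \<tau>"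
    and conv: "\<And>b. b \<in> {1..?N} // P0 \<Longrightarrow> \<exists>i j. 1 \<le> i \<and> j \<le> ?N \<and> b = {i..j}"
    using exists_convex_conjugate[OF P] by metis
  have dom: "a \<in> {1..?N}" "b \<in> {1..?N}" if "(a, b) \<in> P0" for a b using P0 that by (auto simp: equiv_def)
  have refl: "(a, a) \<in> P0" if "a \<in> {1..?N}" for a using P0 that by (meson equivE refl_onD)
  have sym: "(b, a) \<in> P0" if "(a, b) \<in> P0" for a b using P0 that by (meson equivE symD)
  have tr: "(a, c) \<in> P0" if "(a, b) \<in> P0" "(b, c) \<in> P0" for a b c using P0 that by (meson equivE transD)
  define I where "I = adj ` {k. (k, Suc k) \<in> P0}"
  have I_iff: "adj k \<in> I \<longleftrightarrow> (k, Suc k) \<in> P0" for k unfolding I_def by (auto simp: adj_inj)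
  have sub: "I \<subseteq> simple_transpositions n"
    unfolding I_def simple_transpositions_eq using dom by fastforce
  have chain: "(a, a + d) \<in> P0" if "a \<in> {1..?N}" "\<And>k. a \<le> k \<Longrightarrow> k < a + d \<Longrightarrow> (k, Suc k) \<in> P0" for a d
    using that
  proof (induction d)
    case 0
    then show ?case using refl by simp
  next
    case (Suc d)
    then have "(a, a + d) \<in> P0" "(a + d, Suc (a + d)) \<in> P0" by simp_all
    then show ?case using tr by simp
  qed
  have fwd: "(a, b) \<in> P0" if "(a, b) \<in> run_rel ?N I" "a \<le> b" for a b
  proof -
    obtain d where d: "b = a + d" using \<open>a \<le> b\<close> by (metis le_iff_add)
    show ?thesis unfolding d by (rule chain) (use that(1) d in \<open>auto simp: run_rel_def I_iff\<close>)
  qed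
  have bwd: "adj k \<in> I" if ab: "(a, b) \<in> P0" and k: "a \<le> k" "k < b" for a b k
  proof -
    let ?c = "P0 `` {a}"
    have c: "?c \<in> {1..?N} // P0" using dom[OF ab] by (intro quotientI)
    then obtain i j where ij: "?c = {i..j}" using conv by blast
    have "a \<in> ?c" "b \<in> ?c" using equiv_class_self[OF P0 dom(1)[OF ab]] ab by auto
    then have "k \<in> ?c" "Suc k \<in> ?c" unfolding ij using k by auto
    then show ?thesis unfolding I_iff using sym tr by blast
  qed
  have "run_rel ?N I = P0"
  proof (intro equalityI subrelI)
    fix a b assume ab: "(a, b) \<in> run_rel ?N I"
    then have "(b, a) \<in> run_rel ?N I" unfolding run_rel_def by blast
    then show "(a, b) \<in> P0" using fwd[OF ab] fwd[of b a] sym by (metis nat_le_linear)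
  next
    fix a b assume ab: "(a, b) \<in> P0"
    then show "(a, b) \<in> run_rel ?N I"
      unfolding run_rel_def using bwd[OF ab] bwd[OF sym[OF ab]] dom[OF ab] by blast
  qed
  then show ?thesis using sub \<tau> by blast
qed

text \<open>
  The equivalence relations fall into classes \<open>cls I\<close> according to the representative \<open>I\<close> to which their
  Young subgroup is conjugate. Such a class has \<open>\<bar>W\<bar> / N\<^sub>I\<close> elements, each of which contributes \<open>D\<^sub>I\<close>.
\<close>

theorem dimension_sum_eq:
  assumes R: "parabolic_representatives (sym_group (n + 1)) (simple_transpositions n) R"
  shows "of_nat (card (carrier (sym_group (n + 1)))) *
      (\<Sum>I \<in> R. of_nat (block_descent_count (sym_group (n + 1)) (simple_transpositions n) I) /
        of_nat (parabolic_normalizer_size (sym_group (n + 1)) I)) = dimension_formula (n + 1)"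
proof -
  let ?G = "sym_group (n + 1)" and ?S = "simple_transpositions n" and ?N = "n + 1"
  let ?E = "{P. equiv {1..?N} P}" and ?D = "\<lambda>P. fact ?N * rel_weight ?N P"
  interpret group ?G by (rule sym_group_is_group)
  have Rsub: "I \<subseteq> ?S" if "I \<in> R" for I using R that unfolding parabolic_representatives_def by blast
  have Rinj: "inj_on (parabolic_class ?G) R" and Rim: "parabolic_class ?G ` R = parabolic_class ?G ` Pow ?S"
    using R unfolding parabolic_representatives_def bij_betw_def by blast+
  have "finite ?S" unfolding simple_transpositions_eq by simp
  then have finR: "finite R" using R unfolding parabolic_representatives_def by (meson finite_Pow_iff finite_subset)
  define cls where "cls I = {P \<in> ?E. young_subgroup ?N P \<in> parabolic_class ?G I}" for I
  have cls_eq: "cls I = {inv_image (run_rel ?N I) \<pi> | \<pi>. \<pi> permutes {1..?N}}" if I: "I \<subseteq> ?S" for I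
  proof (intro equalityI subsetI)
    fix P assume "P \<in> cls I"
    then have P: "equiv {1..?N} P" "young_subgroup ?N P \<in> parabolic_class ?G I" unfolding cls_def by blast+
    then obtain \<pi> where \<pi>: "\<pi> permutes {1..?N}" "young_subgroup ?N P = young_subgroup ?N (inv_image (run_rel ?N I) \<pi>)"
      unfolding parabolic_class_eq[OF I] by blast
    have "P = inv_image (run_rel ?N I) \<pi>"
      by (rule inj_onD[OF inj_on_young_subgroup \<pi>(2)]) (use P(1) equiv_inv_image[OF equiv_run_rel \<pi>(1)] in blast)+
    then show "P \<in> {inv_image (run_rel ?N I) \<pi> | \<pi>. \<pi> permutes {1..?N}}" using \<pi>(1) by blast
  next
    fix P assume "P \<in> {inv_image (run_rel ?N I) \<pi> | \<pi>. \<pi> permutes {1..?N}}"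
    then obtain \<pi> where \<pi>: "\<pi> permutes {1..?N}" "P = inv_image (run_rel ?N I) \<pi>" by blast
    have "young_subgroup ?N P \<in> parabolic_class ?G I"
      unfolding parabolic_class_eq[OF I] using \<pi> by blast
    then show "P \<in> cls I" unfolding cls_def using \<pi> equiv_inv_image[OF equiv_run_rel \<pi>(1)] by blast
  qed
  have summand: "of_nat (card (carrier ?G)) * (of_nat (block_descent_count ?G ?S I) /
      of_nat (parabolic_normalizer_size ?G I)) = (\<Sum>P \<in> cls I. ?D P)" if "I \<in> R" for I
  proof -
    have I: "I \<subseteq> ?S" by (rule Rsub[OF that])
    have Ic: "I \<subseteq> carrier ?G"
      using I adj_permutes unfolding simple_transpositions_eq sym_group_carrier[symmetric] by blast
    let ?H = "generate ?G I" and ?\<phi> = "\<lambda>g. \<lambda>H \<in> {H. H \<subseteq> carrier ?G}. g <#\<^bsub>?G\<^esub> H #>\<^bsub>?G\<^esub> inv\<^bsub>?G\<^esub> g"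
    have H: "?H \<in> {H. H \<subseteq> carrier ?G}" using generate_in_carrier[OF Ic] by blast
    interpret act: group_action ?G "{H. H \<subseteq> carrier ?G}" ?\<phi>
      by (rule action_by_conjugation_on_power_set)
    have "orbit ?G ?\<phi> ?H = parabolic_class ?G I"
      unfolding orbit_def parabolic_class_def using H by auto
    then have os: "card (parabolic_class ?G I) * parabolic_normalizer_size ?G I = card (carrier ?G)"
      using act.orbit_stabilizer_theorem[OF H] unfolding parabolic_normalizer_size_def normalizer_def Coset.order_def by simp
    have "bij_betw (young_subgroup ?N) (cls I) (parabolic_class ?G I)"
      unfolding bij_betw_def cls_eq[OF I] parabolic_class_eq[OF I]
      by (intro conjI refl inj_on_subset[OF inj_on_young_subgroup])
        (use equiv_inv_image[OF equiv_run_rel] in blast)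
    then have card_cls: "card (cls I) = card (parabolic_class ?G I)" by (rule bij_betw_same_card)
    have "?D P = of_nat (block_descent_count ?G ?S I)" if "P \<in> cls I" for P
      using that unfolding cls_eq[OF I] block_descent_count_eq[OF I]
      by (auto simp: rel_weight_inv_image[OF equiv_run_rel])
    then have "(\<Sum>P \<in> cls I. ?D P) = of_nat (card (cls I)) * of_nat (block_descent_count ?G ?S I)" by simp
    moreover have "card (carrier ?G) \<noteq> 0"
      using card_permutations[of "{1..?N}" ?N] by (simp add: sym_group_def)
    then have "parabolic_normalizer_size ?G I \<noteq> 0" using os by (metis mult_0_right)
    ultimately show ?thesis
      unfolding card_cls os[symmetric] by simp
  qed
  have disj: "cls I \<inter> cls J = {}" if IJ: "I \<in> R" "J \<in> R" "I \<noteq> J" for I J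
  proof (rule ccontr)
    assume "cls I \<inter> cls J \<noteq> {}"
    then obtain \<pi> \<rho> where \<pi>: "\<pi> permutes {1..?N}" and \<rho>: "\<rho> permutes {1..?N}"
      and eq: "inv_image (run_rel ?N I) \<pi> = inv_image (run_rel ?N J) \<rho>"
      unfolding cls_eq[OF Rsub[OF IJ(1)]] cls_eq[OF Rsub[OF IJ(2)]] by blast
    (* A single common pullback makes the two sets of pullbacks equal. *)
    have shift: "inv_image (run_rel ?N I) \<sigma> \<in> {inv_image (run_rel ?N J) \<pi> | \<pi>. \<pi> permutes {1..?N}}"
      if "\<pi> permutes {1..?N}" "\<rho> permutes {1..?N}" "\<sigma> permutes {1..?N}"
        "inv_image (run_rel ?N I) \<pi> = inv_image (run_rel ?N J) \<rho>" for I J \<pi> \<rho> \<sigma>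
    proof -
      have "\<pi> \<circ> (inv' \<pi> \<circ> \<sigma>) = \<sigma>"
        by (metis comp_assoc id_comp permutes_inv_o(1)[OF that(1)])
      then have "inv_image (run_rel ?N I) \<sigma> = inv_image (inv_image (run_rel ?N I) \<pi>) (inv' \<pi> \<circ> \<sigma>)"
        unfolding inv_image_comp by simp
      also have "\<dots> = inv_image (run_rel ?N J) (\<rho> \<circ> (inv' \<pi> \<circ> \<sigma>))"
        unfolding that(4) inv_image_comp ..
      finally show ?thesis
        using permutes_compose[OF permutes_compose[OF that(3) permutes_inv[OF that(1)]] that(2)] by blast
    qed
    have "{inv_image (run_rel ?N I) \<pi> | \<pi>. \<pi> permutes {1..?N}} = {inv_image (run_rel ?N J) \<pi> | \<pi>. \<pi> permutes {1..?N}}"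
      using shift[OF \<pi> \<rho> _ eq] shift[OF \<rho> \<pi> _ eq[symmetric]] by blast
    then have "parabolic_class ?G I = parabolic_class ?G J"
      unfolding parabolic_class_eq[OF Rsub[OF IJ(1)]] parabolic_class_eq[OF Rsub[OF IJ(2)]] by simp
    then show False using inj_onD[OF Rinj] IJ by blast
  qed
  have cover: "(\<Union>I \<in> R. cls I) = ?E"
  proof (intro equalityI subsetI)
    fix P assume "P \<in> ?E"
    then obtain I \<tau> where I: "I \<subseteq> ?S" and \<tau>: "\<tau> permutes {1..?N}" "P = inv_image (run_rel ?N I) \<tau>"
      using exists_run_rel_conjugate by blast
    then have "P \<in> cls I" unfolding cls_eq[OF I] by blast
    moreover obtain J where "J \<in> R" "parabolic_class ?G J = parabolic_class ?G I"
      using Rim I by (metis (no_types, lifting) PowI imageE imageI)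
    ultimately show "P \<in> (\<Union>I \<in> R. cls I)" unfolding cls_def by blast
  qed (auto simp: cls_def)
  have fin_cls: "finite (cls I)" for I
    unfolding cls_def using finite_eqrels[of ?N] by simp
  have "of_nat (card (carrier ?G)) * (\<Sum>I \<in> R. of_nat (block_descent_count ?G ?S I) /
        of_nat (parabolic_normalizer_size ?G I)) = (\<Sum>I \<in> R. \<Sum>P \<in> cls I. ?D P)"
    unfolding sum_distrib_left by (rule sum.cong[OF refl summand])
  also have "\<dots> = (\<Sum>P \<in> (\<Union>I \<in> R. cls I). ?D P)"
    by (rule sum.UNION_disjoint[symmetric]) (use finR fin_cls disj in auto)
  finally show ?thesis unfolding cover dimension_formula_def .
qed

section \<open>The dimension formula\<close>

lemma rat_fun_var_square_generic:
  "rat_fun_var\<^sup>2 \<noteq> 0" "rat_fun_var\<^sup>2 \<noteq> 1" "rat_fun_var\<^sup>2 \<noteq> - 1"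
  by (simp_all add: rat_fun_var_def power2_eq_square fract_expand eq_fract one_pCons)

theorem theorem1p4:
  fixes R :: "nat \<Rightarrow> (nat \<Rightarrow> nat) set set"
  assumes "\<And>n. parabolic_representatives (sym_group (n + 1)) (simple_transpositions n) (R n)"
  shows
    "let F = (\<lambda>n. of_nat (card (carrier (sym_group (n + 1)))) *
                (\<Sum>I \<in> R n.
                   of_nat (block_descent_count (sym_group (n + 1)) (simple_transpositions n) I) /
                   of_nat (parabolic_normalizer_size (sym_group (n + 1)) I)) :: rat)
     in (\<forall>n\<ge>1.
           ring.finite_dimension (bt_A n) (bt_A_scalars n) (bt_A_braid_image n) \<and>
           of_nat (ring.dim (bt_A n) (bt_A_scalars n) (bt_A_braid_image n)) = F n) \<and>
        F 0 = 1 \<and> F 1 = 3 \<and> F 2 = 20 \<and> F 3 = 217 \<and> F 4 = 3364"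
proof -
  have vals: "dimension_formula (0 + 1) = 1" "dimension_formula (1 + 1) = 3" "dimension_formula (2 + 1) = 20"
    "dimension_formula (3 + 1) = 217" "dimension_formula (4 + 1) = 3364"
    using dimension_formula_values by (simp_all add: eval_nat_numeral)
  show ?thesis
    unfolding Let_def dimension_sum_eq[OF assms] vals
    by (intro conjI allI impI refl conjunct1[OF braid_image_dimension] conjunct2[OF braid_image_dimension]
      rat_fun_var_square_generic)
qed

end
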